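(* Let $m\ge 1$ and let $W\in C^2(\mathbb{R}^m\times\mathbb{R}^m;[0,\infty))$, $W=W(u,v)$, satisfy: (H1) the set $A:=\{u\in\mathbb{R}^m: W(u,0)=0\}$ is partitioned into two nonempty disjoint compact subsets $A^-$ and $A^+$; (H2) there exists an open set $\Omega\subset\mathbb{R}^m$ such that $A^-\subset\Omega$, $A^+\cap\overline{\Omega}=\emptyset$, and $W(u,v)>0$ for every $u\in\partial\Omega$ and every $v\in\mathbb{R}^m$; (H3) $\liminf_{|u|\to\infty}W(u,v)>0$ uniformly in $v\in\mathbb{R}^m$. Fix such an $\Omega$, and let $q\in\big(0,\tfrac{d(A^-,A^+)}{2}\big)$ be such that $\{u: d(u,A^-)\le q\}\subset\Omega$ and $\{u: d(u,A^+)\le q\}\cap\overline{\Omega}=\emptyset$. Let $\mathcal{A}$ and $J_{\mathbb{R}}$ be as defined in the context. Then $J_{\mathbb{R}}$ admits a minimizer $\bar u\in\mathcal{A}$: $$J_{\mathbb{R}}(\bar u)=\min_{u\in\mathcal{A}}J_{\mathbb{R}}(u)<+\infty.$$ Moreover: (i) $\bar u\in C^4(\mathbb{R};\mathbb{R}^m)$ and $\bar u$ solves $$\frac{d^4 u}{dx^4}+W_u(u,u')-W_{uv}(u,u')u'-W_{vv}(u,u')u''=0\quad\text{on }\mathbb{R};$$ (ii) $\lim_{x\to\pm\infty}d(\bar u(x),A^\pm)=0$; (iii) $\lim_{x\to\pm\infty}(\bar u'(x),\bar u''(x),\bar u'''(x))=(0,0,0)$; (iv) $H:=\frac12|\bar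 u''|^2-W(\bar u,\bar u')+W_v(\bar u,\bar u')\cdot\bar u'-\bar u'''\cdot\bar u'\equiv 0$ for all $x\in\mathbb{R}$.
   Context: $d$ is the Euclidean distance in $\mathbb{R}^m$ (between points, from a point to a set, or between sets). For $u\in W^{2,2}_{\mathrm{loc}}(\mathbb{R};\mathbb{R}^m)$ (identified with its $C^1$ representative), $$J_{\mathbb{R}}(u)=\int_{\mathbb{R}}\Big(\tfrac12|u''|^2+W(u,u')\Big)dx\in[0,+\infty].$$ The class $\mathcal{A}$ is the set of all $u\in W^{2,2}_{\mathrm{loc}}(\mathbb{R};\mathbb{R}^m)$ for which there exist real numbers $x_u^-<x_u^+$ (depending on $u$) with $d(u(x),A^-)\le q$ for all $x\le x_u^-$ and $d(u(x),A^+)\le q$ for all $x\ge x_u^+$. $W_u,W_v$ denote the gradients of $W$ in the first and second variable; $W_{uv}(u,u')u'$ and $W_{vv}(u,u')u''$ denote the derivatives of $W_v$ with respect to $u$ and $v$ applied to $u'$ and $u''$ respectively, so that $\frac{d}{dx}W_v(u,u')=W_{uv}(u,u')u'+W_{vv}(u,u')u''$. *)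

theory Defs
  imports "HOL-Analysis.Analysis"
begin

definition D :: "(real \<Rightarrow> 'a::real_normed_vector) \<Rightarrow> real \<Rightarrow> 'a" where
  "D f = (\<lambda>x. vector_derivative f (at x))"

definition Ck :: "nat \<Rightarrow> (real \<Rightarrow> 'a::real_normed_vector) \<Rightarrow> bool" where
  "Ck n f \<longleftrightarrow> (\<forall>k<n. \<forall>x. (D ^^ k) f differentiable (at x)) \<and> continuous_on UNIV ((D ^^ n) f)"

text \<open>Twice continuously (Frechet) differentiable on the whole space.\<close>

definition C2_on_space :: "('a::real_normed_vector \<Rightarrow> real) \<Rightarrow> bool" where
  "C2_on_space f \<longleftrightarrow>
    (\<exists>(f' :: 'a \<Rightarrow> 'a \<Rightarrow>\<^sub>L real) (f'' :: 'a \<Rightarrow> 'a \<Rightarrow>\<^sub>L 'a \<Rightarrow>\<^sub>L real).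
      (\<forall>x. (f has_derivative blinfun_apply (f' x)) (at x)) \<and>
      (\<forall>x. (f' has_derivative blinfun_apply (f'' x)) (at x)) \<and>
      continuous_on UNIV f'')"

definition grad :: "('a::real_inner \<Rightarrow> real) \<Rightarrow> 'a \<Rightarrow> 'a" where
  "grad f x = (THE g. GDERIV f x :> g)"

definition grad_u :: "('a::real_inner \<times> 'a \<Rightarrow> real) \<Rightarrow> 'a \<Rightarrow> 'a \<Rightarrow> 'a" where
  "grad_u W u v = grad (\<lambda>a. W (a, v)) u"

definition grad_v :: "('a::real_inner \<times> 'a \<Rightarrow> real) \<Rightarrow> 'a \<Rightarrow> 'a \<Rightarrow> 'a" where
  "grad_v W u v = grad (\<lambda>b. W (u, b)) v"

text \<open>The linear maps \<open>W_uv(u,v)\<close> and \<open>W_vv(u,v)\<close> applied to a vector \<open>w\<close>: the derivatives of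
  \<open>grad_v W\<close> in its first and second argument, in the direction \<open>w\<close>.\<close>

definition W_uv :: "('a::real_inner \<times> 'a \<Rightarrow> real) \<Rightarrow> 'a \<Rightarrow> 'a \<Rightarrow> 'a \<Rightarrow> 'a" where
  "W_uv W u v w = frechet_derivative (\<lambda>a. grad_v W a v) (at u) w"

definition W_vv :: "('a::real_inner \<times> 'a \<Rightarrow> real) \<Rightarrow> 'a \<Rightarrow> 'a \<Rightarrow> 'a \<Rightarrow> 'a" where
  "W_vv W u v w = frechet_derivative (\<lambda>b. grad_v W u b) (at v) w"

definition L1_loc :: "(real \<Rightarrow> 'a::euclidean_space) \<Rightarrow> bool" where
  "L1_loc f \<longleftrightarrow> f \<in> borel_measurable borel \<and> (\<forall>a b. set_integrable lborel {a..b} f)"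

definition L2_loc :: "(real \<Rightarrow> 'a::euclidean_space) \<Rightarrow> bool" where
  "L2_loc f \<longleftrightarrow> f \<in> borel_measurable borel \<and>
    (\<forall>a b. set_integrable lborel {a..b} (\<lambda>x. (norm (f x))\<^sup>2))"

text \<open>Test functions are the \<open>C^1\<close> functions with compact support, as in Brezis' treatment of
  Sobolev spaces in one dimension; smooth ones would give the same weak derivatives.\<close>

definition test_fun :: "(real \<Rightarrow> real) \<Rightarrow> bool" where
  "test_fun \<phi> \<longleftrightarrow> Ck 1 \<phi> \<and> compact (closure {x. \<phi> x \<noteq> 0})"

definition is_weak_deriv :: "(real \<Rightarrow> 'a::euclidean_space) \<Rightarrow> (real \<Rightarrow> 'a) \<Rightarrow> bool" where
  "is_weak_deriv f g \<longleftrightarrow> L1_loc f \<and> L1_loc g \<and>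
    (\<forall>\<phi>. test_fun \<phi> \<longrightarrow>
      (LINT x|lborel. D \<phi> x *\<^sub>R f x) = - (LINT x|lborel. \<phi> x *\<^sub>R g x))"

text \<open>A representative of the weak derivative, which is unique up to null sets.\<close>

definition weak_D :: "(real \<Rightarrow> 'a::euclidean_space) \<Rightarrow> real \<Rightarrow> 'a" where
  "weak_D f = (SOME g. is_weak_deriv f g)"

definition W12_loc :: "(real \<Rightarrow> 'a::euclidean_space) \<Rightarrow> bool" where
  "W12_loc f \<longleftrightarrow> L2_loc f \<and> (\<exists>g. L2_loc g \<and> is_weak_deriv f g)"

text \<open>The elements are the \<open>C^1\<close> representatives, so that \<open>D u\<close> is also the
  weak derivative of \<open>u\<close>.\<close>

definition W22_loc :: "(real \<Rightarrow> 'a::euclidean_space) \<Rightarrow> bool" where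
  "W22_loc u \<longleftrightarrow> Ck 1 u \<and> W12_loc u \<and> W12_loc (D u)"

text \<open>Only meaningful for \<open>u\<close> satisfying \<open>W22_loc\<close>; \<open>weak_D (D u)\<close> is the weak second
  derivative.\<close>

definition J :: "('a::euclidean_space \<times> 'a \<Rightarrow> real) \<Rightarrow> (real \<Rightarrow> 'a) \<Rightarrow> ennreal" where
  "J W u = (\<integral>\<^sup>+ x. ennreal (1/2 * (norm (weak_D (D u) x))\<^sup>2 + W (u x, D u x)) \<partial>lborel)"

definition admissible :: "'a::euclidean_space set \<Rightarrow> 'a set \<Rightarrow> real \<Rightarrow> (real \<Rightarrow> 'a) set" where
  "admissible Am Ap q = {u. W22_loc u \<and>
    (\<exists>xm xp. xm < xp \<and> (\<forall>x\<le>xm. infdist (u x) Am \<le> q) \<and> (\<forall>x\<ge>xp. infdist (u x) Ap \<le> q))}"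

end

theory Submission
  imports Defs "HOL-Complex_Analysis.Great_Picard"
begin

text \<open>
  A path of energy at most \<open>E\<close> has \<open>u''\<close> bounded in \<open>L\<^sup>2\<close>, and by coercivity it spends a bounded amount
  of time far from the origin; together these bound \<open>u\<close> and \<open>u'\<close> uniformly. Finite energy moreover
  forces \<open>u' \<longlongrightarrow> 0\<close> (a persisting velocity would carry the bounded path away) and then
  \<open>d(u, A) \<longlongrightarrow> 0\<close>.

  Translate a minimizing sequence so that each path leaves \<open>\<Omega>\<close> for the last time at \<open>x = 0\<close>. A
  subsequence converges pointwise together with its first derivatives, and the limit \<open>u\<close> has at most
  the infimal energy, satisfies \<open>u 0 \<in> \<partial>\<Omega>\<close> and stays outside \<open>\<Omega>\<close> for \<open>x \<ge> 0\<close>, so \<open>u\<close> tends to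
  \<open>A\<^sup>+\<close> at \<open>+\<infinity>\<close>. If \<open>u\<close> came arbitrarily close to \<open>A\<^sup>+\<close> also near \<open>-\<infinity>\<close>, then the paths of the
  sequence could be stopped at \<open>A\<^sup>+\<close> at a time \<open>-L \<le> -2\<close> at negligible cost, which saves the energy
  needed to cross \<open>\<partial>\<Omega>\<close> near \<open>x = 0\<close>, a contradiction. Hence \<open>u\<close> tends to \<open>A\<^sup>-\<close> at \<open>-\<infinity>\<close> and is a
  minimizer.

  The first variation, integrated by parts twice, says that \<open>u''\<close> differs from a \<open>C\<^sup>2\<close> function by an
  affine one; this gives the equation and its regularity. In the form \<open>(u''' - W\<^sub>v)' = - W\<^sub>u\<close>, with
  \<open>W\<^sub>u, W\<^sub>v \<longlongrightarrow> 0\<close> along the path, it shows that \<open>u'\<close> is nearly quadratic on bounded intervals, so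
  that \<open>u' \<longlongrightarrow> 0\<close> implies \<open>u'', u''' \<longlongrightarrow> 0\<close>. The Hamiltonian is constant and tends to \<open>0\<close>.
\<close>


section \<open>Primitives of locally integrable functions\<close>

text \<open>The obstacle is the unbounded domain: minimizing sequences may drift or split into
  several transitions, and the thresholds in the admissible class depend on the path, so the class
  is not closed under pointwise limits. Fixing the last exit from \<Omega> at 0 settles the right
  end, because lying outside \<Omega> for all x \<ge> 0 is a closed condition; only the left end
  calls for an energy comparison, and its gain is strictly positive because W is positive on the
  frontier whatever the velocity. Convexity enters only through |u''|^2. The second derivatives
  converge merely weakly, and their limit is recovered through its primitives, the velocities; the
  term W(u,u') depends on pointwise convergent quantities and passes to the limit by Fatou. Paths
  are carried as triples: u, u' and some representative of u''. The choice made by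
  \<open>weak_D\<close> is met only in the translation between such triples and
  \<open>W22_loc\<close> and \<open>J\<close>. Local absolute continuity, in the form of
  \<open>primitive\<close>, is the common language: it allows gluing, translation and integration by
  parts for second derivatives that are only square integrable.\<close>

text \<open>\<open>primitive f g\<close> says that \<open>f\<close> is locally absolutely continuous with derivative \<open>g\<close> almost
  everywhere. For continuous \<open>f\<close> this is the same as \<open>g\<close> being a weak derivative of \<open>f\<close>.\<close>

definition primitive :: "(real \<Rightarrow> 'a::euclidean_space) \<Rightarrow> (real \<Rightarrow> 'a) \<Rightarrow> bool" where
  "primitive f g \<longleftrightarrow> L1_loc g \<and> (\<forall>a b. a \<le> b \<longrightarrow> (g has_integral (f b - f a)) {a..b})"

lemma L1_loc_has_integral:
  assumes "L1_loc g"
  shows "(g has_integral (LBINT x:{a..b}. g x)) {a..b}"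
  using assms set_borel_integral_eq_integral[of "{a..b}" g]
  by (auto simp: L1_loc_def has_integral_integral)

lemma continuous_L1_loc:
  fixes g :: "real \<Rightarrow> 'a::euclidean_space"
  assumes "continuous_on UNIV g"
  shows "L1_loc g"
  unfolding L1_loc_def
  using assms borel_integrable_atLeastAtMost'[OF continuous_on_subset[OF assms]]
  by (auto intro: borel_measurable_continuous_onI)

lemma primitive_L1_loc: "primitive f g \<Longrightarrow> L1_loc g"
  by (simp add: primitive_def)

lemma primitive_borel: "primitive f g \<Longrightarrow> g \<in> borel_measurable borel"
  by (simp add: primitive_def L1_loc_def)

lemma primitive_has_integral:
  "primitive f g \<Longrightarrow> a \<le> b \<Longrightarrow> (g has_integral (f b - f a)) {a..b}"
  by (simp add: primitive_def)

lemma primitive_set_integral: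
  assumes "primitive f g" "a \<le> b"
  shows "(LBINT x:{a..b}. g x) = f b - f a"
  using L1_loc_has_integral[OF primitive_L1_loc[OF assms(1)], of a b]
    primitive_has_integral[OF assms] by (rule has_integral_unique)

lemma primitive_exists:
  assumes "L1_loc g"
  shows "\<exists>f. primitive f g \<and> f 0 = c"
proof -
  define f where "f x = c + (if 0 \<le> x then integral {0..x} g else - integral {x..0} g)" for x
  have i: "g integrable_on {a..b}" for a b
    using L1_loc_has_integral[OF assms] by blast
  have "(g has_integral (f b - f a)) {a..b}" if "a \<le> b" for a b
  proof -
    have "integral {a..b} g = f b - f a"
    proof -
      consider "0 \<le> a" | "a < 0" "0 \<le> b" | "b < 0" by linarith
      then show ?thesis
      proof cases
        case 1
        then have "integral {0..a} g + integral {a..b} g = integral {0..b} g"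
          using that i by (intro Henstock_Kurzweil_Integration.integral_combine) auto
        then show ?thesis using 1 that by (simp add: f_def algebra_simps)
      next
        case 2
        then have "integral {a..0} g + integral {0..b} g = integral {a..b} g"
          using that i by (intro Henstock_Kurzweil_Integration.integral_combine) auto
        then show ?thesis using 2 that by (simp add: f_def algebra_simps)
      next
        case 3
        then have "integral {a..b} g + integral {b..0} g = integral {a..0} g"
          using that i by (intro Henstock_Kurzweil_Integration.integral_combine) auto
        then show ?thesis using 3 that by (simp add: f_def algebra_simps)
      qed
    qed
    then show ?thesis using i by (metis integrable_integral)
  qed
  then have "primitive f g" using assms by (simp add: primitive_def)
  moreover have "f 0 = c" by (simp add: f_def)
  ultimately show ?thesis by blast
qed

lemma primitive_continuous:
  assumes "primitive f g"
  shows "continuous_on UNIV f"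
proof -
  have "isCont f x" for x
  proof -
    have i: "g integrable_on {x-1..x+1}"
      using primitive_has_integral[OF assms, of "x-1" "x+1"] by auto
    have "continuous_on {x-1..x+1} (\<lambda>y. f (x-1) + integral {x-1..y} g)"
      by (intro continuous_intros indefinite_integral_continuous_1 i)
    moreover have "f (x-1) + integral {x-1..y} g = f y" if "y \<in> {x-1..x+1}" for y
      using integral_unique[OF primitive_has_integral[OF assms, of "x-1" y]] that by auto
    ultimately have "continuous_on {x-1..x+1} f"
      using continuous_on_cong[of "{x-1..x+1}" _ f] by (metis (no_types, lifting))
    then have "continuous_on {x-1<..<x+1} f"
      by (rule continuous_on_subset) auto
    then show ?thesis
      by (simp add: continuous_on_eq_continuous_at)
  qed
  then show ?thesis by (simp add: continuous_at_imp_continuous_on)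
qed

lemma primitive_C1:
  assumes "\<And>x. (f has_vector_derivative g x) (at x)" "continuous_on UNIV g"
  shows "primitive f g"
  unfolding primitive_def
  using fundamental_theorem_of_calculus[of _ _ f g] assms
  by (auto intro!: continuous_L1_loc intro: has_vector_derivative_at_within)

lemma primitive_has_vector_derivative:
  assumes "primitive f g" "continuous_on UNIV g"
  shows "(f has_vector_derivative g x) (at x)"
proof -
  have "((\<lambda>y. integral {x-1..y} g) has_vector_derivative g x) (at x within {x-1..x+1})"
    by (rule integral_has_vector_derivative) (use assms in \<open>auto intro: continuous_on_subset\<close>)
  then have "((\<lambda>y. f (x-1) + integral {x-1..y} g) has_vector_derivative g x) (at x within {x-1..x+1})"
    by (auto intro!: derivative_eq_intros)
  then have "((\<lambda>y. f (x-1) + integral {x-1..y} g) has_vector_derivative g x) (at x)"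
    by (simp add: at_within_Icc_at)
  then show ?thesis
  proof (rule has_vector_derivative_transform_within_open)
    show "f (x-1) + integral {x-1..y} g = f y" if "y \<in> {x-1<..<x+1}" for y
      using integral_unique[OF primitive_has_integral[OF assms(1), of "x-1" y]] that by auto
  qed auto
qed

lemma L1_loc_bounded_linear:
  assumes "bounded_linear h" "L1_loc g"
  shows "L1_loc (\<lambda>x. h (g x))"
proof -
  interpret bounded_linear h by fact
  have "set_integrable lborel {a..b} (\<lambda>x. h (g x))" for a b
    using assms(2) integrable_bounded_linear[OF assms(1), of lborel "\<lambda>x. indicator {a..b} x *\<^sub>R g x"]
    by (simp add: L1_loc_def set_integrable_def scaleR)
  then show ?thesis using assms(2) measurable_compose[of g borel borel h borel]
      borel_measurable_continuous_onI[OF linear_continuous_on[OF assms(1)]]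
    by (auto simp: L1_loc_def)
qed

lemma primitive_bounded_linear:
  assumes "bounded_linear h" "primitive f g"
  shows "primitive (\<lambda>x. h (f x)) (\<lambda>x. h (g x))"
proof -
  interpret bounded_linear h by fact
  show ?thesis using assms has_integral_linear[OF _ assms(1), of g]
    by (auto simp: primitive_def o_def diff[symmetric] intro: L1_loc_bounded_linear)
qed

lemma L1_loc_add: "L1_loc f \<Longrightarrow> L1_loc g \<Longrightarrow> L1_loc (\<lambda>x. f x + g x)"
  by (auto simp: L1_loc_def)

lemma primitive_add:
  assumes "primitive f g" "primitive f' g'"
  shows "primitive (\<lambda>x. f x + f' x) (\<lambda>x. g x + g' x)"
  using assms unfolding primitive_def
  by (auto simp: add_diff_add intro!: L1_loc_add has_integral_add)

lemma primitive_scaleR: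
  "primitive f g \<Longrightarrow> primitive (\<lambda>x. c *\<^sub>R f x) (\<lambda>x. c *\<^sub>R g x)"
  by (rule primitive_bounded_linear[OF bounded_linear_scaleR_right])

lemma primitive_diff:
  assumes "primitive f g" "primitive f' g'"
  shows "primitive (\<lambda>x. f x - f' x) (\<lambda>x. g x - g' x)"
  using primitive_add[OF assms(1) primitive_scaleR[OF assms(2), of "-1"]] by simp

lemma primitive_const: "primitive (\<lambda>x. c) (\<lambda>x. 0)"
  by (rule primitive_C1) auto

lemma primitive_shift:
  assumes "primitive f g"
  shows "primitive (\<lambda>x. f (x + c)) (\<lambda>x. g (x + c))"
proof -
  have "set_integrable lborel {a..b} (\<lambda>x. g (x + c))" for a b
  proof -
    have "integrable lborel (\<lambda>x. indicator {a+c..b+c} x *\<^sub>R g x)"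
      using primitive_L1_loc[OF assms] by (simp add: L1_loc_def set_integrable_def)
    then have "integrable lborel (\<lambda>x. indicator {a+c..b+c} (c + 1 * x) *\<^sub>R g (c + 1 * x))"
      by (subst lborel_integrable_real_affine_iff[where f="\<lambda>x. indicator {a+c..b+c} x *\<^sub>R g x"]) auto
    moreover have "(indicator {a+c..b+c} (c + 1 * x) :: real) = indicator {a..b} x" for x
      by (auto simp: indicator_def)
    ultimately show ?thesis by (simp add: set_integrable_def add.commute)
  qed
  moreover have "(\<lambda>x. g (x + c)) \<in> borel_measurable borel"
    using primitive_borel[OF assms] by measurable
  moreover have "((\<lambda>x. g (x + c)) has_integral (f (b + c) - f (a + c))) {a..b}" if "a \<le> b" for a b
    using primitive_has_integral[OF assms, of "a+c" "b+c"] that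
      has_integral_shift_Icc_real[of g c "f (b + c) - f (a + c)" a b]
    by (simp add: o_def add.commute)
  ultimately show ?thesis by (simp add: primitive_def L1_loc_def)
qed

text \<open>Compact intervals generate the Borel sets and are stable under intersection, so a Dynkin
  argument extends the vanishing to all Borel sets, and a density all of whose integrals vanish is
  zero. Cutting off at \<open>n\<close> gives a globally integrable function, which the step for
  complements requires.\<close>

lemma L1_loc_AE_zero:
  fixes h :: "real \<Rightarrow> 'a::euclidean_space"
  assumes "L1_loc h" "\<And>a b. a \<le> b \<Longrightarrow> (LBINT x:{a..b}. h x) = 0"
  shows "AE x in lborel. h x = 0"
proof -
  have *: "AE x in lborel. indicator {-real n..real n} x *\<^sub>R h x = 0" for n
  proof (rule sigma_finite_measure.density_zero[OF sigma_finite_lborel])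
    let ?k = "\<lambda>x. indicator {-real n..real n} x *\<^sub>R h x"
    show int: "integrable lborel ?k"
      using assms(1) by (auto simp: L1_loc_def set_integrable_def)
    have si: "set_integrable lborel A ?k" if "A \<in> sets borel" for A
      unfolding set_integrable_def by (rule integrable_mult_indicator[OF _ int]) (use that in simp)
    have Icc: "(LBINT x:{a..b}. ?k x) = 0" for a b
    proof -
      have "(LBINT x:{a..b}. ?k x) = (LBINT x:{max a (-n)..min b n}. h x)"
        unfolding set_lebesgue_integral_def
        by (intro Bochner_Integration.integral_cong) (auto simp: indicator_def)
      also have "\<dots> = 0"
        using assms(2) by (cases "max a (-n) \<le> min b n") (auto simp: set_lebesgue_integral_def)
      finally show ?thesis .
    qed
    fix A :: "real set" assume "A \<in> sets lborel"
    then have A: "A \<in> sigma_sets UNIV (range (\<lambda>(a::real, b). {a..b}))"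
      by (simp add: borel_eq_atLeastAtMost)
    have st: "Int_stable (range (\<lambda>(a::real, b). {a..b}))"
      by (auto simp: Int_stable_def)
    have "range (\<lambda>(a::real, b). {a..b}) \<subseteq> Pow UNIV" by auto
    from st this A show "(LBINT x:A. ?k x) = 0"
    proof (induct rule: sigma_sets_induct_disjoint)
      case (basic A) then show ?case using Icc by auto
    next
      case empty show ?case by (simp add: set_lebesgue_integral_def)
    next
      case (compl A)
      then have A: "A \<in> sets borel"
        by (simp add: borel_eq_atLeastAtMost)
      have "(LBINT x:(UNIV - A) \<union> A. ?k x) = (LBINT x:UNIV-A. ?k x) + (LBINT x:A. ?k x)"
        using A by (intro set_integral_Un si) auto
      moreover have "(LBINT x:UNIV. ?k x) = (LBINT x:{-real n..real n}. ?k x)"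
        unfolding set_lebesgue_integral_def
        by (intro Bochner_Integration.integral_cong) (auto simp: indicator_def)
      ultimately show ?case using compl Icc by simp
    next
      case (union A)
      then have "A i \<in> sets borel" for i
        by (auto simp: borel_eq_atLeastAtMost)
      then have "(LBINT x:(\<Union>i. A i). ?k x) = (\<Sum>i. (LBINT x:A i. ?k x))"
        using union by (intro lebesgue_integral_countable_add si)
          (auto simp: disjoint_family_on_def)
      then show ?case using union by simp
    qed
  qed
  have "AE x in lborel. \<forall>n. indicator {-real n..real n} x *\<^sub>R h x = 0"
    unfolding AE_all_countable using * by blast
  then show ?thesis
  proof eventually_elim
    case (elim x)
    obtain n where "\<bar>x\<bar> \<le> real n" using real_arch_simple by blast
    then show ?case using elim[rule_format, of n] by (simp add: indicator_def abs_le_iff)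
  qed
qed

text \<open>Uniqueness makes the arbitrary choice in \<open>weak_D\<close> harmless under
  integrals.\<close>

lemma primitive_AE_unique:
  assumes "primitive f g" "primitive f h"
  shows "AE x in lborel. g x = h x"
proof -
  have p: "primitive (\<lambda>x. 0) (\<lambda>x. g x - h x)"
    using primitive_diff[OF assms] by simp
  have "AE x in lborel. g x - h x = 0"
    by (rule L1_loc_AE_zero[OF primitive_L1_loc[OF p]])
      (use primitive_set_integral[OF p] in simp)
  then show ?thesis by simp
qed

lemma L1_loc_scaleR_continuous:
  fixes g :: "real \<Rightarrow> 'a::euclidean_space"
  assumes "continuous_on UNIV \<phi>" "L1_loc g"
  shows "L1_loc (\<lambda>x. \<phi> x *\<^sub>R g x)"
proof -
  have m: "\<phi> \<in> borel_measurable borel" "g \<in> borel_measurable borel"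
    using assms borel_measurable_continuous_onI by (auto simp: L1_loc_def)
  have "set_integrable lborel {a..b} (\<lambda>x. \<phi> x *\<^sub>R g x)" for a b
  proof -
    have "bounded (\<phi> ` {a..b})"
      by (intro compact_imp_bounded compact_continuous_image continuous_on_subset[OF assms(1)]) auto
    then obtain C where "\<forall>y\<in>\<phi> ` {a..b}. norm y \<le> C"
      unfolding bounded_iff by blast
    then have C: "\<And>x. x \<in> {a..b} \<Longrightarrow> \<bar>\<phi> x\<bar> \<le> C"
      by auto
    show ?thesis
    proof (rule set_integrable_bound)
      show "set_integrable lborel {a..b} (\<lambda>x. C *\<^sub>R g x)"
        using assms(2) by (auto simp: L1_loc_def)
      show "set_borel_measurable lborel {a..b} (\<lambda>x. \<phi> x *\<^sub>R g x)"
        using m unfolding set_borel_measurable_def by measurable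
      show "AE x in lborel. x \<in> {a..b} \<longrightarrow> norm (\<phi> x *\<^sub>R g x) \<le> norm (C *\<^sub>R g x)"
      proof (intro AE_I2 impI)
        fix x assume "x \<in> {a..b}"
        then show "norm (\<phi> x *\<^sub>R g x) \<le> norm (C *\<^sub>R g x)"
          using C[of x] by (auto intro!: mult_right_mono)
      qed
    qed
  qed
  then show ?thesis using m by (auto simp: L1_loc_def)
qed

text \<open>Fubini for \<open>p x * g y\<close> on the square over \<open>{a..b}\<close>, cut along
  the diagonal: integrating the triangle \<open>y \<le> x\<close> in \<open>y\<close> first produces
  \<open>f x - f a\<close>, the other triangle in \<open>x\<close> first produces
  \<open>\<phi> y - \<phi> a\<close>. Since \<open>p\<close> and \<open>g\<close> are merely
  integrable, no pointwise product rule is used.\<close>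

lemma primitive_by_parts:
  fixes \<phi> f :: "real \<Rightarrow> real"
  assumes \<phi>: "primitive \<phi> p" and f: "primitive f g" and ab: "a \<le> b"
  shows "(LBINT x:{a..b}. p x * f x) + (LBINT x:{a..b}. \<phi> x * g x)
    = \<phi> b * f b - \<phi> a * f a"
proof -
  define P where "P x = indicator {a..b} x * p x" for x
  define G where "G x = indicator {a..b} x * g x" for x
  have iP: "integrable lborel P" and iG: "integrable lborel G"
    using primitive_L1_loc[OF \<phi>] primitive_L1_loc[OF f]
    unfolding P_def[abs_def] G_def[abs_def] by (simp_all add: L1_loc_def set_integrable_def)
  have [measurable]: "P \<in> borel_measurable borel" "G \<in> borel_measurable borel"
    using iP iG borel_measurable_integrable by force+
  have I: "integrable (lborel \<Otimes>\<^sub>M lborel) (\<lambda>(x, y). P x * G y)"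
  proof (rule lborel_pair.Fubini_integrable)
    show "integrable lborel (\<lambda>x. LBINT y. norm (case (x, y) of (x, y) \<Rightarrow> P x * G y))"
      using iP by (simp add: abs_mult)
  qed (use iG in auto)
  have I1: "integrable (lborel \<Otimes>\<^sub>M lborel) (\<lambda>(x, y). P x * (G y * of_bool (y \<le> x)))"
    by (rule Bochner_Integration.integrable_bound[OF I]) (auto simp: abs_mult mult_nonneg_nonneg)
  have I2: "integrable (lborel \<Otimes>\<^sub>M lborel) (\<lambda>(x, y). P x * (G y * of_bool (x < y)))"
    by (rule Bochner_Integration.integrable_bound[OF I]) (auto simp: abs_mult mult_nonneg_nonneg)
  have e1: "(LBINT y. G y * of_bool (y \<le> x)) = f x - f a" if "x \<in> {a..b}" for x
  proof -
    have "(LBINT y. G y * of_bool (y \<le> x)) = (LBINT y:{a..x}. g y)"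
      unfolding set_lebesgue_integral_def
      by (intro Bochner_Integration.integral_cong) (use that in \<open>auto simp: G_def indicator_def\<close>)
    then show ?thesis using primitive_set_integral[OF f, of a x] that by simp
  qed
  have e2: "(LBINT x. P x * of_bool (x < y)) = \<phi> y - \<phi> a" if "y \<in> {a..b}" for y
  proof -
    have "(LBINT x. P x * of_bool (x < y)) = (LBINT x:{a..y}. p x)"
      unfolding set_lebesgue_integral_def
    proof (rule integral_cong_AE)
      \<comment> \<open>The strict inequality differs from the closed interval only at the null
        point \<open>y\<close>.\<close>
      show "AE x in lborel. P x * of_bool (x < y) = indicat_real {a..y} x *\<^sub>R p x"
        using AE_lborel_singleton[of y] by eventually_elim (use that in \<open>auto simp: P_def indicator_def\<close>)
      show "(\<lambda>x. indicat_real {a..y} x *\<^sub>R p x) \<in> borel_measurable lborel"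
        using primitive_borel[OF \<phi>] by measurable
    qed measurable
    then show ?thesis using primitive_set_integral[OF \<phi>, of a y] that by simp
  qed
  have A: "(LBINT x. LBINT y. P x * (G y * of_bool (y \<le> x)))
    = (LBINT x:{a..b}. p x * (f x - f a))"
    unfolding set_lebesgue_integral_def
    by (intro Bochner_Integration.integral_cong) (auto simp: e1 P_def indicator_def)
  have "(LBINT x. LBINT y. P x * (G y * of_bool (x < y)))
    = (LBINT y. LBINT x. P x * (G y * of_bool (x < y)))"
    by (rule lborel_pair.Fubini_integral[symmetric, OF I2])
  also have "\<dots> = (LBINT y. G y * (LBINT x. P x * of_bool (x < y)))"
    by (simp add: mult.left_commute)
  also have "\<dots> = (LBINT y:{a..b}. (\<phi> y - \<phi> a) * g y)"
    unfolding set_lebesgue_integral_def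
    by (intro Bochner_Integration.integral_cong) (auto simp: e2 G_def indicator_def)
  finally have B: "(LBINT x. LBINT y. P x * (G y * of_bool (x < y)))
    = (LBINT y:{a..b}. (\<phi> y - \<phi> a) * g y)" .
  have "(LBINT x. LBINT y. P x * G y) = (LBINT x. P x) * (LBINT y. G y)"
    by simp
  also have "\<dots> = (\<phi> b - \<phi> a) * (f b - f a)"
    using primitive_set_integral[OF \<phi> ab] primitive_set_integral[OF f ab]
    by (simp add: P_def[abs_def] G_def[abs_def] set_lebesgue_integral_def)
  also have "(LBINT x. LBINT y. P x * G y)
    = integral\<^sup>L (lborel \<Otimes>\<^sub>M lborel) (\<lambda>(x, y). P x * G y)"
    by (rule lborel_pair.integral_fst[OF I])
  also have "\<dots> = integral\<^sup>L (lborel \<Otimes>\<^sub>M lborel) (\<lambda>z. (case z of (x, y) \<Rightarrow> P x * (G y * of_bool (y \<le> x)))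
     + (case z of (x, y) \<Rightarrow> P x * (G y * of_bool (x < y))))"
    by (intro Bochner_Integration.integral_cong) auto
  also have "\<dots> = (LBINT x. LBINT y. P x * (G y * of_bool (y \<le> x)))
    + (LBINT x. LBINT y. P x * (G y * of_bool (x < y)))"
    by (simp only: Bochner_Integration.integral_add[OF I1 I2] lborel_pair.integral_fst[OF I1]
        lborel_pair.integral_fst[OF I2])
  finally have S: "(LBINT x:{a..b}. p x * (f x - f a)) + (LBINT y:{a..b}. (\<phi> y - \<phi> a) * g y)
    = (\<phi> b - \<phi> a) * (f b - f a)"
    unfolding A B by simp
  have si: "set_integrable lborel {a..b} (\<lambda>x. f x * p x)" "set_integrable lborel {a..b} (\<lambda>x. \<phi> x * g x)"
    "set_integrable lborel {a..b} p" "set_integrable lborel {a..b} g"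
    using L1_loc_scaleR_continuous[OF primitive_continuous[OF f] primitive_L1_loc[OF \<phi>]]
      L1_loc_scaleR_continuous[OF primitive_continuous[OF \<phi>] primitive_L1_loc[OF f]]
      primitive_L1_loc[OF f] primitive_L1_loc[OF \<phi>]
    unfolding L1_loc_def real_scaleR_def by blast+
  have "(LBINT x:{a..b}. p x * (f x - f a)) = (LBINT x:{a..b}. f x * p x - f a * p x)"
    by (simp add: algebra_simps)
  also have "\<dots> = (LBINT x:{a..b}. f x * p x) - f a * (\<phi> b - \<phi> a)"
    using si by (simp add: set_integral_diff primitive_set_integral[OF \<phi> ab])
  finally have S1: "(LBINT x:{a..b}. p x * (f x - f a)) = (LBINT x:{a..b}. p x * f x) - f a * (\<phi> b - \<phi> a)"
    by (simp add: mult.commute)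
  have "(LBINT x:{a..b}. (\<phi> x - \<phi> a) * g x) = (LBINT x:{a..b}. \<phi> x * g x - \<phi> a * g x)"
    by (simp add: algebra_simps)
  also have "\<dots> = (LBINT x:{a..b}. \<phi> x * g x) - \<phi> a * (f b - f a)"
    using si by (simp add: set_integral_diff primitive_set_integral[OF f ab])
  finally have S2: "(LBINT x:{a..b}. (\<phi> x - \<phi> a) * g x) = (LBINT x:{a..b}. \<phi> x * g x) - \<phi> a * (f b - f a)" .
  show ?thesis using S unfolding S1 S2 by (simp add: algebra_simps)
qed

section \<open>Test functions and weak derivatives\<close>

lemma set_integral_support:
  fixes h :: "real \<Rightarrow> 'a::euclidean_space"
  assumes "\<And>x. x \<notin> A \<Longrightarrow> h x = 0"
  shows "(LBINT x. h x) = (LBINT x:A. h x)"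
  unfolding set_lebesgue_integral_def
  by (intro Bochner_Integration.integral_cong) (use assms in \<open>auto simp: indicator_def\<close>)

lemma continuous_support_integrable:
  fixes h :: "real \<Rightarrow> 'a::euclidean_space"
  assumes "continuous_on UNIV h" "\<And>x. x \<notin> {a..b} \<Longrightarrow> h x = 0"
  shows "integrable lborel h"
proof -
  have "integrable lborel (\<lambda>x. indicator {a..b} x *\<^sub>R h x)"
    by (intro borel_integrable_compact continuous_on_subset[OF assms(1)]) auto
  moreover have "(\<lambda>x. indicator {a..b} x *\<^sub>R h x) = h"
    using assms(2) by (auto simp: indicator_def)
  ultimately show ?thesis by simp
qed

lemma Ck_1_iff: "Ck 1 f \<longleftrightarrow> (\<forall>x. (f has_vector_derivative D f x) (at x)) \<and> continuous_on UNIV (D f)"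
  by (simp add: Ck_def D_def vector_derivative_works)

lemma test_fun_primitive:
  assumes "test_fun \<phi>"
  shows "primitive \<phi> (D \<phi>)"
  using assms unfolding test_fun_def Ck_1_iff by (auto intro: primitive_C1)

lemma test_fun_support:
  assumes "test_fun \<phi>"
  obtains R where "R > 0" "\<And>x. x \<notin> {-R..R} \<Longrightarrow> \<phi> x = 0" "\<And>x. x \<notin> {-R..R} \<Longrightarrow> D \<phi> x = 0"
    "\<phi> R = 0" "\<phi> (-R) = 0"
proof -
  have "bounded (closure {x. \<phi> x \<noteq> 0})"
    using assms compact_imp_bounded by (auto simp: test_fun_def)
  then obtain B where "\<And>x. x \<in> closure {x. \<phi> x \<noteq> 0} \<Longrightarrow> \<bar>x\<bar> \<le> B"
    by (auto simp: bounded_iff)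
  then have B: "\<And>x. \<phi> x \<noteq> 0 \<Longrightarrow> \<bar>x\<bar> \<le> B"
    using closure_subset by force
  \<comment> \<open>The margin 1 puts \<open>R\<close> and \<open>-R\<close> themselves outside the
    support, so boundary terms at these points vanish.\<close>
  define R where "R = \<bar>B\<bar> + 1"
  have z: "\<phi> x = 0" if "\<bar>x\<bar> > \<bar>B\<bar>" for x using B[of x] that by force
  have "D \<phi> x = 0" if "x \<notin> {-R..R}" for x
  proof -
    have "((\<lambda>x. 0) has_vector_derivative 0) (at x)" by simp
    then have "(\<phi> has_vector_derivative 0) (at x)"
      by (rule has_vector_derivative_transform_within_open[where S="- {-R..R}"])
        (use that z in \<open>auto simp: R_def\<close>)
    then show ?thesis by (simp add: D_def vector_derivative_at)
  qed
  then show ?thesis by (rule that[of R, rotated 2]) (use z in \<open>auto simp: R_def\<close>)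
qed

text \<open>Integration by parts is scalar, so it is applied to each coordinate; on an interval that
  contains the support of the test function the boundary terms vanish.\<close>

lemma primitive_imp_weak_deriv:
  fixes f :: "real \<Rightarrow> 'a::euclidean_space"
  assumes f: "primitive f g"
  shows "is_weak_deriv f g"
  unfolding is_weak_deriv_def
proof (intro conjI allI impI)
  show "L1_loc f" by (intro continuous_L1_loc primitive_continuous[OF f])
  show "L1_loc g" using f by (rule primitive_L1_loc)
  fix \<phi> assume t: "test_fun \<phi>"
  obtain R where R: "R > 0" "\<And>x. x \<notin> {-R..R} \<Longrightarrow> \<phi> x = 0" "\<And>x. x \<notin> {-R..R} \<Longrightarrow> D \<phi> x = 0"
    "\<phi> R = 0" "\<phi> (-R) = 0" using test_fun_support[OF t] by metis
  have p: "primitive \<phi> (D \<phi>)" by (rule test_fun_primitive[OF t])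
  have cD: "continuous_on UNIV (D \<phi>)" using t unfolding test_fun_def Ck_1_iff by blast
  have L: "L1_loc (\<lambda>x. D \<phi> x *\<^sub>R f x)" "L1_loc (\<lambda>x. \<phi> x *\<^sub>R g x)"
    using L1_loc_scaleR_continuous[OF cD \<open>L1_loc f\<close>]
      L1_loc_scaleR_continuous[OF primitive_continuous[OF p] \<open>L1_loc g\<close>] .
  have inn: "(LBINT x:{-R..R}. h x) \<bullet> e = (LBINT x:{-R..R}. h x \<bullet> e)"
    if "L1_loc h" for h :: "real \<Rightarrow> 'a" and e
    using that integral_inner_left[of e lborel "\<lambda>x. indicator {-R..R} x *\<^sub>R h x"]
    by (simp add: set_lebesgue_integral_def set_integrable_def L1_loc_def)
  have "(LBINT x:{-R..R}. D \<phi> x *\<^sub>R f x) = - (LBINT x:{-R..R}. \<phi> x *\<^sub>R g x)"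
  proof (rule euclidean_eqI)
    fix e :: 'a assume "e \<in> Basis"
    have "primitive (\<lambda>x. f x \<bullet> e) (\<lambda>x. g x \<bullet> e)"
      by (rule primitive_bounded_linear[OF bounded_linear_inner_left f])
    from primitive_by_parts[OF p this, of "-R" R] R
    show "(LBINT x:{-R..R}. D \<phi> x *\<^sub>R f x) \<bullet> e = - (LBINT x:{-R..R}. \<phi> x *\<^sub>R g x) \<bullet> e"
      using inn[OF L(1)] inn[OF L(2)] by simp
  qed
  then show "(LBINT x. D \<phi> x *\<^sub>R f x) = - (LBINT x. \<phi> x *\<^sub>R g x)"
    using set_integral_support[of "{-R..R}" "\<lambda>x. D \<phi> x *\<^sub>R f x"]
      set_integral_support[of "{-R..R}" "\<lambda>x. \<phi> x *\<^sub>R g x"] R by simp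
qed

text \<open>The test function is built so that its derivative is a hat around \<open>x0\<close>
  minus the same hat around \<open>y0\<close>. If \<open>h x0\<close> and \<open>h y0\<close>
  differed, a narrow hat would detect the difference in the direction
  \<open>e = h x0 - h y0\<close>.\<close>

lemma continuous_weak_const:
  fixes h :: "real \<Rightarrow> 'a::euclidean_space"
  assumes ch: "continuous_on UNIV h"
    and h: "\<And>\<phi>. test_fun \<phi> \<Longrightarrow> (LBINT x. D \<phi> x *\<^sub>R h x) = 0"
  shows "h x0 = h y0"
proof (rule ccontr)
  assume ne: "h x0 \<noteq> h y0"
  define e where "e = h x0 - h y0"
  define k where "k t = (h (x0 + t) - h (y0 + t)) \<bullet> e" for t
  have k0: "k 0 > 0" using ne by (simp add: k_def e_def)
  have ck: "continuous_on UNIV k"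
    unfolding k_def by (intro continuous_intros continuous_on_compose2[OF ch]) auto
  then have "isCont k 0" by (simp add: continuous_on_eq_continuous_at)
  then have "\<exists>\<delta>>0. \<forall>t. dist t 0 < \<delta> \<longrightarrow> dist (k t) (k 0) < k 0 / 2"
    using k0 unfolding continuous_at_eps_delta by (metis half_gt_zero)
  then obtain \<delta>' where "\<delta>' > 0" and k': "\<And>t. \<bar>t\<bar> < \<delta>' \<Longrightarrow> \<bar>k t - k 0\<bar> < k 0 / 2"
    by (auto simp: dist_real_def)
  define \<delta> where "\<delta> = \<delta>' / 2"
  have \<delta>: "\<delta> > 0" using \<open>\<delta>' > 0\<close> by (simp add: \<delta>_def)
  have k: "k t > k 0 / 2" if "\<bar>t\<bar> \<le> \<delta>" for t
    using k'[of t] that \<open>\<delta>' > 0\<close> unfolding \<delta>_def by linarith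
  define \<psi> where "\<psi> t = max 0 (\<delta> - \<bar>t\<bar>)" for t
  have c\<psi>: "continuous_on UNIV \<psi>" unfolding \<psi>_def by (intro continuous_intros)
  obtain \<Psi> where \<Psi>: "primitive \<Psi> \<psi>" using primitive_exists[OF continuous_L1_loc[OF c\<psi>]] by blast
  have d\<Psi>: "(\<Psi> has_vector_derivative \<psi> x) (at x)" for x
    by (rule primitive_has_vector_derivative[OF \<Psi> c\<psi>])
  have \<Psi>r: "\<Psi> x = \<Psi> \<delta>" if "x \<ge> \<delta>" for x
  proof -
    have "(\<psi> has_integral 0) {\<delta>..x}"
      by (rule has_integral_is_0) (auto simp: \<psi>_def)
    from has_integral_unique[OF primitive_has_integral[OF \<Psi> that] this] show ?thesis by simp
  qed
  have \<Psi>l: "\<Psi> x = \<Psi> (-\<delta>)" if "x \<le> -\<delta>" for x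
  proof -
    have "(\<psi> has_integral 0) {x..-\<delta>}"
      by (rule has_integral_is_0) (auto simp: \<psi>_def)
    from has_integral_unique[OF primitive_has_integral[OF \<Psi> that] this] show ?thesis by simp
  qed
  \<comment> \<open>\<open>\<Psi>\<close> is constant on either side of the hat; the difference of
    two translates cancels both constants far out, and this makes the support compact.\<close>
  define \<Phi> where "\<Phi> x = \<Psi> (x - x0) - \<Psi> (x - y0)" for x
  have d\<Phi>: "(\<Phi> has_vector_derivative (\<psi> (x - x0) - \<psi> (x - y0))) (at x)" for x
  proof -
    have "primitive (\<lambda>x. \<Psi> (x + - x0) - \<Psi> (x + - y0)) (\<lambda>x. \<psi> (x + - x0) - \<psi> (x + - y0))"
      by (intro primitive_diff primitive_shift \<Psi>)
    moreover have "continuous_on UNIV (\<lambda>x. \<psi> (x + - x0) - \<psi> (x + - y0))"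
      by (intro continuous_intros continuous_on_compose2[OF c\<psi>]) auto
    ultimately show ?thesis
      unfolding \<Phi>_def using primitive_has_vector_derivative by fastforce
  qed
  have D\<Phi>: "D \<Phi> = (\<lambda>x. \<psi> (x - x0) - \<psi> (x - y0))"
    unfolding D_def using d\<Phi> by (auto simp: vector_derivative_at)
  have "{x. \<Phi> x \<noteq> 0} \<subseteq> {- \<delta> - \<bar>x0\<bar> - \<bar>y0\<bar>..\<delta> + \<bar>x0\<bar> + \<bar>y0\<bar>}"
  proof
    fix x assume x: "x \<in> {x. \<Phi> x \<noteq> 0}"
    have "\<not> (x > \<delta> + \<bar>x0\<bar> + \<bar>y0\<bar>)"
    proof
      assume "x > \<delta> + \<bar>x0\<bar> + \<bar>y0\<bar>"
      then have "x - x0 \<ge> \<delta>" "x - y0 \<ge> \<delta>" by linarith+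
      then show False using x \<Psi>r[of "x - x0"] \<Psi>r[of "x - y0"] by (simp add: \<Phi>_def)
    qed
    moreover have "\<not> (x < - \<delta> - \<bar>x0\<bar> - \<bar>y0\<bar>)"
    proof
      assume "x < - \<delta> - \<bar>x0\<bar> - \<bar>y0\<bar>"
      then have "x - x0 \<le> -\<delta>" "x - y0 \<le> -\<delta>" by linarith+
      then show False using x \<Psi>l[of "x - x0"] \<Psi>l[of "x - y0"] by (simp add: \<Phi>_def)
    qed
    ultimately show "x \<in> {- \<delta> - \<bar>x0\<bar> - \<bar>y0\<bar>..\<delta> + \<bar>x0\<bar> + \<bar>y0\<bar>}" by auto
  qed
  then have "bounded {x. \<Phi> x \<noteq> 0}" by (rule bounded_subset[rotated]) simp
  moreover have "Ck 1 \<Phi>"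
    unfolding Ck_1_iff D\<Phi> using d\<Phi>
    by (auto intro!: continuous_intros continuous_on_compose2[OF c\<psi>])
  ultimately have "test_fun \<Phi>" by (simp add: test_fun_def compact_closure)
  from h[OF this] have z: "(LBINT x. (\<psi> (x - x0) - \<psi> (x - y0)) *\<^sub>R h x) = 0"
    by (simp add: D\<Phi>)
  have i: "integrable lborel (\<lambda>x. \<psi> (x - c) *\<^sub>R h x)" for c
  proof (rule continuous_support_integrable[of _ "c - \<delta>" "c + \<delta>"])
    show "continuous_on UNIV (\<lambda>x. \<psi> (x - c) *\<^sub>R h x)"
      by (intro continuous_intros continuous_on_compose2[OF c\<psi>] ch) auto
  qed (auto simp: \<psi>_def)
  have s: "(LBINT x. \<psi> (x - c) *\<^sub>R h x) = (LBINT t. \<psi> t *\<^sub>R h (c + t))" for c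
    using lborel_integral_real_affine[of 1 "\<lambda>x. \<psi> (x - c) *\<^sub>R h x" c] by simp
  have i': "integrable lborel (\<lambda>t. \<psi> t *\<^sub>R h (c + t))" for c
    using lborel_integrable_real_affine_iff[of 1 "\<lambda>x. \<psi> (x - c) *\<^sub>R h x" c] i[of c] by simp
  have "(LBINT t. \<psi> t *\<^sub>R h (x0 + t)) = (LBINT t. \<psi> t *\<^sub>R h (y0 + t))"
    using z i[of x0] i[of y0] by (simp add: scaleR_left_diff_distrib s)
  then have "(LBINT t. \<psi> t *\<^sub>R h (x0 + t) - \<psi> t *\<^sub>R h (y0 + t)) \<bullet> e = 0"
    using i' by simp
  then have "(LBINT t. (\<psi> t *\<^sub>R h (x0 + t) - \<psi> t *\<^sub>R h (y0 + t)) \<bullet> e) = 0"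
    using i' by (subst (asm) integral_inner_left[symmetric]) auto
  moreover have "(\<psi> t *\<^sub>R h (x0 + t) - \<psi> t *\<^sub>R h (y0 + t)) \<bullet> e = \<psi> t * k t" for t
    by (simp add: k_def algebra_simps)
  ultimately have z0: "(LBINT t. \<psi> t * k t) = 0" by simp
  \<comment> \<open>On the inner half of its support the hat is at least \<delta>/2 and
    \<open>k\<close> is at least half of \<open>k 0\<close>; elsewhere the integrand is
    nonnegative.\<close>
  have "(LBINT t. indicator {-\<delta>/2..\<delta>/2} t * (\<delta>/2 * (k 0 / 2))) \<le> (LBINT t. \<psi> t * k t)"
  proof (rule integral_mono)
    show "integrable lborel (\<lambda>t. \<psi> t * k t)"
      by (rule continuous_support_integrable[of _ "- \<delta>" "\<delta>"])
        (auto intro!: continuous_intros c\<psi> ck simp: \<psi>_def)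
    show "integrable lborel (\<lambda>t. indicator {-\<delta>/2..\<delta>/2} t * (\<delta>/2 * (k 0 / 2)))"
      by (intro integrable_mult_left integrable_real_indicator) (auto simp: emeasure_lborel_Icc_eq)
    show "indicator {-\<delta>/2..\<delta>/2} t * (\<delta>/2 * (k 0 / 2)) \<le> \<psi> t * k t" for t
    proof (cases "\<bar>t\<bar> \<le> \<delta>/2")
      case True
      then have "\<delta>/2 \<le> \<psi> t" "k 0 / 2 \<le> k t"
        using k[of t] \<delta> unfolding \<psi>_def by linarith+
      then have "\<delta>/2 * (k 0 / 2) \<le> \<psi> t * k t"
        using k0 \<delta> by (intro mult_mono[of "\<delta>/2"]) linarith+
      moreover have "t \<in> {-\<delta>/2..\<delta>/2}" using True by (auto simp: abs_le_iff)
      ultimately show ?thesis by (metis indicator_simps(1) mult_1)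
    next
      case False
      have "\<psi> t * k t \<ge> 0"
      proof (cases "\<bar>t\<bar> \<le> \<delta>")
        case True
        then have "0 \<le> \<psi> t" "0 \<le> k t" using k[of t] k0 unfolding \<psi>_def by linarith+
        then show ?thesis by (rule mult_nonneg_nonneg)
      next
        case False
        then have "\<psi> t = 0" unfolding \<psi>_def by linarith
        then show ?thesis by simp
      qed
      moreover have "t \<notin> {-\<delta>/2..\<delta>/2}" using False by (auto simp: abs_le_iff)
      ultimately show ?thesis by (metis indicator_simps(2) mult_zero_left)
    qed
  qed
  moreover have "(LBINT t. indicator {-\<delta>/2..\<delta>/2} t * (\<delta>/2 * (k 0 / 2))) > 0"
    using k0 \<delta> by simp
  ultimately show False using z0 by linarith
qed

text \<open>Subtracting any primitive of \<open>g\<close> leaves a continuous function with weak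
  derivative zero, hence a constant.\<close>

lemma weak_deriv_imp_primitive:
  fixes f :: "real \<Rightarrow> 'a::euclidean_space"
  assumes cf: "continuous_on UNIV f" and w: "is_weak_deriv f g"
  shows "primitive f g"
proof -
  have "L1_loc g" using w by (simp add: is_weak_deriv_def)
  then obtain F where F: "primitive F g" using primitive_exists by blast
  have cF: "continuous_on UNIV F" by (rule primitive_continuous[OF F])
  have "f x - F x = f y - F y" for x y
  proof (rule continuous_weak_const)
    show "continuous_on UNIV (\<lambda>x. f x - F x)" by (intro continuous_intros cf cF)
    fix \<phi> assume t: "test_fun \<phi>"
    obtain R where R: "R > 0" "\<And>x. x \<notin> {-R..R} \<Longrightarrow> \<phi> x = 0" "\<And>x. x \<notin> {-R..R} \<Longrightarrow> D \<phi> x = 0"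
      "\<phi> R = 0" "\<phi> (-R) = 0" using test_fun_support[OF t] by metis
    have cD: "continuous_on UNIV (D \<phi>)" using t unfolding test_fun_def Ck_1_iff by blast
    have "integrable lborel (\<lambda>x. D \<phi> x *\<^sub>R f x)" "integrable lborel (\<lambda>x. D \<phi> x *\<^sub>R F x)"
      by (rule continuous_support_integrable[of _ "-R" R];
          use R in \<open>auto intro!: continuous_intros cD cf cF\<close>)+
    then show "(LBINT x. D \<phi> x *\<^sub>R (f x - F x)) = 0"
      using w primitive_imp_weak_deriv[OF F] t
      by (simp add: is_weak_deriv_def scaleR_right_diff_distrib)
  qed
  then have "f = (\<lambda>x. F x + (f 0 - F 0))"
    by (metis add.commute diff_add_cancel)
  then show ?thesis using primitive_add[OF F primitive_const[of "f 0 - F 0"]] by simp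
qed

section \<open>Local square integrability and Holder estimates\<close>

lemma L2_loc_imp_L1_loc:
  assumes "L2_loc g"
  shows "L1_loc g"
proof -
  have m: "g \<in> borel_measurable borel" using assms by (simp add: L2_loc_def)
  have "set_integrable lborel {a..b} g" for a b
  proof (rule set_integrable_bound)
    have "set_integrable lborel {a..b} (\<lambda>x. (norm (g x))\<^sup>2)"
      using assms by (simp add: L2_loc_def)
    moreover have "set_integrable lborel {a..b} (\<lambda>x. 1::real)"
      by (rule borel_integrable_atLeastAtMost') simp
    ultimately show "set_integrable lborel {a..b} (\<lambda>x. 1 + (norm (g x))\<^sup>2)" by (rule set_integral_add(1)[rotated])
    show "set_borel_measurable lborel {a..b} g"
      using m unfolding set_borel_measurable_def by measurable
    show "AE x in lborel. x \<in> {a..b} \<longrightarrow> norm (g x) \<le> norm (1 + (norm (g x))\<^sup>2)"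
    proof (intro AE_I2 impI)
      fix x
      have "0 \<le> (norm (g x) - 1)\<^sup>2 + norm (g x)" by simp
      then have "norm (g x) \<le> 1 + (norm (g x))\<^sup>2" by (simp add: power2_eq_square algebra_simps)
      then show "norm (g x) \<le> norm (1 + (norm (g x))\<^sup>2)" by simp
    qed
  qed
  then show ?thesis using m by (simp add: L1_loc_def)
qed

lemma continuous_L2_loc:
  fixes g :: "real \<Rightarrow> 'a::euclidean_space"
  assumes "continuous_on UNIV g"
  shows "L2_loc g"
proof -
  have "continuous_on {a..b} (\<lambda>x. (norm (g x))\<^sup>2)" for a b
    by (intro continuous_intros continuous_on_subset[OF assms]) auto
  from borel_integrable_atLeastAtMost'[OF this] show ?thesis
    using borel_measurable_continuous_onI[OF assms] by (simp add: L2_loc_def)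
qed

lemma L2_loc_cong_AE:
  assumes "L2_loc g" "AE x in lborel. g x = h x" "h \<in> borel_measurable borel"
  shows "L2_loc h"
proof -
  have [measurable]: "g \<in> borel_measurable borel" "h \<in> borel_measurable borel"
    using assms by (simp_all add: L2_loc_def)
  have "set_integrable lborel {a..b} (\<lambda>x. (norm (h x))\<^sup>2)
    = set_integrable lborel {a..b} (\<lambda>x. (norm (g x))\<^sup>2)" for a b
  proof (rule set_integrable_cong_AE)
    show "AE x\<in>{a..b} in lborel. (norm (h x))\<^sup>2 = (norm (g x))\<^sup>2"
      using assms(2) by eventually_elim simp
  qed measurable
  then show ?thesis using assms by (simp add: L2_loc_def)
qed

lemma L2_loc_integrable:
  fixes g :: "real \<Rightarrow> 'a::euclidean_space"
  assumes "g \<in> borel_measurable borel" "integrable lborel (\<lambda>x. (norm (g x))\<^sup>2)"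
  shows "L2_loc g"
  using assms integrable_mult_indicator[OF _ assms(2)] by (simp add: L2_loc_def set_integrable_def)

lemma L2_loc_inner:
  fixes f g :: "real \<Rightarrow> 'a::euclidean_space"
  assumes "L2_loc f" "L2_loc g"
  shows "set_integrable lborel {a..b} (\<lambda>x. f x \<bullet> g x)"
proof (rule set_integrable_bound)
  have [measurable]: "g \<in> borel_measurable borel" "f \<in> borel_measurable borel"
    using assms by (simp_all add: L2_loc_def)
  show "set_integrable lborel {a..b} (\<lambda>x. (norm (f x))\<^sup>2 + (norm (g x))\<^sup>2)"
    using assms by (intro set_integral_add(1)) (auto simp: L2_loc_def)
  show "set_borel_measurable lborel {a..b} (\<lambda>x. f x \<bullet> g x)"
    unfolding set_borel_measurable_def by measurable
  show "AE x in lborel. x \<in> {a..b} \<longrightarrow> norm (f x \<bullet> g x) \<le> norm ((norm (f x))\<^sup>2 + (norm (g x))\<^sup>2)"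
  proof (intro AE_I2 impI)
    fix x
    have "0 \<le> (norm (f x) - norm (g x))\<^sup>2" "0 \<le> norm (f x) * norm (g x)" by auto
    then have "norm (f x) * norm (g x) \<le> (norm (f x))\<^sup>2 + (norm (g x))\<^sup>2"
      unfolding power2_diff by linarith
    then show "norm (f x \<bullet> g x) \<le> norm ((norm (f x))\<^sup>2 + (norm (g x))\<^sup>2)"
      using Cauchy_Schwarz_ineq2[of "f x" "g x"] by simp
  qed
qed

lemma norm_add_sq: "(norm (a + b))\<^sup>2 = (norm a)\<^sup>2 + (norm b)\<^sup>2 + 2 * (a \<bullet> b)"
  for a b :: "'a::real_inner"
  by (simp add: power2_norm_eq_inner inner_add_left inner_add_right inner_commute)

lemma L2_loc_add:
  assumes "L2_loc f" "L2_loc g"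
  shows "L2_loc (\<lambda>x. f x + g x)"
proof -
  have "set_integrable lborel {a..b} (\<lambda>x. ((norm (f x))\<^sup>2 + (norm (g x))\<^sup>2) + 2 * (f x \<bullet> g x))" for a b
    using assms L2_loc_inner[OF assms]
    by (intro set_integral_add(1) set_integrable_mult_right) (auto simp: L2_loc_def)
  then show ?thesis using assms by (auto simp: L2_loc_def norm_add_sq)
qed

lemma L2_loc_scaleR: "L2_loc f \<Longrightarrow> L2_loc (\<lambda>x. c *\<^sub>R f x)"
  by (auto simp: L2_loc_def power_mult_distrib)

lemma L2_loc_diff: "L2_loc f \<Longrightarrow> L2_loc g \<Longrightarrow> L2_loc (\<lambda>x. f x - g x)"
  using L2_loc_add[of f "\<lambda>x. (-1) *\<^sub>R g x"] L2_loc_scaleR[of g "-1"] by simp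

text \<open>It follows by expanding the nonnegative integral of
  \<open>(norm (g x - v))\<^sup>2\<close>, where \<open>v\<close> is the mean of \<open>g\<close>
  over the interval.\<close>

lemma primitive_Cauchy_Schwarz:
  assumes z: "primitive z g" and g: "L2_loc g" and ab: "a \<le> b"
  shows "(norm (z b - z a))\<^sup>2 \<le> (b - a) * (LBINT x:{a..b}. (norm (g x))\<^sup>2)"
proof (cases "a = b")
  case False
  then have ab': "a < b" using ab by simp
  define v where "v = (1 / (b - a)) *\<^sub>R (z b - z a)"
  let ?I = "LBINT x:{a..b}. (norm (g x))\<^sup>2"
  have p: "primitive (\<lambda>x. z x \<bullet> v) (\<lambda>x. g x \<bullet> v)"
    by (rule primitive_bounded_linear[OF bounded_linear_inner_left z])
  have i1: "set_integrable lborel {a..b} (\<lambda>x. (norm (g x))\<^sup>2)"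
    using g by (simp add: L2_loc_def)
  have i2: "set_integrable lborel {a..b} (\<lambda>x. 2 * (g x \<bullet> v))"
    using primitive_L1_loc[OF p] by (intro set_integrable_mult_right) (simp add: L1_loc_def)
  have i3: "set_integrable lborel {a..b} (\<lambda>x. (norm v)\<^sup>2)"
    by (rule borel_integrable_atLeastAtMost') simp
  have "(LBINT x:{a..b}. (norm v)\<^sup>2) = (b - a) * (norm v)\<^sup>2"
    using ab by (simp add: set_lebesgue_integral_def)
  moreover have "(LBINT x:{a..b}. 2 * (g x \<bullet> v)) = 2 * ((z b - z a) \<bullet> v)"
    using primitive_set_integral[OF p ab] by (simp add: inner_diff_left)
  moreover have "(LBINT x:{a..b}. (norm (g x))\<^sup>2 - 2 * (g x \<bullet> v) + (norm v)\<^sup>2)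
    = ?I - (LBINT x:{a..b}. 2 * (g x \<bullet> v)) + (LBINT x:{a..b}. (norm v)\<^sup>2)"
    using i1 i2 i3 by (simp only: set_integral_add set_integral_diff)
  moreover have "0 \<le> (LBINT x:{a..b}. (norm (g x))\<^sup>2 - 2 * (g x \<bullet> v) + (norm v)\<^sup>2)"
    unfolding set_lebesgue_integral_def
  proof (rule integral_nonneg_AE, rule AE_I2)
    fix x
    have "(norm (g x))\<^sup>2 - 2 * (g x \<bullet> v) + (norm v)\<^sup>2 = (norm (g x - v))\<^sup>2"
      by (simp add: power2_norm_eq_inner inner_diff_left inner_diff_right inner_commute)
    then show "0 \<le> indicat_real {a..b} x *\<^sub>R ((norm (g x))\<^sup>2 - 2 * (g x \<bullet> v) + (norm v)\<^sup>2)"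
      by simp
  qed
  ultimately have "0 \<le> ?I - 2 * ((z b - z a) \<bullet> v) + (b - a) * (norm v)\<^sup>2" by simp
  moreover have "(z b - z a) \<bullet> v = (norm (z b - z a))\<^sup>2 / (b - a)"
    by (simp add: v_def power2_norm_eq_inner)
  moreover have "(b - a) * (norm v)\<^sup>2 = (norm (z b - z a))\<^sup>2 / (b - a)"
    using ab' by (simp add: v_def power_mult_distrib power2_eq_square)
  ultimately have "(norm (z b - z a))\<^sup>2 / (b - a) \<le> ?I" by simp
  then show ?thesis using ab' by (simp add: pos_divide_le_eq mult.commute)
qed simp

lemma set_integral_le_nn_integral:
  fixes f :: "real \<Rightarrow> real"
  assumes "set_integrable lborel A f" "\<And>x. f x \<ge> 0" "(\<integral>\<^sup>+x. ennreal (f x) \<partial>lborel) \<le> ennreal C" "C \<ge> 0"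
  shows "(LBINT x:A. f x) \<le> C"
proof -
  have "ennreal (LBINT x:A. f x) = (\<integral>\<^sup>+x. ennreal (indicator A x *\<^sub>R f x) \<partial>lborel)"
    unfolding set_lebesgue_integral_def
    by (rule nn_integral_eq_integral[symmetric]) (use assms in \<open>auto simp: set_integrable_def\<close>)
  also have "\<dots> \<le> (\<integral>\<^sup>+x. ennreal (f x) \<partial>lborel)"
    by (intro nn_integral_mono ennreal_leI) (use assms in \<open>auto simp: indicator_def\<close>)
  also have "\<dots> \<le> ennreal C" by fact
  finally show ?thesis using assms(4) by (simp add: ennreal_le_iff)
qed

abbreviation sq_nn_integral :: "(real \<Rightarrow> 'a::real_normed_vector) \<Rightarrow> ennreal" where
  "sq_nn_integral h \<equiv> \<integral>\<^sup>+x. ennreal ((norm (h x))\<^sup>2) \<partial>lborel"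

lemma primitive_Holder:
  assumes z: "primitive z g" and g: "L2_loc g" and ab: "a \<le> b"
    and C: "sq_nn_integral g \<le> ennreal C" "C \<ge> 0"
  shows "(norm (z b - z a))\<^sup>2 \<le> (b - a) * C"
proof -
  have "(LBINT x:{a..b}. (norm (g x))\<^sup>2) \<le> C"
    by (rule set_integral_le_nn_integral) (use g C in \<open>auto simp: L2_loc_def\<close>)
  then have "(b - a) * (LBINT x:{a..b}. (norm (g x))\<^sup>2) \<le> (b - a) * C"
    using ab by (intro mult_left_mono) auto
  then show ?thesis using primitive_Cauchy_Schwarz[OF z g ab] by linarith
qed

text \<open>A path is a triple: \<open>u\<close>, its continuous derivative \<open>z\<close>, and
  any representative \<open>g\<close> of the second derivative. Gluing, translating and passing to
  limits then act on explicit functions.\<close>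

definition H2 :: "(real \<Rightarrow> 'a::euclidean_space) \<Rightarrow> (real \<Rightarrow> 'a) \<Rightarrow> (real \<Rightarrow> 'a) \<Rightarrow> bool" where
  "H2 u z g \<longleftrightarrow> primitive u z \<and> primitive z g \<and> L2_loc g"

definition energy :: "('a::euclidean_space \<times> 'a \<Rightarrow> real) \<Rightarrow> (real \<Rightarrow> 'a) \<Rightarrow> (real \<Rightarrow> 'a) \<Rightarrow> (real \<Rightarrow> 'a) \<Rightarrow> ennreal" where
  "energy W u z g = (\<integral>\<^sup>+x. ennreal (1/2 * (norm (g x))\<^sup>2 + W (u x, z x)) \<partial>lborel)"

lemma H2_has_vector_derivative:
  assumes "H2 u z g"
  shows "(u has_vector_derivative z x) (at x)"
  using assms primitive_continuous unfolding H2_def by (blast intro: primitive_has_vector_derivative)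

lemma H2_continuous:
  assumes "H2 u z g"
  shows "continuous_on UNIV u" "continuous_on UNIV z"
  using assms primitive_continuous unfolding H2_def by blast+

text \<open>\<open>weak_D\<close> picks some weak derivative, a priori only locally integrable; it
  inherits local square integrability because it agrees almost everywhere with the given
  derivative.\<close>

lemma W22_loc_imp_H2:
  assumes "W22_loc u"
  shows "H2 u (D u) (weak_D (D u))"
proof -
  have c: "continuous_on UNIV (D u)" and p: "primitive u (D u)"
    using assms unfolding W22_loc_def Ck_1_iff by (auto intro: primitive_C1)
  obtain g where g: "L2_loc g" "is_weak_deriv (D u) g"
    using assms by (auto simp: W22_loc_def W12_loc_def)
  then have w: "is_weak_deriv (D u) (weak_D (D u))"
    unfolding weak_D_def by (intro someI[of "is_weak_deriv (D u)"])
  have pg: "primitive (D u) g" "primitive (D u) (weak_D (D u))"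
    using g(2) w by (auto intro: weak_deriv_imp_primitive[OF c])
  have "L2_loc (weak_D (D u))"
    by (rule L2_loc_cong_AE[OF g(1) primitive_AE_unique[OF pg] primitive_borel[OF pg(2)]])
  then show ?thesis using p pg by (simp add: H2_def)
qed

lemma H2_D: "H2 u z g \<Longrightarrow> D u = z"
  using H2_has_vector_derivative[of u z g] by (auto simp: D_def vector_derivative_at)

lemma H2_imp_W22_loc:
  assumes h: "H2 u z g"
  shows "W22_loc u"
proof -
  have c: "continuous_on UNIV u" "continuous_on UNIV z" using H2_continuous[OF h] .
  have "Ck 1 u"
    unfolding Ck_1_iff H2_D[OF h] using c H2_has_vector_derivative[OF h] by blast
  moreover have "W12_loc u"
    unfolding W12_loc_def using h c continuous_L2_loc primitive_imp_weak_deriv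
    by (auto simp: H2_def)
  moreover have "W12_loc (D u)"
    unfolding W12_loc_def H2_D[OF h] using h c continuous_L2_loc primitive_imp_weak_deriv
    by (auto simp: H2_def)
  ultimately show ?thesis by (simp add: W22_loc_def)
qed

text \<open>Representatives of the second derivative agree almost everywhere, so \<open>J\<close>
  may be computed from whichever triple a construction provides.\<close>

lemma H2_J_eq_energy:
  assumes h: "H2 u z g"
  shows "J W u = energy W u z g"
proof -
  have w: "H2 u z (weak_D z)"
    using W22_loc_imp_H2[OF H2_imp_W22_loc[OF h]] by (simp add: H2_D[OF h])
  have "AE x in lborel. weak_D z x = g x"
    by (rule primitive_AE_unique[of z]) (use h w in \<open>auto simp: H2_def\<close>)
  then have "AE x in lborel. ennreal (1/2 * (norm (weak_D z x))\<^sup>2 + W (u x, z x))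
      = ennreal (1/2 * (norm (g x))\<^sup>2 + W (u x, z x))"
    by eventually_elim simp
  then show ?thesis
    unfolding J_def energy_def H2_D[OF h] by (rule nn_integral_cong_AE)
qed

lemma H2_shift:
  assumes "H2 u z g"
  shows "H2 (\<lambda>x. u (x + c)) (\<lambda>x. z (x + c)) (\<lambda>x. g (x + c))"
proof -
  have g: "L2_loc g" using assms by (simp add: H2_def)
  then have [measurable]: "g \<in> borel_measurable borel" by (simp add: L2_loc_def)
  have "set_integrable lborel {a..b} (\<lambda>x. (norm (g (x + c)))\<^sup>2)" for a b
  proof -
    have "L1_loc (\<lambda>x. (norm (g x))\<^sup>2)" using g by (simp add: L1_loc_def L2_loc_def)
    then obtain F where "primitive F (\<lambda>x. (norm (g x))\<^sup>2)" using primitive_exists by blast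
    from primitive_L1_loc[OF primitive_shift[OF this, of c]] show ?thesis
      by (simp add: L1_loc_def)
  qed
  then have "L2_loc (\<lambda>x. g (x + c))" by (simp add: L2_loc_def)
  then show ?thesis using assms by (auto simp: H2_def intro: primitive_shift)
qed

lemma energy_shift:
  assumes "W \<in> borel_measurable borel" "H2 u z g"
  shows "energy W (\<lambda>x. u (x + c)) (\<lambda>x. z (x + c)) (\<lambda>x. g (x + c)) = energy W u z g"
proof -
  have [measurable]: "u \<in> borel_measurable borel" "z \<in> borel_measurable borel"
    using H2_continuous[OF assms(2)] by (auto intro: borel_measurable_continuous_onI)
  have [measurable]: "g \<in> borel_measurable borel" using assms(2) by (simp add: H2_def L2_loc_def)
  have [measurable]: "(\<lambda>x. W (u x, z x)) \<in> borel_measurable borel"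
    by (rule measurable_compose[OF _ assms(1)]) (simp add: borel_prod[symmetric])
  show ?thesis unfolding energy_def
    by (subst nn_integral_real_affine[where c=1 and t=c and
          f="\<lambda>x. ennreal (1/2 * (norm (g x))\<^sup>2 + W (u x, z x))"]) (auto simp: add.commute)
qed

section \<open>Weak limits in \<open>L\<^sup>2\<close>\<close>

text \<open>The weight \<open>2 ^ k\<close> in the series below leaves room for both the summability of the norms of
  the increments almost everywhere and the integrability of the series.\<close>

lemma L2_Cauchy_imp_limit:
  fixes h :: "nat \<Rightarrow> real \<Rightarrow> 'a::euclidean_space"
  assumes [measurable]: "\<And>n. h n \<in> borel_measurable borel"
    and cau: "\<And>e. e > 0 \<Longrightarrow> \<exists>N. \<forall>m\<ge>N. \<forall>n\<ge>N. sq_nn_integral (\<lambda>x. h m x - h n x) \<le> ennreal e"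
  shows "\<exists>G s. G \<in> borel_measurable borel \<and> (\<forall>k. s k \<ge> k) \<and>
    (AE x in lborel. (\<lambda>k. h (s k) x) \<longlonglongrightarrow> G x) \<and>
    (\<forall>e>0. \<exists>N. \<forall>n\<ge>N. sq_nn_integral (\<lambda>x. G x - h n x) \<le> ennreal e)"
proof -
  have "\<forall>k. \<exists>N. \<forall>m\<ge>N. \<forall>n\<ge>N. sq_nn_integral (\<lambda>x. h m x - h n x) \<le> ennreal ((1/4)^k)"
    by (intro allI cau) simp
  then obtain N where N: "\<And>k m n. m \<ge> N k \<Longrightarrow> n \<ge> N k \<Longrightarrow>
    sq_nn_integral (\<lambda>x. h m x - h n x) \<le> ennreal ((1/4)^k)" by metis
  \<comment> \<open>The sum makes \<open>s\<close> monotone and keeps it above \<open>N k\<close>;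
    the summand \<open>k\<close> makes it at least \<open>k\<close>.\<close>
  define s where "s k = k + (\<Sum>j\<le>k. N j)" for k
  have sN: "N k \<le> s k" for k unfolding s_def by (simp add: trans_le_add2 member_le_sum)
  have sSuc: "s k \<le> s (Suc k)" for k unfolding s_def by simp
  define d where "d k x = norm (h (s (Suc k)) x - h (s k) x)" for k x
  have [measurable]: "d k \<in> borel_measurable borel" for k unfolding d_def by measurable
  define F where "F x = (\<Sum>k. ennreal (2^k * (d k x)\<^sup>2))" for x
  have [measurable]: "F \<in> borel_measurable borel" unfolding F_def by measurable
  have "(\<integral>\<^sup>+x. F x \<partial>lborel) = (\<Sum>k. \<integral>\<^sup>+x. ennreal (2^k * (d k x)\<^sup>2) \<partial>lborel)"
    unfolding F_def by (rule nn_integral_suminf) measurable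
  also have "\<dots> \<le> (\<Sum>k. ennreal ((1/2)^k))"
  proof (rule suminf_le)
    fix k
    have "(\<integral>\<^sup>+x. ennreal (2^k * (d k x)\<^sup>2) \<partial>lborel) = ennreal (2^k) * (\<integral>\<^sup>+x. ennreal ((d k x)\<^sup>2) \<partial>lborel)"
      by (subst nn_integral_cmult[symmetric]) (auto simp: ennreal_mult)
    also have "\<dots> \<le> ennreal (2^k) * ennreal ((1/4)^k)"
      unfolding d_def using sN[of k] sSuc[of k] by (intro mult_left_mono N) auto
    also have "\<dots> = ennreal ((1/2)^k)"
      by (simp add: ennreal_mult[symmetric] power_mult_distrib[symmetric])
    finally show "(\<integral>\<^sup>+x. ennreal (2^k * (d k x)\<^sup>2) \<partial>lborel) \<le> ennreal ((1/2)^k)" .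
  qed auto
  also have "\<dots> = ennreal (\<Sum>k. (1/2)^k)"
    by (intro suminf_ennreal2) (auto simp: summable_geometric)
  also have "\<dots> < \<infinity>" by simp
  finally have "(\<integral>\<^sup>+x. F x \<partial>lborel) \<noteq> \<infinity>" by simp
  then have "AE x in lborel. F x \<noteq> \<infinity>" by (intro nn_integral_PInf_AE) auto
  then have conv: "AE x in lborel. convergent (\<lambda>k. h (s k) x)"
  proof eventually_elim
    case (elim x)
    have "summable (\<lambda>k. 2^k * (d k x)\<^sup>2)"
      using elim unfolding F_def by (intro summable_suminf_not_top) auto
    then have "(\<lambda>k. 2^k * (d k x)\<^sup>2) \<longlonglongrightarrow> 0" by (rule summable_LIMSEQ_zero)
    then have "Bseq (\<lambda>k. 2^k * (d k x)\<^sup>2)" using convergent_imp_Bseq convergentI by blast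
    then obtain K where K: "K > 0" "\<And>k. 2^k * (d k x)\<^sup>2 \<le> K"
      unfolding Bseq_def real_norm_def by (metis abs_le_D1)
    \<comment> \<open>Boundedness of the terms \<open>2^k * (d k x)\<^sup>2\<close> already makes
      the increments decay geometrically, with ratio \<open>sqrt (1/2)\<close>.\<close>
    have dk: "norm (h (s (Suc k)) x - h (s k) x) \<le> sqrt K * (sqrt (1/2))^k" for k
    proof -
      have "(d k x)\<^sup>2 \<le> K / 2^k" using K(2)[of k] by (simp add: pos_le_divide_eq mult.commute)
      then have "d k x \<le> sqrt (K / 2^k)" by (rule real_le_rsqrt)
      also have "\<dots> = sqrt K * (sqrt (1/2))^k"
        by (simp add: real_sqrt_divide real_sqrt_power power_divide)
      finally show ?thesis by (simp add: d_def)
    qed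
    have "summable (\<lambda>k. sqrt K * (sqrt (1/2))^k)"
      by (intro summable_mult summable_geometric) simp
    then have "summable (\<lambda>k. h (s (Suc k)) x - h (s k) x)"
      by (rule summable_comparison_test'[where N=0]) (use dk in auto)
    then have "convergent (\<lambda>n. \<Sum>k<n. h (s (Suc k)) x - h (s k) x)"
      by (simp add: summable_iff_convergent)
    then have "convergent (\<lambda>n. h (s n) x - h (s 0) x)"
      by (simp only: sum_lessThan_telescope[of "\<lambda>k. h (s k) x"])
    from convergent_add[OF this convergent_const[of "h (s 0) x"]] show ?case by simp
  qed
  define G where "G x = lim (\<lambda>k. h (s k) x)" for x
  have G[measurable]: "G \<in> borel_measurable borel"
    unfolding G_def by (rule borel_measurable_lim_metric) measurable
  have lim: "AE x in lborel. (\<lambda>k. h (s k) x) \<longlonglongrightarrow> G x"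
    using conv by eventually_elim (simp add: G_def convergent_LIMSEQ_iff)
  have "\<exists>N. \<forall>n\<ge>N. sq_nn_integral (\<lambda>x. G x - h n x) \<le> ennreal e" if "e > 0" for e
  proof -
    obtain M where M: "\<And>m n. m \<ge> M \<Longrightarrow> n \<ge> M \<Longrightarrow>
      sq_nn_integral (\<lambda>x. h m x - h n x) \<le> ennreal e" using cau[OF \<open>e > 0\<close>] by blast
    have "sq_nn_integral (\<lambda>x. G x - h n x) \<le> ennreal e" if n: "n \<ge> M" for n
    proof -
      \<comment> \<open>Fatou along the subsequence, with \<open>n\<close> fixed: the whole sequence
        converges in norm, not just the subsequence.\<close>
      have "sq_nn_integral (\<lambda>x. G x - h n x)
        = (\<integral>\<^sup>+x. liminf (\<lambda>k. ennreal ((norm (h (s k) x - h n x))\<^sup>2)) \<partial>lborel)"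
      proof (rule nn_integral_cong_AE, use lim in eventually_elim)
        case (elim x)
        have "(\<lambda>k. ennreal ((norm (h (s k) x - h n x))\<^sup>2)) \<longlonglongrightarrow> ennreal ((norm (G x - h n x))\<^sup>2)"
          by (intro tendsto_ennrealI tendsto_intros elim)
        from lim_imp_Liminf[OF sequentially_bot this] show ?case by (rule sym)
      qed
      also have "\<dots> \<le> liminf (\<lambda>k. \<integral>\<^sup>+x. ennreal ((norm (h (s k) x - h n x))\<^sup>2) \<partial>lborel)"
        by (rule nn_integral_liminf) measurable
      also have "\<dots> \<le> limsup (\<lambda>k. \<integral>\<^sup>+x. ennreal ((norm (h (s k) x - h n x))\<^sup>2) \<partial>lborel)"
        by (rule Liminf_le_Limsup) simp
      also have "\<dots> \<le> ennreal e"
      proof (rule Limsup_bounded, rule eventually_sequentiallyI)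
        fix k assume "k \<ge> M"
        then have "s k \<ge> M" unfolding s_def by simp
        then show "sq_nn_integral (\<lambda>x. h (s k) x - h n x) \<le> ennreal e"
          using M n by blast
      qed
      finally show ?thesis .
    qed
    then show ?thesis by blast
  qed
  moreover have "\<forall>k. s k \<ge> k" by (simp add: s_def)
  ultimately show ?thesis using G lim by blast
qed

section \<open>Square norms, the parallelogram identity and weak limits\<close>

definition nsq :: "(real \<Rightarrow> 'a::euclidean_space) \<Rightarrow> real" where
  "nsq h = (LBINT x. (norm (h x))\<^sup>2)"

definition L2 :: "(real \<Rightarrow> 'a::euclidean_space) \<Rightarrow> bool" where
  "L2 h \<longleftrightarrow> h \<in> borel_measurable borel \<and> integrable lborel (\<lambda>x. (norm (h x))\<^sup>2)"

lemma L2_nn_integral: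
  "L2 h \<Longrightarrow> sq_nn_integral h = ennreal (nsq h)"
  unfolding L2_def nsq_def by (intro nn_integral_eq_integral) auto

lemma L2_nn_integralI:
  assumes "h \<in> borel_measurable borel" "sq_nn_integral h \<le> ennreal C"
  shows "L2 h"
  unfolding L2_def
proof (intro conjI integrableI_bounded)
  have "(\<integral>\<^sup>+x. ennreal (norm ((norm (h x))\<^sup>2)) \<partial>lborel) \<le> ennreal C" using assms(2) by simp
  also have "\<dots> < \<infinity>" by simp
  finally show "(\<integral>\<^sup>+x. ennreal (norm ((norm (h x))\<^sup>2)) \<partial>lborel) < \<infinity>" .
qed (use assms(1) in measurable)

lemma nsq_nonneg: "nsq h \<ge> 0"
  unfolding nsq_def by (rule integral_nonneg_AE) simp

lemma L2_add:
  assumes "L2 f" "L2 g"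
  shows "L2 (\<lambda>x. f x + g x)"
proof -
  have [measurable]: "f \<in> borel_measurable borel" "g \<in> borel_measurable borel"
    using assms by (simp_all add: L2_def)
  have "integrable lborel (\<lambda>x. (norm (f x + g x))\<^sup>2)"
  proof (rule Bochner_Integration.integrable_bound)
    show "integrable lborel (\<lambda>x. 2 * (norm (f x))\<^sup>2 + 2 * (norm (g x))\<^sup>2)"
      using assms by (simp add: L2_def)
    show "AE x in lborel. norm ((norm (f x + g x))\<^sup>2) \<le> norm (2 * (norm (f x))\<^sup>2 + 2 * (norm (g x))\<^sup>2)"
    proof (rule AE_I2)
      fix x
      have "0 \<le> (norm (f x - g x))\<^sup>2" by simp
      then have "(norm (f x + g x))\<^sup>2 \<le> 2 * (norm (f x))\<^sup>2 + 2 * (norm (g x))\<^sup>2"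
        by (simp add: power2_norm_eq_inner inner_diff_left inner_diff_right inner_add_left inner_add_right inner_commute)
      then show "norm ((norm (f x + g x))\<^sup>2) \<le> norm (2 * (norm (f x))\<^sup>2 + 2 * (norm (g x))\<^sup>2)" by simp
    qed
  qed measurable
  then show ?thesis by (simp add: L2_def)
qed

lemma L2_scaleR: "L2 f \<Longrightarrow> L2 (\<lambda>x. c *\<^sub>R f x)"
  by (auto simp: L2_def power_mult_distrib)

lemma L2_diff: "L2 f \<Longrightarrow> L2 g \<Longrightarrow> L2 (\<lambda>x. f x - g x)"
  using L2_add[of f "\<lambda>x. (-1) *\<^sub>R g x"] L2_scaleR[of g "-1"] by simp

lemma nsq_parallelogram:
  assumes "L2 f" "L2 g"
  shows "nsq (\<lambda>x. f x - g x) + 4 * nsq (\<lambda>x. (1/2) *\<^sub>R (f x + g x)) = 2 * nsq f + 2 * nsq g"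
proof -
  have "nsq (\<lambda>x. f x - g x) + 4 * nsq (\<lambda>x. (1/2) *\<^sub>R (f x + g x))
    = (LBINT x. (norm (f x - g x))\<^sup>2 + 4 * (norm ((1/2) *\<^sub>R (f x + g x)))\<^sup>2)"
    unfolding nsq_def using L2_diff[OF assms] L2_scaleR[OF L2_add[OF assms], of "1/2"]
    by (simp add: L2_def)
  also have "\<dots> = (LBINT x. 2 * (norm (f x))\<^sup>2 + 2 * (norm (g x))\<^sup>2)"
  proof (rule Bochner_Integration.integral_cong[OF refl])
    fix x
    have "4 * (norm ((1/2) *\<^sub>R (f x + g x)))\<^sup>2 = (norm (f x + g x))\<^sup>2"
      by (simp add: power_mult_distrib power_divide)
    then show "(norm (f x - g x))\<^sup>2 + 4 * (norm ((1/2) *\<^sub>R (f x + g x)))\<^sup>2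
      = 2 * (norm (f x))\<^sup>2 + 2 * (norm (g x))\<^sup>2"
      by (simp add: power2_norm_eq_inner inner_diff_left inner_diff_right inner_add_left inner_add_right
          inner_commute)
  qed
  also have "\<dots> = 2 * nsq f + 2 * nsq g"
    unfolding nsq_def using assms by (simp add: L2_def)
  finally show ?thesis .
qed

lemma nsq_le_iff:
  assumes "C \<ge> 0" "L2 h"
  shows "nsq h \<le> C \<longleftrightarrow> sq_nn_integral h \<le> ennreal C"
  using assms by (simp add: L2_nn_integral)

text \<open>The weak limit in \<open>L\<^sup>2\<close> is obtained as a strong limit: elements of nearly minimal norm in the
  convex sets \<open>V k\<close>, which contain the tails of the sequence, form a Cauchy sequence by the
  parallelogram identity.\<close>

lemma L2_weak_limit:
  fixes z g :: "nat \<Rightarrow> real \<Rightarrow> 'a::euclidean_space"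
  assumes pr: "\<And>n. primitive (z n) (g n)" and L2g: "\<And>n. L2 (g n)"
    and C: "\<And>n. nsq (g n) \<le> C"
    and lim: "\<And>x. (\<lambda>n. z n x) \<longlonglongrightarrow> Z x"
  shows "\<exists>G. primitive Z G \<and> L2 G \<and> ennreal (nsq G) \<le> liminf (\<lambda>n. ennreal (nsq (g n)))"
proof -
  \<comment> \<open>The tail supremum is a pointwise tolerance that decreases in \<open>k\<close>
    and tends to 0 at every \<open>x\<close>, without uniformity in \<open>x\<close>. As a bound on
    a norm at each point it makes \<open>V k\<close> convex.\<close>
  define e where "e k x = (SUP n\<in>{k..}. norm (z n x - Z x))" for k :: nat and x
  have l0: "(\<lambda>n. norm (z n x - Z x)) \<longlonglongrightarrow> 0" for x
    using lim[of x] by (simp add: LIM_zero tendsto_norm_zero)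
  have bdd: "bdd_above ((\<lambda>n. norm (z n x - Z x)) ` {k..})" for k x
  proof -
    have "Bseq (\<lambda>n. norm (z n x - Z x))"
      using l0[of x] convergent_imp_Bseq convergentI by blast
    then have "bdd_above (range (\<lambda>n. norm (z n x - Z x)))"
      by (rule Bseq_bdd_above)
    then show ?thesis by (rule bdd_above_mono) auto
  qed
  have e_ge: "norm (z n x - Z x) \<le> e k x" if "k \<le> n" for k n x
    unfolding e_def by (rule cSUP_upper[OF _ bdd]) (use that in auto)
  have e_anti: "e n x \<le> e k x" if "k \<le> n" for k n x
    unfolding e_def by (rule cSUP_subset_mono[OF _ bdd]) (use that in auto)
  have e0: "\<exists>k. e k x \<le> \<epsilon>" if "\<epsilon> > 0" for x \<epsilon>
  proof -
    have "eventually (\<lambda>n. norm (z n x - Z x) < \<epsilon>) sequentially"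
      using order_tendstoD(2)[OF l0 that] .
    then obtain k where "\<And>n. n \<ge> k \<Longrightarrow> norm (z n x - Z x) < \<epsilon>" by (auto simp: eventually_sequentially)
    then have "e k x \<le> \<epsilon>" unfolding e_def by (intro cSUP_least) (auto intro: less_imp_le)
    then show ?thesis by blast
  qed
  define V where "V k = {(y, h). primitive y h \<and> L2 h \<and> (\<forall>x. norm (y x - Z x) \<le> e k x)}" for k :: nat
  have zV: "(z n, g n) \<in> V k" if "k \<le> n" for k n
    using e_ge[OF that] pr L2g by (auto simp: V_def)
  have V_anti: "V n \<subseteq> V k" if "k \<le> n" for k n
  proof
    fix p assume "p \<in> V n"
    moreover have "norm (y x - Z x) \<le> e k x" if "norm (y x - Z x) \<le> e n x" for x and y :: "real \<Rightarrow> 'a"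
      using that e_anti[OF \<open>k \<le> n\<close>, of x] by (rule order_trans)
    ultimately show "p \<in> V k" unfolding V_def by blast
  qed
  have V_mid: "((\<lambda>x. (1/2) *\<^sub>R (y x + y' x)), (\<lambda>x. (1/2) *\<^sub>R (h x + h' x))) \<in> V k"
    if "(y, h) \<in> V k" "(y', h') \<in> V k" for y h y' h' k
  proof -
    have "norm ((1/2) *\<^sub>R (y x + y' x) - Z x) \<le> e k x" for x
    proof -
      have "(1/2) *\<^sub>R (y x + y' x) - Z x = (1/2) *\<^sub>R ((y x - Z x) + (y' x - Z x))"
        by (simp add: algebra_simps) (simp add: scaleR_add_left[symmetric])
      then have "norm ((1/2) *\<^sub>R (y x + y' x) - Z x) = (1/2) * norm ((y x - Z x) + (y' x - Z x))"
        by (metis abs_of_pos norm_scaleR half_gt_zero zero_less_one)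
      also have "\<dots> \<le> (1/2) * (norm (y x - Z x) + norm (y' x - Z x))"
        using norm_triangle_ineq by (intro mult_left_mono) auto
      also have "\<dots> \<le> (1/2) * (e k x + e k x)"
        using that by (intro mult_left_mono add_mono) (auto simp: V_def)
      finally show ?thesis by simp
    qed
    then show ?thesis using that
      by (auto simp: V_def intro!: primitive_scaleR primitive_add L2_add L2_scaleR)
  qed
  define d where "d k = Inf ((\<lambda>(y, h). nsq h) ` V k)" for k
  have bb: "bdd_below ((\<lambda>(y, h). nsq h) ` V k)" for k
    by (rule bdd_belowI[of _ 0]) (auto simp: nsq_nonneg)
  have d_le: "d k \<le> nsq h" if "(y, h) \<in> V k" for y h k
  proof -
    have "(\<lambda>(y, h). nsq h) (y, h) \<in> (\<lambda>(y, h). nsq h) ` V k" using that by (rule imageI)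
    then show ?thesis unfolding d_def using bb by (intro cInf_lower) auto
  qed
  have d_mono: "d k \<le> d n" if "k \<le> n" for k n
    unfolding d_def
  proof (rule cInf_superset_mono[OF _ bb])
    show "(\<lambda>(y, h). nsq h) ` V n \<noteq> {}" using zV[of n n] by auto
  qed (use V_anti[OF that] in auto)
  have dC: "d k \<le> C" for k using d_le[OF zV[of k k]] C[of k] by simp
  have "incseq d" using d_mono by (simp add: incseq_def)
  then obtain L where dL: "d \<longlonglongrightarrow> L" using incseq_convergent[of d C] dC by blast
  have d_le_L: "d k \<le> L" for k using incseq_le[OF \<open>incseq d\<close> dL] .
  have "\<exists>y h. (y, h) \<in> V k \<and> nsq h < d k + 1 / Suc k" for k
  proof -
    have "\<exists>r\<in>(\<lambda>(y, h). nsq h) ` V k. r < d k + 1 / Suc k"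
      by (rule cInf_lessD) (use zV[of k k] in \<open>auto simp: d_def\<close>)
    then show ?thesis by auto
  qed
  then obtain y h where yh: "\<And>k. (y k, h k) \<in> V k" "\<And>k. nsq (h k) < d k + 1 / Suc k" by metis
  have L2h: "L2 (h k)" and pry: "primitive (y k) (h k)" for k using yh(1)[of k] by (auto simp: V_def)
  have hm[measurable]: "h k \<in> borel_measurable borel" for k using L2h by (simp add: L2_def)
  \<comment> \<open>The midpoint of two elements of \<open>V N\<close> lies in \<open>V N\<close>,
    so its square norm is at least \<open>d N\<close>; the parallelogram identity turns this into
    closeness.\<close>
  have dist: "nsq (\<lambda>x. h m x - h n x) \<le> 4 * (L - d N) + 4 / Suc N" if "N \<le> m" "N \<le> n" for m n N
  proof -
    have "(y m, h m) \<in> V N" "(y n, h n) \<in> V N" using yh(1) V_anti that by blast+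
    from d_le[OF V_mid[OF this]] have "d N \<le> nsq (\<lambda>x. (1/2) *\<^sub>R (h m x + h n x))" .
    moreover have "1 / Suc m \<le> 1 / Suc N" "1 / Suc n \<le> 1 / Suc N"
      using that by (simp_all add: frac_le)
    then have "nsq (h m) \<le> L + 1 / Suc N" "nsq (h n) \<le> L + 1 / Suc N"
      using yh(2)[of m] yh(2)[of n] d_le_L[of m] d_le_L[of n] by linarith+
    ultimately show ?thesis using nsq_parallelogram[OF L2h[of m] L2h[of n]] by simp
  qed
  have "(\<lambda>N. 4 * (L - d N) + 4 / Suc N) \<longlonglongrightarrow> 4 * (L - L) + 0"
    by (intro tendsto_intros dL LIMSEQ_Suc[OF lim_const_over_n])
  then have small: "\<exists>N. 4 * (L - d N) + 4 / Suc N \<le> \<epsilon>" if "\<epsilon> > 0" for \<epsilon>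
    using order_tendstoD(2)[of _ "0::real" sequentially \<epsilon>] that
    by (fastforce simp: eventually_sequentially intro: less_imp_le)
  have "\<exists>G s. G \<in> borel_measurable borel \<and> (\<forall>k. s k \<ge> k) \<and>
    (AE x in lborel. (\<lambda>k. h (s k) x) \<longlonglongrightarrow> G x) \<and>
    (\<forall>e>0. \<exists>N. \<forall>n\<ge>N. sq_nn_integral (\<lambda>x. G x - h n x) \<le> ennreal e)"
  proof (rule L2_Cauchy_imp_limit)
    fix \<epsilon> :: real assume \<epsilon>: "\<epsilon> > 0"
    then obtain N where "4 * (L - d N) + 4 / Suc N \<le> \<epsilon>" using small by blast
    then have "nsq (\<lambda>x. h m x - h n x) \<le> \<epsilon>" if "N \<le> m" "N \<le> n" for m n
      using dist[OF that] by linarith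
    then show "\<exists>N. \<forall>m\<ge>N. \<forall>n\<ge>N. sq_nn_integral (\<lambda>x. h m x - h n x) \<le> ennreal \<epsilon>"
      using nsq_le_iff[OF less_imp_le[OF \<epsilon>] L2_diff[OF L2h L2h]] by blast
  qed measurable
  then obtain G s where G[measurable]: "G \<in> borel_measurable borel" and s: "\<And>k. s k \<ge> k"
    and AEG: "AE x in lborel. (\<lambda>k. h (s k) x) \<longlonglongrightarrow> G x"
    and Gh: "\<And>e. e > 0 \<Longrightarrow> \<exists>N. \<forall>n\<ge>N. sq_nn_integral (\<lambda>x. G x - h n x) \<le> ennreal e"
    by blast
  have "L2 G"
  proof -
    obtain N where "sq_nn_integral (\<lambda>x. G x - h N x) \<le> ennreal 1"
      using Gh[of 1] by auto
    then have "L2 (\<lambda>x. G x - h N x)" by (rule L2_nn_integralI[rotated]) measurable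
    from L2_add[OF this L2h[of N]] show ?thesis by simp
  qed
  have L2loc: "L2_loc G" using \<open>L2 G\<close> unfolding L2_def by (intro L2_loc_integrable) auto
  obtain F where F: "primitive F G" using primitive_exists[OF L2_loc_imp_L1_loc[OF L2loc]] by blast
  \<comment> \<open>Increments of \<open>F\<close> and \<open>Z\<close> are compared through
    \<open>y n\<close>: membership in \<open>V n\<close> controls \<open>y n\<close> at both
    endpoints, and the norm distance between \<open>G\<close> and \<open>h n\<close> controls
    \<open>F - y n\<close> by Holder. The first error is at most \<eta>/2, the second strictly
    less.\<close>
  have FZ: "F b - F a = Z b - Z a" if ab: "a < b" for a b
  proof (rule ccontr)
    assume ne: "F b - F a \<noteq> Z b - Z a"
    define \<eta> where "\<eta> = norm ((F b - F a) - (Z b - Z a))"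
    have \<eta>: "\<eta> > 0" using ne by (simp add: \<eta>_def)
    have "0 < (\<eta>/2)\<^sup>2 / (b - a) / 2" using \<eta> ab by simp
    from Gh[OF this] obtain N1 where N1: "\<And>n. n \<ge> N1 \<Longrightarrow>
      sq_nn_integral (\<lambda>x. G x - h n x) \<le> ennreal ((\<eta>/2)\<^sup>2 / (b - a) / 2)" by blast
    obtain N2 N3 where N23: "e N2 a \<le> \<eta>/4" "e N3 b \<le> \<eta>/4" using e0[of "\<eta>/4"] \<eta> by (meson divide_pos_pos zero_less_numeral)
    define n where "n = N1 + N2 + N3"
    have "norm (y n x - Z x) \<le> e n x" for x using yh(1)[of n] by (simp add: V_def)
    moreover have "e n a \<le> e N2 a" "e n b \<le> e N3 b" by (rule e_anti; simp add: n_def)+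
    ultimately have "norm (y n a - Z a) \<le> \<eta>/4" "norm (y n b - Z b) \<le> \<eta>/4"
      using N23 by (meson order_trans)+
    then have 1: "norm ((y n b - y n a) - (Z b - Z a)) \<le> \<eta>/2"
      using norm_triangle_ineq4[of "y n b - Z b" "y n a - Z a"] by (simp add: algebra_simps)
    have "(norm ((F b - y n b) - (F a - y n a)))\<^sup>2 \<le> (b - a) * ((\<eta>/2)\<^sup>2 / (b - a) / 2)"
    proof (rule primitive_Holder)
      show "primitive (\<lambda>x. F x - y n x) (\<lambda>x. G x - h n x)" by (rule primitive_diff[OF F pry])
      show "L2_loc (\<lambda>x. G x - h n x)"
        using L2_diff[OF \<open>L2 G\<close> L2h] unfolding L2_def by (intro L2_loc_integrable) auto
      show "sq_nn_integral (\<lambda>x. G x - h n x) \<le> ennreal ((\<eta>/2)\<^sup>2 / (b - a) / 2)"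
        by (rule N1) (simp add: n_def)
    qed (use ab in auto)
    also have "\<dots> = (\<eta>/2)\<^sup>2 / 2"
    proof -
      have "c * (X / c / 2) = X / 2" if "c \<noteq> 0" for c X :: real using that by simp
      from this[of "b - a"] show ?thesis using ab by simp
    qed
    also have "\<dots> < (\<eta>/2)\<^sup>2"
    proof -
      have "0 < (\<eta>/2)\<^sup>2" using \<eta> by simp
      then show ?thesis by linarith
    qed
    finally have "norm ((F b - y n b) - (F a - y n a)) < \<eta>/2"
      by (rule power_less_imp_less_base) (use \<eta> in simp)
    then have "norm ((F b - F a) - (Z b - Z a)) < \<eta>"
      using 1 norm_triangle_ineq[of "(F b - y n b) - (F a - y n a)" "(y n b - y n a) - (Z b - Z a)"]
      by (simp add: algebra_simps)
    then show False by (simp add: \<eta>_def)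
  qed
  have "primitive Z G"
    unfolding primitive_def
  proof (intro conjI allI impI)
    show "L1_loc G" using F by (rule primitive_L1_loc)
    fix a b :: real assume ab: "a \<le> b"
    then have "F b - F a = Z b - Z a" using FZ[of a b] by (cases "a = b") auto
    then show "(G has_integral Z b - Z a) {a..b}" using primitive_has_integral[OF F ab] by simp
  qed
  moreover have "ennreal (nsq G) \<le> liminf (\<lambda>n. ennreal (nsq (g n)))"
  proof -
    have "ennreal (nsq G) = sq_nn_integral G"
      by (rule L2_nn_integral[OF \<open>L2 G\<close>, symmetric])
    also have "\<dots> = (\<integral>\<^sup>+x. liminf (\<lambda>k. ennreal ((norm (h (s k) x))\<^sup>2)) \<partial>lborel)"
    proof (rule nn_integral_cong_AE, use AEG in eventually_elim)
      case (elim x)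
      have "(\<lambda>k. ennreal ((norm (h (s k) x))\<^sup>2)) \<longlonglongrightarrow> ennreal ((norm (G x))\<^sup>2)"
        by (intro tendsto_ennrealI tendsto_intros elim)
      from lim_imp_Liminf[OF sequentially_bot this] show ?case by (rule sym)
    qed
    also have "\<dots> \<le> liminf (\<lambda>k. \<integral>\<^sup>+x. ennreal ((norm (h (s k) x))\<^sup>2) \<partial>lborel)"
      by (rule nn_integral_liminf) measurable
    also have "\<dots> \<le> liminf (\<lambda>k. ennreal (L + 1 / Suc k))"
    proof (intro Liminf_mono always_eventually allI)
      fix k
      have "1 / Suc (s k) \<le> 1 / Suc k" using s[of k] by (simp add: frac_le)
      then have "nsq (h (s k)) \<le> L + 1 / Suc k" using yh(2)[of "s k"] d_le_L[of "s k"] by linarith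
      then show "sq_nn_integral (\<lambda>x. h (s k) x) \<le> ennreal (L + 1 / Suc k)"
        unfolding L2_nn_integral[OF L2h] by (rule ennreal_leI)
    qed
    also have "\<dots> = ennreal (L + 0)"
      by (intro lim_imp_Liminf tendsto_ennrealI tendsto_intros LIMSEQ_Suc[OF lim_const_over_n]) simp
    also have "\<dots> = ennreal L" by simp
    also have "\<dots> = liminf (\<lambda>n. ennreal (d n))"
      by (intro lim_imp_Liminf[symmetric] tendsto_ennrealI dL) simp
    \<comment> \<open>The given sequence competes with the near-minimal elements: \<open>g n\<close>
      belongs to \<open>V n\<close>, where the infimum is \<open>d n\<close>.\<close>
    also have "\<dots> \<le> liminf (\<lambda>n. ennreal (nsq (g n)))"
      by (intro Liminf_mono always_eventually allI ennreal_leI d_le[OF zV]) simp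
    finally show ?thesis .
  qed
  ultimately show ?thesis using \<open>L2 G\<close> by blast
qed

section \<open>Paths of finite energy\<close>

lemma energy_interval:
  assumes "energy W u z g \<le> ennreal E" "E \<ge> 0" "c \<ge> 0" "a \<le> b"
    and "\<And>x. x \<in> {a..b} \<Longrightarrow> c \<le> W (u x, z x)"
  shows "(b - a) * c \<le> E"
proof -
  have "ennreal ((b - a) * c) = ennreal c * emeasure lborel {a..b}"
    using assms by (simp add: ennreal_mult mult.commute)
  also have "\<dots> = (\<integral>\<^sup>+x. ennreal c * indicator {a..b} x \<partial>lborel)"
    by (rule nn_integral_cmult_indicator[symmetric]) simp
  also have "\<dots> \<le> energy W u z g"
    unfolding energy_def
  proof (rule nn_integral_mono)
    fix x
    have "ennreal c \<le> ennreal (1/2 * (norm (g x))\<^sup>2 + W (u x, z x))" if "x \<in> {a..b}"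
    proof (rule ennreal_leI)
      have "0 \<le> 1/2 * (norm (g x))\<^sup>2" by simp
      then show "c \<le> 1/2 * (norm (g x))\<^sup>2 + W (u x, z x)" using assms(5)[OF that] by linarith
    qed
    then show "ennreal c * indicator {a..b} x \<le> ennreal (1/2 * (norm (g x))\<^sup>2 + W (u x, z x))"
      by (auto simp: indicator_def)
  qed
  also have "\<dots> \<le> ennreal E" by fact
  finally show ?thesis using assms(2) by (simp add: ennreal_le_iff)
qed

lemma integral_interval_tail:
  fixes f :: "real \<Rightarrow> real"
  assumes f: "integrable lborel f" "\<And>x. f x \<ge> 0" and "\<epsilon> > 0"
  shows "\<exists>X. \<forall>a b. (\<forall>x\<in>{a..b}. \<bar>x\<bar> \<ge> X) \<longrightarrow> (LBINT x:{a..b}. f x) \<le> \<epsilon>"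
proof -
  have [measurable]: "f \<in> borel_measurable borel" using f by auto
  have "(\<lambda>n::nat. LBINT x. indicator {x. \<bar>x\<bar> \<ge> real n} x * f x) \<longlonglongrightarrow> (LBINT (x::real). 0::real)"
  proof (rule integral_dominated_convergence[where w=f])
    show "AE x in lborel. (\<lambda>n. indicator {x. \<bar>x\<bar> \<ge> real n} x * f x) \<longlonglongrightarrow> 0"
    proof (rule AE_I2)
      fix x :: real
      obtain N :: nat where "\<bar>x\<bar> < real N" using reals_Archimedean2 by blast
      then have "\<forall>\<^sub>F n in sequentially. indicator {x. \<bar>x\<bar> \<ge> real n} x * f x = 0"
        unfolding eventually_sequentially by (intro exI[of _ N]) (auto simp: indicator_def)
      then show "(\<lambda>n. indicator {x. \<bar>x\<bar> \<ge> real n} x * f x) \<longlonglongrightarrow> 0"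
        by (rule tendsto_eventually)
    qed
    show "AE x in lborel. norm (indicator {x. \<bar>x\<bar> \<ge> real n} x * f x) \<le> f x" for n
      by (intro AE_I2) (use f(2) in \<open>auto simp: indicator_def\<close>)
  qed (use f in auto)
  then have "\<forall>\<^sub>F n in sequentially. (LBINT x. indicator {x. \<bar>x\<bar> \<ge> real n} x * f x) < \<epsilon>"
    using order_tendstoD(2)[of _ 0] \<open>\<epsilon> > 0\<close> by simp
  then obtain n :: nat where n: "(LBINT x. indicator {x. \<bar>x\<bar> \<ge> real n} x * f x) < \<epsilon>"
    by (auto simp: eventually_sequentially)
  have i: "integrable lborel (\<lambda>x. indicator {x. \<bar>x\<bar> \<ge> real n} x * f x)"
    using integrable_mult_indicator[OF _ f(1), of "{x. \<bar>x\<bar> \<ge> real n}"] by simp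
  have "(LBINT x:{a..b}. f x) \<le> \<epsilon>" if "\<forall>x\<in>{a..b}. \<bar>x\<bar> \<ge> real n" for a b
  proof -
    have "(LBINT x:{a..b}. f x) \<le> (LBINT x. indicator {x. \<bar>x\<bar> \<ge> real n} x * f x)"
      unfolding set_lebesgue_integral_def
    proof (rule integral_mono[OF _ i])
      show "integrable lborel (\<lambda>x. indicat_real {a..b} x *\<^sub>R f x)"
        by (intro integrable_mult_indicator f) simp
      show "indicat_real {a..b} x *\<^sub>R f x \<le> indicator {x. \<bar>x\<bar> \<ge> real n} x * f x" for x
        using that f(2)[of x] by (auto simp: indicator_def)
    qed
    then show ?thesis using n by linarith
  qed
  then show ?thesis by blast
qed

lemma primitive_bound:
  fixes u z :: "real \<Rightarrow> 'a::euclidean_space"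
  assumes "primitive u z" "a \<le> b" "B \<ge> 0" "\<And>x. x \<in> {a..b} \<Longrightarrow> norm (z x) \<le> B"
  shows "norm (u b - u a) \<le> B * (b - a)"
proof -
  have "norm (u b - u a) \<le> B * Henstock_Kurzweil_Integration.content (cbox a b)"
    by (rule has_integral_bound[where f=z]) (use primitive_has_integral[OF assms(1,2)] assms in auto)
  then show ?thesis using assms by simp
qed

section \<open>The double-well setting and a priori bounds\<close>

locale double_well =
  fixes W :: "'a::euclidean_space \<times> 'a \<Rightarrow> real" and Am Ap \<Omega> :: "'a set" and q :: real
  assumes W_C2: "C2_on_space W"
    and W_nonneg: "\<And>u v. W (u, v) \<ge> 0"
    and zeros: "{u. W (u, 0) = 0} = Am \<union> Ap"
    and Am: "Am \<noteq> {}" "compact Am" and Ap: "Ap \<noteq> {}" "compact Ap"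
    and \<Omega>_open: "open \<Omega>"
    and W_frontier: "\<And>u v. u \<in> frontier \<Omega> \<Longrightarrow> W (u, v) > 0"
    and W_coercive: "Liminf at_infinity (\<lambda>u. INF v. ereal (W (u, v))) > 0"
    and q: "0 < q" "q < setdist Am Ap / 2"
      "{u. infdist u Am \<le> q} \<subseteq> \<Omega>" "{u. infdist u Ap \<le> q} \<inter> closure \<Omega> = {}"
begin

lemma W_differentiable: "W differentiable (at p)"
  using W_C2 unfolding C2_on_space_def differentiable_def by blast

lemma W_continuous: "continuous_on S W"
  using W_differentiable differentiable_imp_continuous_within
  by (metis continuous_at_imp_continuous_on)

lemma W_measurable: "W \<in> borel_measurable borel"
  by (intro borel_measurable_continuous_onI W_continuous)

lemma H2_measurable:
  assumes "H2 u z g"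
  shows "g \<in> borel_measurable borel" "(\<lambda>x. W (u x, z x)) \<in> borel_measurable borel"
proof -
  have [measurable]: "u \<in> borel_measurable borel" "z \<in> borel_measurable borel"
    using H2_continuous[OF assms] by (auto intro: borel_measurable_continuous_onI)
  show "g \<in> borel_measurable borel" using assms by (simp add: H2_def L2_loc_def)
  show "(\<lambda>x. W (u x, z x)) \<in> borel_measurable borel"
    by (rule measurable_compose[OF _ W_measurable]) (simp add: borel_prod[symmetric])
qed

lemma W_large:
  obtains R c where "R > 0" "c > 0" "\<And>u v. norm u \<ge> R \<Longrightarrow> W (u, v) \<ge> c"
proof -
  obtain c where c: "0 < ereal c" "ereal c < Liminf at_infinity (\<lambda>u. INF v. ereal (W (u, v)))"
    using ereal_dense2[OF W_coercive] by blast
  have "eventually (\<lambda>u. ereal c < (INF v. ereal (W (u, v)))) at_infinity"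
    by (rule less_LiminfD[OF c(2)])
  then obtain R where R: "\<And>u. norm u \<ge> R \<Longrightarrow> ereal c < (INF v. ereal (W (u, v)))"
    by (auto simp: eventually_at_infinity)
  have "W (u, v) \<ge> c" if "norm u \<ge> max R 1" for u v
  proof -
    have "ereal c < (INF v. ereal (W (u, v)))" using R that by simp
    also have "\<dots> \<le> ereal (W (u, v))" by (rule INF_lower) simp
    finally show ?thesis by simp
  qed
  then show ?thesis using c(1) by (intro that[of "max R 1" c]) auto
qed

lemma energy_L2:
  assumes "H2 u z g" "energy W u z g \<le> ennreal E" "E \<ge> 0"
  shows "sq_nn_integral g \<le> ennreal (2 * E)"
proof -
  have [measurable]: "g \<in> borel_measurable borel" using assms(1) by (simp add: H2_def L2_loc_def)
  have "sq_nn_integral g = (\<integral>\<^sup>+x. ennreal 2 * ennreal (1/2 * (norm (g x))\<^sup>2) \<partial>lborel)"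
    by (subst ennreal_mult[symmetric]) auto
  also have "\<dots> = ennreal 2 * (\<integral>\<^sup>+x. ennreal (1/2 * (norm (g x))\<^sup>2) \<partial>lborel)"
    by (rule nn_integral_cmult) measurable
  also have "(\<integral>\<^sup>+x. ennreal (1/2 * (norm (g x))\<^sup>2) \<partial>lborel) \<le> energy W u z g"
    unfolding energy_def by (intro nn_integral_mono ennreal_leI) (simp add: W_nonneg)
  also have "\<dots> \<le> ennreal E" by fact
  finally show ?thesis using assms(3) by (simp add: ennreal_mult mult_left_mono)
qed

text \<open>A velocity far above \<open>2 * R\<close> cannot be lost within time \<open>T\<close>,
  since the energy controls its Holder constant. Such a path moves so fast in one direction that any
  two visits to the ball of radius \<open>R\<close> are less than 1 apart; it spends the rest of the
  time outside, where every unit of time costs \<open>c\<close>, and exceeds the energy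
  bound.\<close>

lemma energy_bounds:
  assumes "E \<ge> 0"
  obtains M where "M > 0" "\<And>u z g. H2 u z g \<Longrightarrow> energy W u z g \<le> ennreal E \<Longrightarrow>
    (\<forall>x. norm (z x) \<le> M \<and> norm (u x) \<le> M)"
proof -
  obtain R c where R: "R > 0" and c: "c > 0" and W: "\<And>u v. norm u \<ge> R \<Longrightarrow> W (u, v) \<ge> c"
    using W_large by blast
  \<comment> \<open>Removing a window of length 2 around one visit to the ball leaves more than
    \<open>2 * E / c\<close> of time in at most two pieces, whereas each piece may last at most
    \<open>E / c\<close>.\<close>
  define T where "T = 2 * E / c + 6"
  have T: "T \<ge> 6" using assms c by (simp add: T_def)
  \<comment> \<open>\<open>sqrt (2 * E * T)\<close> bounds the change of velocity within time
    \<open>T\<close>; the remaining speed \<open>2 * R\<close> crosses the ball of radius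
    \<open>R\<close> in unit time.\<close>
  define M1 where "M1 = 2 * R + sqrt (2 * E * T)"
  have M1: "M1 > 0" using R assms T unfolding M1_def by (intro add_pos_nonneg) auto
  define M where "M = R + M1 * (E / c + 2)"
  have "M1 \<le> M"
  proof -
    have "M1 * 1 \<le> M1 * (E / c + 2)" using M1 assms c by (intro mult_left_mono) (auto intro: add_increasing)
    then show ?thesis using R by (simp add: M_def)
  qed
  show ?thesis
  proof (rule that[of M])
    show "M > 0" using M1 \<open>M1 \<le> M\<close> by simp
    fix u z g assume h: "H2 u z g" and en: "energy W u z g \<le> ennreal E"
    have out: "b - a \<le> E / c" if "a \<le> b" "\<And>x. x \<in> {a..b} \<Longrightarrow> norm (u x) \<ge> R" for a b
    proof -
      have "(b - a) * c \<le> E"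
        by (rule energy_interval[OF en assms]) (use that c W in auto)
      then show ?thesis using c by (simp add: pos_le_divide_eq)
    qed
    have pz: "primitive z g" "L2_loc g" and pu: "primitive u z" using h by (auto simp: H2_def)
    have zb: "norm (z x0) \<le> M1" for x0
    proof (rule ccontr)
      assume "\<not> norm (z x0) \<le> M1"
      then have big: "norm (z x0) - sqrt (2 * E * T) > 2 * R" by (simp add: M1_def)
      moreover have "sqrt (2 * E * T) \<ge> 0" using assms T by simp
      ultimately have "norm (z x0) > 0" using R by linarith
      then have z0: "z x0 \<noteq> 0" by simp
      define e where "e = (1 / norm (z x0)) *\<^sub>R z x0"
      have e: "norm e = 1" "z x0 \<bullet> e = norm (z x0)"
        using z0 by (simp_all add: e_def) (simp add: power2_norm_eq_inner[symmetric] power2_eq_square)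
      have ze: "z t \<bullet> e > 2 * R" if "t \<in> {x0..x0+T}" for t
      proof -
        have "(norm (z t - z x0))\<^sup>2 \<le> (t - x0) * (2 * E)"
          using primitive_Holder[OF pz _ energy_L2[OF h en assms]] that assms by auto
        also have "\<dots> \<le> T * (2 * E)" using that assms by (intro mult_right_mono) auto
        finally have "norm (z t - z x0) \<le> sqrt (2 * E * T)"
          by (intro real_le_rsqrt) (simp add: mult.commute)
        moreover have "\<bar>(z t - z x0) \<bullet> e\<bar> \<le> norm (z t - z x0)"
          using Cauchy_Schwarz_ineq2[of "z t - z x0" e] e by simp
        ultimately show ?thesis using big e(2) by (simp add: inner_diff_left)
      qed
      have pe: "primitive (\<lambda>x. u x \<bullet> e) (\<lambda>x. z x \<bullet> e)"
        by (rule primitive_bounded_linear[OF bounded_linear_inner_left pu])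
      have close: "t2 - t1 < 1" if "x0 \<le> t1" "t1 \<le> t2" "t2 \<le> x0 + T" "norm (u t1) < R" "norm (u t2) < R" for t1 t2
      proof (rule ccontr)
        assume "\<not> t2 - t1 < 1"
        have "((\<lambda>x. 2 * R) has_integral (t2 - t1) * (2 * R)) {t1..t2}"
          using has_integral_const_real[of "2*R" t1 t2] that(2) by simp
        then have "(t2 - t1) * (2 * R) \<le> u t2 \<bullet> e - u t1 \<bullet> e"
          by (rule has_integral_le[OF _ primitive_has_integral[OF pe that(2)]])
            (use ze that in \<open>auto intro: less_imp_le\<close>)
        moreover have "1 * (2 * R) \<le> (t2 - t1) * (2 * R)"
          using \<open>\<not> t2 - t1 < 1\<close> R by (intro mult_right_mono) auto
        moreover have "\<bar>u t2 \<bullet> e\<bar> < R" "\<bar>u t1 \<bullet> e\<bar> < R"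
          using that Cauchy_Schwarz_ineq2[of "u t2" e] Cauchy_Schwarz_ineq2[of "u t1" e] e by auto
        ultimately show False by linarith
      qed
      show False
      proof (cases "\<exists>t1\<in>{x0..x0+T}. norm (u t1) < R")
        case True
        then obtain t1 where t1: "x0 \<le> t1" "t1 \<le> x0 + T" "norm (u t1) < R" by auto
        have lo: "t1 - 1 - x0 \<le> E / c" if "x0 \<le> t1 - 1"
        proof (rule out[OF that])
          fix x assume x: "x \<in> {x0..t1 - 1}"
          show "norm (u x) \<ge> R"
          proof (rule ccontr)
            assume "\<not> norm (u x) \<ge> R"
            then show False using close[of x t1] x t1 by auto
          qed
        qed
        have hi: "x0 + T - (t1 + 1) \<le> E / c" if "t1 + 1 \<le> x0 + T"
        proof (rule out[OF that])
          fix x assume x: "x \<in> {t1 + 1..x0 + T}"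
          show "norm (u x) \<ge> R"
          proof (rule ccontr)
            assume "\<not> norm (u x) \<ge> R"
            then show False using close[of t1 x] x t1 by auto
          qed
        qed
        have "E / c \<ge> 0" using assms c by simp
        moreover have "T = E / c + E / c + 6" by (simp add: T_def)
        ultimately show False using lo hi by linarith
      next
        case False
        then have "T \<le> E / c" using out[of x0 "x0 + T"] T by force
        moreover have "E / c \<ge> 0" using assms c by simp
        ultimately show False using T by (simp add: T_def)
      qed
    qed
    have ub: "norm (u x0) \<le> M" for x0
    proof -
      have Ec: "E / c \<ge> 0" using assms c by simp
      \<comment> \<open>Staying outside the ball for a time \<open>E / c + 1\<close> would cost more
        than \<open>E\<close>; from the next visit the position is recovered through the speed bound
        \<open>M1\<close>.\<close>
      have "\<exists>t\<in>{x0..x0 + (E / c + 1)}. norm (u t) < R"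
      proof (rule ccontr)
        assume "\<not> ?thesis"
        then show False using out[of x0 "x0 + (E / c + 1)"] Ec by force
      qed
      then obtain t where t: "x0 \<le> t" "t \<le> x0 + (E / c + 1)" "norm (u t) < R" by auto
      have "norm (u t - u x0) \<le> M1 * Henstock_Kurzweil_Integration.content (cbox x0 t)"
        by (rule has_integral_bound[where f=z])
          (use primitive_has_integral[OF pu t(1)] zb M1 in \<open>auto intro: less_imp_le\<close>)
      then have "norm (u t - u x0) \<le> M1 * (t - x0)" using t by simp
      also have "\<dots> \<le> M1 * (E / c + 2)" using t M1 by (intro mult_left_mono) auto
      finally show ?thesis using t(3) norm_triangle_ineq4[of "u t" "u t - u x0"] by (simp add: M_def)
    qed
    show "\<forall>x. norm (z x) \<le> M \<and> norm (u x) \<le> M"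
      using zb ub \<open>M1 \<le> M\<close> order_trans by blast
  qed
qed

lemma energy_integrable:
  assumes h: "H2 u z g" and e: "energy W u z g < \<infinity>"
  shows "integrable lborel (\<lambda>x. 1/2 * (norm (g x))\<^sup>2 + W (u x, z x))"
proof -
  note [measurable] = H2_measurable[OF h]
  show ?thesis
    by (rule integrableI_nonneg) (use e in \<open>auto simp: energy_def W_nonneg\<close>)
qed

lemma finite_energyD:
  assumes h: "H2 u z g" and e: "energy W u z g < \<infinity>"
  obtains M where "M > 0" "\<And>x. norm (z x) \<le> M" "\<And>x. norm (u x) \<le> M"
proof -
  define E where "E = enn2real (energy W u z g)"
  have "energy W u z g = ennreal E" "E \<ge> 0" using e by (auto simp: E_def)
  then show ?thesis using energy_bounds[of E] h that by (metis order_refl)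
qed

text \<open>Square integrability of \<open>g\<close> makes the velocity almost constant on long
  intervals far out. The displacement over a time \<open>T\<close> is then close to
  \<open>T *\<^sub>R z x\<close>, yet it cannot exceed \<open>2 * M\<close>.\<close>

lemma finite_energy_derivative_tendsto_0:
  assumes h: "H2 u z g" and e: "energy W u z g < \<infinity>"
  shows "(z \<longlongrightarrow> 0) at_infinity"
proof -
  obtain M where M: "M > 0" "\<And>x. norm (z x) \<le> M" "\<And>x. norm (u x) \<le> M"
    using finite_energyD[OF h e] by blast
  have pz: "primitive z g" "L2_loc g" and pu: "primitive u z" using h by (auto simp: H2_def)
  have ig: "integrable lborel (\<lambda>x. (norm (g x))\<^sup>2)"
  proof (rule Bochner_Integration.integrable_bound)
    show "integrable lborel (\<lambda>x. 2 * (1/2 * (norm (g x))\<^sup>2 + W (u x, z x)))"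
      using energy_integrable[OF h e] by (rule integrable_mult_right)
    show "AE x in lborel. norm ((norm (g x))\<^sup>2) \<le> norm (2 * (1/2 * (norm (g x))\<^sup>2 + W (u x, z x)))"
    proof (rule AE_I2)
      fix x show "norm ((norm (g x))\<^sup>2) \<le> norm (2 * (1/2 * (norm (g x))\<^sup>2 + W (u x, z x)))"
        using W_nonneg[of "u x" "z x"] by simp
    qed
  next
    have [measurable]: "g \<in> borel_measurable borel" using pz(2) by (simp add: L2_loc_def)
    show "(\<lambda>x. (norm (g x))\<^sup>2) \<in> borel_measurable lborel" by measurable
  qed
  have "\<exists>b. \<forall>x. b \<le> norm x \<longrightarrow> norm (z x) \<le> \<delta>" if \<delta>: "\<delta> > 0" for \<delta>
  proof -
    \<comment> \<open>Chosen so that the largest displacement \<open>2 * M\<close> equals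
      \<open>\<delta>/2 * T\<close>; the other half of the bound is the variation allowed to the
      velocity.\<close>
    define T where "T = 4 * M / \<delta>"
    have T: "T > 0" using M \<delta> by (simp add: T_def)
    define \<epsilon> where "\<epsilon> = (\<delta>/2)\<^sup>2 / T"
    have \<epsilon>: "\<epsilon> > 0" using T \<delta> by (simp add: \<epsilon>_def)
    obtain X where X: "\<And>a b. (\<forall>x\<in>{a..b}. \<bar>x\<bar> \<ge> X) \<Longrightarrow> (LBINT x:{a..b}. (norm (g x))\<^sup>2) \<le> \<epsilon>"
      using integral_interval_tail[OF ig _ \<epsilon>] by auto
    \<comment> \<open>The surplus \<open>T\<close> keeps all of \<open>{x..x+T}\<close> beyond
      \<open>X\<close> in absolute value, also when \<open>x\<close> is negative.\<close>
    have "norm (z x) \<le> \<delta>" if x: "\<bar>x\<bar> \<ge> X + T" for x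
    proof -
      have zt: "norm (z t - z x) \<le> \<delta>/2" if t: "t \<in> {x..x+T}" for t
      proof -
        have "\<forall>s\<in>{x..t}. \<bar>s\<bar> \<ge> X" using x t by auto
        then have "(LBINT x:{x..t}. (norm (g x))\<^sup>2) \<le> \<epsilon>" by (rule X)
        then have "(t - x) * (LBINT x:{x..t}. (norm (g x))\<^sup>2) \<le> T * \<epsilon>"
          using t T \<epsilon> by (intro mult_mono) (auto simp: set_lebesgue_integral_def intro: integral_nonneg_AE)
        then have "(norm (z t - z x))\<^sup>2 \<le> (\<delta>/2)\<^sup>2"
          using primitive_Cauchy_Schwarz[OF pz, of x t] t T by (simp add: \<epsilon>_def)
        then show ?thesis by (rule power2_le_imp_le) (use \<delta> in simp)
      qed
      have "primitive (\<lambda>t. u t - t *\<^sub>R z x) (\<lambda>t. z t - z x)"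
      proof (rule primitive_diff[OF pu])
        show "primitive (\<lambda>t. t *\<^sub>R z x) (\<lambda>t. z x)"
          by (rule primitive_C1) (auto intro!: derivative_eq_intros)
      qed
      then have "norm ((u (x+T) - (x+T) *\<^sub>R z x) - (u x - x *\<^sub>R z x)) \<le> \<delta>/2 * ((x+T) - x)"
        by (rule primitive_bound) (use T \<delta> zt in auto)
      then have "norm (T *\<^sub>R z x - (u (x+T) - u x)) \<le> \<delta>/2 * T"
        by (simp add: algebra_simps norm_minus_commute)
      then have "norm (T *\<^sub>R z x) \<le> \<delta>/2 * T + norm (u (x+T) - u x)"
        using norm_triangle_ineq2[of "T *\<^sub>R z x" "u (x+T) - u x"] by linarith
      also have "norm (u (x+T) - u x) \<le> 2 * M"
        using norm_triangle_ineq4[of "u (x+T)" "u x"] M(3)[of x] M(3)[of "x+T"] by linarith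
      also have "2 * M = \<delta>/2 * T" using \<delta> by (simp add: T_def)
      finally have "T * norm (z x) \<le> T * \<delta>" using T by (simp add: mult.commute)
      then show ?thesis using T by simp
    qed
    then show ?thesis by (intro exI[of _ "X + T"]) simp
  qed
  then show ?thesis unfolding tendsto_iff dist_norm eventually_at_infinity
    by (metis diff_zero field_lbound_gt_zero order_le_less_trans)
qed

text \<open>The minimum of \<open>W (u, 0)\<close> over the compact set of bounded points away from
  the zeros is positive, and uniform continuity preserves half of it for small velocities.\<close>

lemma W_positive_away:
  assumes "\<delta> > 0"
  obtains c \<eta> where "c > 0" "\<eta> > 0"
    "\<And>u v. norm u \<le> M \<Longrightarrow> infdist u (Am \<union> Ap) \<ge> \<delta> \<Longrightarrow> norm v \<le> \<eta> \<Longrightarrow> W (u, v) \<ge> c"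
proof -
  let ?K = "cball 0 M \<inter> {u. infdist u (Am \<union> Ap) \<ge> \<delta>}"
  have cK: "compact ?K"
    by (intro compact_Int_closed compact_cball closed_Collect_le continuous_intros)
  show ?thesis
  proof (cases "?K = {}")
    case True
    then show ?thesis by (intro that[of 1 1]) auto
  next
    case False
    have "continuous_on ?K (\<lambda>u. W (u, 0))"
      by (rule continuous_on_compose2[OF W_continuous[of UNIV]]) (auto intro!: continuous_intros)
    then obtain u0 where u0: "u0 \<in> ?K" "\<And>u. u \<in> ?K \<Longrightarrow> W (u0, 0) \<le> W (u, 0)"
      using continuous_attains_inf[OF cK False] by blast
    have "W (u0, 0) \<noteq> 0"
    proof
      assume "W (u0, 0) = 0"
      then have "u0 \<in> Am \<union> Ap" using zeros by blast
      then have "infdist u0 (Am \<union> Ap) = 0" by simp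
      then show False using u0 assms by auto
    qed
    then have c0: "W (u0, 0) > 0" using W_nonneg[of u0 0] by simp
    have "uniformly_continuous_on (?K \<times> cball 0 1) W"
      by (intro compact_uniformly_continuous W_continuous compact_Times cK compact_cball)
    then have "\<exists>d>0. \<forall>p\<in>?K \<times> cball 0 1. \<forall>p'\<in>?K \<times> cball 0 1. dist p' p < d \<longrightarrow>
        dist (W p') (W p) < W (u0, 0) / 2"
      unfolding uniformly_continuous_on_def using half_gt_zero[OF c0] by presburger
    then obtain d where d: "d > 0" "\<And>p p'. p \<in> ?K \<times> cball 0 1 \<Longrightarrow> p' \<in> ?K \<times> cball 0 1 \<Longrightarrow> dist p' p < d \<Longrightarrow>
        dist (W p') (W p) < W (u0, 0) / 2"
      by blast
    show ?thesis
    proof (rule that[of "W (u0, 0) / 2" "min 1 (d/2)"])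
      fix u v :: 'a assume *: "norm u \<le> M" "infdist u (Am \<union> Ap) \<ge> \<delta>" "norm v \<le> min 1 (d/2)"
      have "dist (u, v) (u, 0) = norm v" by (simp add: dist_Pair_Pair)
      then have "dist (W (u, v)) (W (u, 0)) < W (u0, 0) / 2"
        using * d(1) by (intro d(2)) auto
      moreover have "W (u0, 0) \<le> W (u, 0)" using * by (intro u0(2)) auto
      ultimately show "W (u0, 0) / 2 \<le> W (u, v)" unfolding dist_real_def by linarith
    qed (use c0 d in auto)
  qed
qed

text \<open>A point far from the zeros, met at small speed, keeps the path away from them for a unit
  of time and costs a fixed amount \<open>c\<close>, while the tail of the energy is at most
  \<open>c/2\<close>.\<close>

lemma finite_energy_infdist_tendsto_0:
  assumes h: "H2 u z g" and e: "energy W u z g < \<infinity>"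
  shows "((\<lambda>x. infdist (u x) (Am \<union> Ap)) \<longlongrightarrow> 0) at_infinity"
proof -
  obtain M where M: "M > 0" "\<And>x. norm (z x) \<le> M" "\<And>x. norm (u x) \<le> M"
    using finite_energyD[OF h e] by blast
  have pu: "primitive u z" using h by (auto simp: H2_def)
  note i = energy_integrable[OF h e]
  have "\<exists>b. \<forall>x. b \<le> norm x \<longrightarrow> infdist (u x) (Am \<union> Ap) < \<delta>" if \<delta>: "\<delta> > 0" for \<delta>
  proof -
    obtain c \<eta> where c: "c > 0" and \<eta>: "\<eta> > 0"
      and W: "\<And>u v. norm u \<le> M \<Longrightarrow> infdist u (Am \<union> Ap) \<ge> \<delta>/2 \<Longrightarrow> norm v \<le> \<eta> \<Longrightarrow> W (u, v) \<ge> c"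
      using W_positive_away[of "\<delta>/2" M] \<delta> by (metis half_gt_zero)
    \<comment> \<open>The bound \<eta> lets \<open>W\<close> be estimated from below; \<delta>/2
      limits the displacement over one unit of time, so that half of the distance \<delta>
      survives.\<close>
    have "min \<eta> (\<delta>/2) > 0" using \<eta> \<delta> by simp
    then obtain X1 where X1: "\<And>x. \<bar>x\<bar> \<ge> X1 \<Longrightarrow> norm (z x) < min \<eta> (\<delta>/2)"
      using finite_energy_derivative_tendsto_0[OF h e]
      unfolding tendsto_iff dist_norm eventually_at_infinity by (metis diff_zero real_norm_def)
    obtain X2 where X2: "\<And>a b. (\<forall>x\<in>{a..b}. \<bar>x\<bar> \<ge> X2) \<Longrightarrow>
        (LBINT x:{a..b}. 1/2 * (norm (g x))\<^sup>2 + W (u x, z x)) \<le> c/2"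
      using integral_interval_tail[OF i _ half_gt_zero[OF c]] W_nonneg by auto
    have "infdist (u x) (Am \<union> Ap) < \<delta>" if x: "\<bar>x\<bar> \<ge> \<bar>X1\<bar> + \<bar>X2\<bar> + 1" for x
    proof (rule ccontr)
      assume far: "\<not> infdist (u x) (Am \<union> Ap) < \<delta>"
      have out: "\<bar>t\<bar> \<ge> X1" "\<bar>t\<bar> \<ge> X2" if "t \<in> {x..x+1}" for t using x that by auto
      have Wc: "c \<le> W (u t, z t)" if t: "t \<in> {x..x+1}" for t
      proof (rule W[OF M(3)])
        show "norm (z t) \<le> \<eta>" using X1[OF out(1)[OF t]] by simp
        have "norm (u t - u x) \<le> \<delta>/2 * (t - x)"
        proof (rule primitive_bound[OF pu])
          show "norm (z s) \<le> \<delta>/2" if "s \<in> {x..t}" for s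
            using X1[OF out(1), of s] that t by auto
        qed (use t \<delta> in auto)
        also have "\<dots> \<le> \<delta>/2 * 1" using t \<delta> by (intro mult_left_mono) auto
        finally have "dist (u x) (u t) \<le> \<delta>/2" by (simp add: dist_norm norm_minus_commute)
        then show "\<delta>/2 \<le> infdist (u t) (Am \<union> Ap)"
          using infdist_triangle[of "u x" "Am \<union> Ap" "u t"] far by linarith
      qed
      have "(LBINT t:{x..x+1}. c) \<le> (LBINT t:{x..x+1}. 1/2 * (norm (g t))\<^sup>2 + W (u t, z t))"
      proof (rule set_integral_mono)
        show "set_integrable lborel {x..x+1} (\<lambda>t. c)"
          by (rule borel_integrable_atLeastAtMost') simp
        show "set_integrable lborel {x..x+1} (\<lambda>t. 1/2 * (norm (g t))\<^sup>2 + W (u t, z t))"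
          unfolding set_integrable_def by (intro integrable_mult_indicator i) simp
        show "c \<le> 1/2 * (norm (g t))\<^sup>2 + W (u t, z t)" if "t \<in> {x..x+1}" for t
        proof -
          have "0 \<le> 1/2 * (norm (g t))\<^sup>2" by simp
          then show ?thesis using Wc[OF that] by linarith
        qed
      qed
      also have "\<dots> \<le> c/2" by (rule X2) (use out in blast)
      finally show False using c by (simp add: set_lebesgue_integral_def)
    qed
    then show ?thesis by (intro exI[of _ "\<bar>X1\<bar> + \<bar>X2\<bar> + 1"]) simp
  qed
  then show ?thesis unfolding tendsto_iff eventually_at_infinity
    by (simp add: dist_real_def infdist_nonneg)
qed

end

section \<open>Existence of a minimizer\<close>

lemma set_integrable_glue:
  fixes g1 g2 :: "real \<Rightarrow> 'a::euclidean_space"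
  assumes "set_integrable lborel A g1" "set_integrable lborel A g2"
  shows "set_integrable lborel A (\<lambda>x. if x \<le> c then g1 x else g2 x)"
proof -
  have "integrable lborel (\<lambda>x. indicator {..c} x *\<^sub>R (indicator A x *\<^sub>R g1 x)
      + indicator {c<..} x *\<^sub>R (indicator A x *\<^sub>R g2 x))"
    by (rule Bochner_Integration.integrable_add[OF
          integrable_mult_indicator[OF _ assms(1)[unfolded set_integrable_def]]
          integrable_mult_indicator[OF _ assms(2)[unfolded set_integrable_def]]]) auto
  moreover have "(\<lambda>x. indicator {..c} x *\<^sub>R (indicator A x *\<^sub>R g1 x)
      + indicator {c<..} x *\<^sub>R (indicator A x *\<^sub>R g2 x))
    = (\<lambda>x. indicator A x *\<^sub>R (if x \<le> c then g1 x else g2 x))"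
    by (auto simp: indicator_def)
  ultimately show ?thesis by (simp add: set_integrable_def)
qed

lemma primitive_glue:
  assumes 1: "primitive f1 g1" and 2: "primitive f2 g2" and c: "f1 c = f2 c"
  shows "primitive (\<lambda>x. if x \<le> c then f1 x else f2 x) (\<lambda>x. if x \<le> c then g1 x else g2 x)"
    (is "primitive ?f ?g")
proof -
  have "L1_loc ?g"
    using primitive_L1_loc[OF 1] primitive_L1_loc[OF 2]
    unfolding L1_loc_def by (auto intro: set_integrable_glue)
  moreover have l: "(?g has_integral (?f b - ?f a)) {a..b}" if "a \<le> b" "b \<le> c" for a b
    using has_integral_cong[of "{a..b}" ?g g1] primitive_has_integral[OF 1 that(1)] that by auto
  moreover have r: "(?g has_integral (?f b - ?f a)) {a..b}" if "a \<le> b" "c \<le> a" for a b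
  proof -
    have "?f a = f2 a" using c that by (cases "a = c") auto
    moreover have "?f b = f2 b" using c that by (cases "b = c") auto
    ultimately have "(g2 has_integral (?f b - ?f a)) {a..b}"
      using primitive_has_integral[OF 2 that(1)] by simp
    \<comment> \<open>At \<open>c\<close> the glued derivative takes the value of \<open>g1\<close>;
      for \<open>a = c\<close> this is a single exceptional point.\<close>
    then show ?thesis
      by (rule has_integral_spike_finite[of "{c}", rotated 2]) (use that in auto)
  qed
  moreover have "(?g has_integral (?f b - ?f a)) {a..b}" if "a \<le> b" for a b
  proof -
    consider "b \<le> c" | "c \<le> a" | "a \<le> c" "c \<le> b" by linarith
    then show ?thesis
    proof cases
      case 3
      have "(?g has_integral (?f c - ?f a) + (?f b - ?f c)) {a..b}"
        by (rule has_integral_combine[OF 3 l[OF 3(1) order_refl] r[OF 3(2) order_refl]])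
      then show ?thesis by simp
    qed (use l r that in auto)
  qed
  ultimately show ?thesis by (simp add: primitive_def)
qed

lemma H2_glue:
  assumes 1: "H2 u1 z1 g1" and 2: "H2 u2 z2 g2" and c: "u1 c = u2 c" "z1 c = z2 c"
  shows "H2 (\<lambda>x. if x \<le> c then u1 x else u2 x) (\<lambda>x. if x \<le> c then z1 x else z2 x)
    (\<lambda>x. if x \<le> c then g1 x else g2 x)"
proof -
  have sq: "(\<lambda>x. (norm (if x \<le> c then g1 x else g2 x))\<^sup>2)
      = (\<lambda>x. if x \<le> c then (norm (g1 x))\<^sup>2 else (norm (g2 x))\<^sup>2)" by auto
  have "L2_loc (\<lambda>x. if x \<le> c then g1 x else g2 x)"
    unfolding L2_loc_def sq using 1 2 by (auto simp: H2_def L2_loc_def intro: set_integrable_glue)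
  then show ?thesis using 1 2 c unfolding H2_def by (auto intro: primitive_glue)
qed

lemma H2_C2:
  assumes "\<And>x. (u has_vector_derivative z x) (at x)" "\<And>x. (z has_vector_derivative g x) (at x)"
    "continuous_on UNIV g"
  shows "H2 u z g"
proof -
  have "continuous_on UNIV z"
    using assms(2) by (intro continuous_at_imp_continuous_on) (blast intro: has_vector_derivative_continuous)
  then show ?thesis unfolding H2_def
    using assms by (auto intro: primitive_C1 continuous_L2_loc)
qed

lemma H2_const: "H2 (\<lambda>x. a) (\<lambda>x. 0) (\<lambda>x. 0)"
  by (rule H2_C2) auto

text \<open>On \<open>{c..c+1}\<close> the cubic Hermite polynomial joins \<open>(u c, z c)\<close> to the rest point \<open>(a, 0)\<close>.\<close>

lemma H2_connect:
  fixes u z g :: "real \<Rightarrow> 'a::euclidean_space" and a :: 'a and c :: real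
  assumes h: "H2 u z g"
  defines "r \<equiv> norm (u c - a) + norm (z c)"
  shows "\<exists>w w' w''. H2 w w' w'' \<and> (\<forall>x\<le>c. w x = u x \<and> w' x = z x \<and> w'' x = g x) \<and>
    (\<forall>x>c + 1. w x = a \<and> w' x = 0 \<and> w'' x = 0) \<and>
    (\<forall>x. c < x \<longrightarrow> x \<le> c + 1 \<longrightarrow> norm (w x - a) \<le> 18 * r \<and> norm (w' x) \<le> 18 * r \<and> norm (w'' x) \<le> 18 * r)"
proof -
  define p v where "p = u c - a" and "v = z c"
  \<comment> \<open>The coefficients of \<open>p\<close> and \<open>v\<close> are the Hermite basis
    polynomials in \<open>x - c\<close>: value 1 and slope 0, respectively value 0 and slope 1, at
    0, and a double zero at 1.\<close>
  define h0 where "h0 x = a + (1 - 3*(x-c)^2 + 2*(x-c)^3) *\<^sub>R p + ((x-c) - 2*(x-c)^2 + (x-c)^3) *\<^sub>R v" for x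
  define h1 where "h1 x = (6*(x-c)^2 - 6*(x-c)) *\<^sub>R p + (1 - 4*(x-c) + 3*(x-c)^2) *\<^sub>R v" for x
  define h2 where "h2 x = (12*(x-c) - 6) *\<^sub>R p + (6*(x-c) - 4) *\<^sub>R v" for x
  have hh: "H2 h0 h1 h2"
  proof (rule H2_C2)
    show "(h0 has_vector_derivative h1 x) (at x)" for x
      unfolding h0_def h1_def
      by (auto intro!: derivative_eq_intros simp: has_real_derivative_iff_has_vector_derivative[symmetric])
    show "(h1 has_vector_derivative h2 x) (at x)" for x
      unfolding h1_def h2_def
      by (auto intro!: derivative_eq_intros simp: has_real_derivative_iff_has_vector_derivative[symmetric])
    show "continuous_on UNIV h2" unfolding h2_def by (intro continuous_intros)
  qed
  have inner: "H2 (\<lambda>x. if x \<le> c + 1 then h0 x else a) (\<lambda>x. if x \<le> c + 1 then h1 x else 0)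
      (\<lambda>x. if x \<le> c + 1 then h2 x else 0)"
    by (rule H2_glue[OF hh H2_const]) (simp_all add: h0_def h1_def)
  have H: "H2 (\<lambda>x. if x \<le> c then u x else if x \<le> c + 1 then h0 x else a)
      (\<lambda>x. if x \<le> c then z x else if x \<le> c + 1 then h1 x else 0)
      (\<lambda>x. if x \<le> c then g x else if x \<le> c + 1 then h2 x else 0)"
    by (rule H2_glue[OF h inner]) (simp_all add: h0_def h1_def p_def v_def)
  \<comment> \<open>18 is the sum of the absolute coefficients of \<open>12 t - 6\<close>, the
    largest such sum among the six polynomials, so it bounds all of them on
    \<open>{0..1}\<close>.\<close>
  have two: "norm (\<alpha> *\<^sub>R p + \<beta> *\<^sub>R v) \<le> 18 * r" if "\<bar>\<alpha>\<bar> \<le> 18" "\<bar>\<beta>\<bar> \<le> 18" for \<alpha> \<beta>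
  proof -
    have "norm (\<alpha> *\<^sub>R p + \<beta> *\<^sub>R v) \<le> \<bar>\<alpha>\<bar> * norm p + \<bar>\<beta>\<bar> * norm v"
      using norm_triangle_ineq[of "\<alpha> *\<^sub>R p" "\<beta> *\<^sub>R v"] by simp
    also have "\<dots> \<le> 18 * norm p + 18 * norm v" using that by (intro add_mono mult_right_mono) auto
    finally show ?thesis by (simp add: r_def p_def v_def)
  qed
  have b: "norm (h0 x - a) \<le> 18 * r \<and> norm (h1 x) \<le> 18 * r \<and> norm (h2 x) \<le> 18 * r"
    if "c < x" "x \<le> c + 1" for x
  proof -
    define t where "t = x - c"
    have t: "0 \<le> t" "t \<le> 1" "0 \<le> t^2" "t^2 \<le> 1" "0 \<le> t^3" "t^3 \<le> 1"
      using that by (auto simp: t_def power_le_one)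
    have "h0 x - a = (1 - 3*t^2 + 2*t^3) *\<^sub>R p + (t - 2*t^2 + t^3) *\<^sub>R v"
      by (simp add: h0_def t_def)
    then have "norm (h0 x - a) \<le> 18 * r"
      using two[of "1 - 3*t^2 + 2*t^3" "t - 2*t^2 + t^3"] t by (simp add: abs_le_iff)
    moreover have "norm (h1 x) \<le> 18 * r"
      unfolding h1_def t_def[symmetric] using t by (intro two abs_leI) linarith+
    moreover have "norm (h2 x) \<le> 18 * r"
      unfolding h2_def t_def[symmetric] using t by (intro two abs_leI) linarith+
    ultimately show ?thesis by blast
  qed
  show ?thesis
    by (rule exI, rule exI, rule exI, rule conjI[OF H]) (use b in auto)
qed

text \<open>Tail infima increase, so their suprema add up termwise. This joins the separate
  semicontinuity estimates for the two parts of the energy.\<close>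

lemma ennreal_liminf_add:
  fixes a b :: "nat \<Rightarrow> ennreal"
  shows "liminf a + liminf b \<le> liminf (\<lambda>n. a n + b n)"
proof -
  have inc: "incseq (\<lambda>n. INF m\<in>{n..}. f m)" for f :: "nat \<Rightarrow> ennreal"
    by (intro incseq_SucI INF_superset_mono) auto
  have "liminf a + liminf b = (SUP n. (INF m\<in>{n..}. a m) + (INF m\<in>{n..}. b m))"
    unfolding liminf_SUP_INF by (rule ennreal_SUP_add[symmetric, OF inc inc])
  also have "\<dots> \<le> (SUP n. INF m\<in>{n..}. a m + b m)"
    by (intro SUP_mono' INF_greatest add_mono INF_lower) auto
  finally show ?thesis by (simp add: liminf_SUP_INF)
qed

section \<open>Estimates near the wells and competitors\<close>

context double_well
begin

lemma energy_split:
  assumes "H2 u z g"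
  shows "energy W u z g = (\<integral>\<^sup>+x. ennreal (1/2 * (norm (g x))\<^sup>2) \<partial>lborel) + (\<integral>\<^sup>+x. ennreal (W (u x, z x)) \<partial>lborel)"
proof -
  note [measurable] = H2_measurable[OF assms]
  have "energy W u z g = (\<integral>\<^sup>+x. ennreal (1/2 * (norm (g x))\<^sup>2) + ennreal (W (u x, z x)) \<partial>lborel)"
    unfolding energy_def by (intro nn_integral_cong ennreal_plus) (auto simp: W_nonneg)
  also have "\<dots> = (\<integral>\<^sup>+x. ennreal (1/2 * (norm (g x))\<^sup>2) \<partial>lborel) + (\<integral>\<^sup>+x. ennreal (W (u x, z x)) \<partial>lborel)"
    by (rule nn_integral_add) measurable
  finally show ?thesis .
qed

lemma W_bounded_on_bounded:
  obtains B where "B > 0" "\<And>u v. norm u \<le> M \<Longrightarrow> norm v \<le> M \<Longrightarrow> W (u, v) \<le> B"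
proof -
  have "bounded (W ` (cball 0 M \<times> cball 0 M))"
    by (intro compact_imp_bounded compact_continuous_image W_continuous compact_Times compact_cball)
  then obtain B where "B > 0" "\<forall>y\<in>W ` (cball 0 M \<times> cball 0 M). norm y \<le> B"
    unfolding bounded_pos by blast
  then have "W (u, v) \<le> B" if "norm u \<le> M" "norm v \<le> M" for u v
    using that by (force simp: abs_le_iff)
  then show ?thesis using that \<open>B > 0\<close> by blast
qed

text \<open>Uniformity over all zeros comes from compactness: one bounded set contains them together
  with their neighbourhoods, and the map is uniformly continuous there. The map is general because
  it will be \<open>W\<close> as well as either of its gradients.\<close>

lemma small_near_zeros:
  fixes \<Phi> :: "'a \<times> 'a \<Rightarrow> 'b::real_normed_vector"
  assumes c: "continuous_on UNIV \<Phi>" and zero: "\<And>a. a \<in> Am \<union> Ap \<Longrightarrow> \<Phi> (a, 0) = 0" and "\<eta> > 0"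
  obtains \<delta> where "\<delta> > 0" "\<And>a u v. a \<in> Am \<union> Ap \<Longrightarrow> norm (u - a) \<le> \<delta> \<Longrightarrow> norm v \<le> \<delta> \<Longrightarrow> norm (\<Phi> (u, v)) \<le> \<eta>"
proof -
  have "bounded (Am \<union> Ap)" using Am Ap compact_imp_bounded by auto
  then obtain B where B: "\<And>a. a \<in> Am \<union> Ap \<Longrightarrow> norm a \<le> B" unfolding bounded_iff by blast
  let ?K = "cball 0 (B + 1) \<times> cball (0::'a) 1"
  have "uniformly_continuous_on ?K \<Phi>"
    by (intro compact_uniformly_continuous continuous_on_subset[OF c] compact_Times compact_cball) simp
  then have "\<exists>d>0. \<forall>p\<in>?K. \<forall>p'\<in>?K. dist p' p < d \<longrightarrow> dist (\<Phi> p') (\<Phi> p) < \<eta>"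
    unfolding uniformly_continuous_on_def using assms by presburger
  then obtain d where d: "d > 0" "\<And>p p'. p \<in> ?K \<Longrightarrow> p' \<in> ?K \<Longrightarrow> dist p' p < d \<Longrightarrow> dist (\<Phi> p') (\<Phi> p) < \<eta>"
    by blast
  show ?thesis
  proof (rule that[of "min 1 (d/3)"])
    fix a u v :: 'a assume *: "a \<in> Am \<union> Ap" "norm (u - a) \<le> min 1 (d/3)" "norm v \<le> min 1 (d/3)"
    have "dist (u, v) (a, 0) \<le> norm (u - a) + norm v"
      by (simp add: dist_norm norm_Pair sqrt_sum_squares_le_sum)
    also have "\<dots> < d" using * d(1) by simp
    finally have "dist (u, v) (a, 0) < d" .
    moreover have "norm u \<le> B + 1"
      using B[OF *(1)] *(2) norm_triangle_ineq[of "u - a" a] by simp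
    ultimately have "dist (\<Phi> (u, v)) (\<Phi> (a, 0)) < \<eta>"
      using * B[OF *(1)] by (intro d(2)) auto
    then show "norm (\<Phi> (u, v)) \<le> \<eta>" using zero[OF *(1)] by simp
  qed (use d in auto)
qed

lemma W_small_near_zeros:
  assumes "\<eta> > 0"
  obtains \<delta> where "\<delta> > 0" "\<And>a u v. a \<in> Am \<union> Ap \<Longrightarrow> norm (u - a) \<le> \<delta> \<Longrightarrow> norm v \<le> \<delta> \<Longrightarrow> W (u, v) \<le> \<eta>"
proof -
  have "W (a, 0) = 0" if "a \<in> Am \<union> Ap" for a using that zeros by blast
  from small_near_zeros[OF W_continuous this assms] show ?thesis
    using that W_nonneg by (metis abs_of_nonneg real_norm_def)
qed

lemma admissible_iff_H2:
  "u \<in> admissible Am Ap q \<longleftrightarrow> (\<exists>z g. H2 u z g) \<and>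
    (\<exists>xm xp. xm < xp \<and> (\<forall>x\<le>xm. infdist (u x) Am \<le> q) \<and> (\<forall>x\<ge>xp. infdist (u x) Ap \<le> q))"
  unfolding admissible_def using W22_loc_imp_H2 H2_imp_W22_loc by auto

text \<open>A rest point of \<open>Am\<close> is connected in unit time to a rest point of
  \<open>Ap\<close>, and only that unit interval costs energy. Hence the infimum is finite.\<close>

lemma admissible_finite_energy_exists: "\<exists>w\<in>admissible Am Ap q. J W w < \<infinity>"
proof -
  obtain a b where ab: "a \<in> Am" "b \<in> Ap" using Am Ap by blast
  define r where "r = norm (a - b) + norm (0::'a)"
  obtain w w' w'' where H: "H2 w w' w''"
    and l: "\<And>x. x \<le> 0 \<Longrightarrow> w x = a \<and> w' x = 0 \<and> w'' x = 0"
    and rt: "\<And>x. x > 0 + 1 \<Longrightarrow> w x = b \<and> w' x = 0 \<and> w'' x = 0"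
    and m: "\<And>x. 0 < x \<Longrightarrow> x \<le> 0 + 1 \<Longrightarrow> norm (w x - b) \<le> 18 * r \<and> norm (w' x) \<le> 18 * r \<and> norm (w'' x) \<le> 18 * r"
    using H2_connect[OF H2_const[of a], where c=0 and a=b] unfolding r_def by blast
  obtain B where B: "B > 0" "\<And>u v. norm u \<le> norm b + 18 * r \<Longrightarrow> norm v \<le> norm b + 18 * r \<Longrightarrow> W (u, v) \<le> B"
    using W_bounded_on_bounded by blast
  have zab: "W (a, 0) = 0" "W (b, 0) = 0" using ab zeros by blast+
  have "J W w = energy W w w' w''" by (rule H2_J_eq_energy[OF H])
  also have "\<dots> \<le> (\<integral>\<^sup>+x. ennreal (1/2 * (18 * r)\<^sup>2 + B) * indicator {0..1::real} x \<partial>lborel)"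
    unfolding energy_def
  proof (rule nn_integral_mono)
    fix x :: real
    consider "x \<le> 0" | "x > 1" | "0 < x" "x \<le> 1" by linarith
    then show "ennreal (1/2 * (norm (w'' x))\<^sup>2 + W (w x, w' x)) \<le> ennreal (1/2 * (18 * r)\<^sup>2 + B) * indicator {0..1} x"
    proof cases
      case 3
      then have n: "norm (w x - b) \<le> 18 * r" "norm (w' x) \<le> 18 * r" "norm (w'' x) \<le> 18 * r" using m by auto
      have "W (w x, w' x) \<le> B"
        using n norm_triangle_sub[of "w x" b] norm_ge_zero[of b] by (intro B(2)) linarith+
      moreover have "(norm (w'' x))\<^sup>2 \<le> (18 * r)\<^sup>2" using n(3) by (intro power_mono) auto
      ultimately show ?thesis using 3 by (auto intro!: ennreal_leI)
    qed (use l rt zab in auto)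
  qed
  also have "\<dots> = ennreal (1/2 * (18 * r)\<^sup>2 + B) * emeasure lborel {0..1::real}"
    by (rule nn_integral_cmult_indicator) simp
  also have "\<dots> < \<infinity>" by (simp add: ennreal_mult_less_top)
  finally have "J W w < \<infinity>" .
  moreover have "w \<in> admissible Am Ap q"
    unfolding admissible_iff_H2
  proof (intro conjI exI)
    show "H2 w w' w''" by (rule H)
    \<comment> \<open>2 rather than 1, because the connecting path is known to rest only at
      \<open>x > 1\<close>.\<close>
    show "(0::real) < 2" by simp
    show "\<forall>x\<le>0. infdist (w x) Am \<le> q" "\<forall>x\<ge>2. infdist (w x) Ap \<le> q"
      using l rt ab q by auto
  qed
  ultimately show ?thesis by blast
qed

text \<open>Replacing a path by a fast transition to a point of \<open>Ap\<close> saves the potential energy spent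
  on \<open>{-1..1}\<close>.\<close>

lemma energy_cut:
  assumes h: "H2 u z g" and a: "a \<in> Ap" and L: "L \<ge> 2" and \<eta>: "\<eta> > 0"
    and \<delta>: "\<And>x v. norm (x - a) \<le> \<delta> \<Longrightarrow> norm v \<le> \<delta> \<Longrightarrow> W (x, v) \<le> \<eta>/2" "\<delta>\<^sup>2 \<le> \<eta>"
    and close: "18 * (norm (u (-L) - a) + norm (z (-L))) \<le> \<delta>"
    and left: "\<forall>x\<le>xm. infdist (u x) Am \<le> q"
  shows "\<exists>w\<in>admissible Am Ap q. J W w + (\<integral>\<^sup>+x\<in>{-1..1}. ennreal (W (u x, z x)) \<partial>lborel) \<le> energy W u z g + ennreal \<eta>"
proof -
  obtain w w' w'' where H: "H2 w w' w''"
    and l: "\<And>x. x \<le> -L \<Longrightarrow> w x = u x \<and> w' x = z x \<and> w'' x = g x"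
    and rt: "\<And>x. x > -L + 1 \<Longrightarrow> w x = a \<and> w' x = 0 \<and> w'' x = 0"
    and m: "\<And>x. -L < x \<Longrightarrow> x \<le> -L + 1 \<Longrightarrow>
      norm (w x - a) \<le> 18 * (norm (u (-L) - a) + norm (z (-L))) \<and> norm (w' x) \<le> 18 * (norm (u (-L) - a) + norm (z (-L)))
      \<and> norm (w'' x) \<le> 18 * (norm (u (-L) - a) + norm (z (-L)))"
    using H2_connect[OF h, where c="-L" and a=a] by blast
  have \<delta>0: "\<delta> \<ge> 0" using close by (rule order_trans[rotated]) auto
  have zab: "W (a, 0) = 0" using a zeros by blast
  note [measurable] = H2_measurable[OF h] H2_measurable[OF H]
  let ?d = "\<lambda>u z g x. 1/2 * (norm (g x))\<^sup>2 + W (u x, z x)"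
  have "J W w + (\<integral>\<^sup>+x\<in>{-1..1}. ennreal (W (u x, z x)) \<partial>lborel)
    = (\<integral>\<^sup>+x. ennreal (?d w w' w'' x) + ennreal (W (u x, z x)) * indicator {-1..1} x \<partial>lborel)"
    unfolding H2_J_eq_energy[OF H] energy_def by (rule nn_integral_add[symmetric]) measurable
  also have "\<dots> \<le> (\<integral>\<^sup>+x. ennreal (?d u z g x) + ennreal \<eta> * indicator {-L..-L+1} x \<partial>lborel)"
  proof (rule nn_integral_mono)
    fix x
    have W1: "ennreal (W (u x, z x)) * indicator {-1..1} x \<le> ennreal (?d u z g x)"
      by (auto simp: indicator_def intro!: ennreal_leI)
    \<comment> \<open>Before the cut both densities agree, and \<open>L \<ge> 2\<close> keeps
      \<open>{-1..1}\<close> away; during the transition the new density is at most \<eta>;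
      afterwards the new path rests at a zero, and the old density pays for the potential on
      \<open>{-1..1}\<close>.\<close>
    consider "x \<le> -L" | "-L < x" "x \<le> -L + 1" | "x > -L + 1" by linarith
    then show "ennreal (?d w w' w'' x) + ennreal (W (u x, z x)) * indicator {-1..1} x
      \<le> ennreal (?d u z g x) + ennreal \<eta> * indicator {-L..-L+1} x"
    proof cases
      case 1
      then have "x \<notin> {-1..1}" using L by auto
      then show ?thesis using l[OF 1] by simp
    next
      case 2
      then have n: "norm (w x - a) \<le> \<delta>" "norm (w' x) \<le> \<delta>" "norm (w'' x) \<le> \<delta>"
        using m[OF 2] close by linarith+
      have "(norm (w'' x))\<^sup>2 \<le> \<delta>\<^sup>2" using n(3) by (intro power_mono) auto
      then have "?d w w' w'' x \<le> \<eta>" using \<delta>(1)[OF n(1,2)] \<delta>(2) by linarith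
      then have "ennreal (?d w w' w'' x) \<le> ennreal \<eta> * indicator {-L..-L+1} x"
        using 2 by (auto intro!: ennreal_leI)
      from add_mono[OF this W1] show ?thesis by (simp add: add.commute)
    next
      case 3
      then have "ennreal (?d w w' w'' x) = 0" using rt[OF 3] zab by simp
      then show ?thesis using W1 by (simp add: add_increasing2)
    qed
  qed
  also have "\<dots> = energy W u z g + (\<integral>\<^sup>+x. ennreal \<eta> * indicator {-L..-L+1} x \<partial>lborel)"
    unfolding energy_def by (rule nn_integral_add) measurable
  also have "(\<integral>\<^sup>+x. ennreal \<eta> * indicator {-L..-L+1} x \<partial>lborel) = ennreal \<eta>"
    by (subst nn_integral_cmult_indicator) auto
  finally have "J W w + (\<integral>\<^sup>+x\<in>{-1..1}. ennreal (W (u x, z x)) \<partial>lborel) \<le> energy W u z g + ennreal \<eta>" .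
  moreover have "w \<in> admissible Am Ap q"
    unfolding admissible_iff_H2
  proof (intro conjI exI)
    show "H2 w w' w''" by (rule H)
    show "min xm (-L) < -L + 2" by simp
    show "\<forall>x\<le>min xm (-L). infdist (w x) Am \<le> q" "\<forall>x\<ge>-L+2. infdist (w x) Ap \<le> q"
      using l rt left a q by auto
  qed
  ultimately show ?thesis by blast
qed

end

text \<open>A subsequence converges at all rationals, and equicontinuity carries the convergence to
  every point. Pointwise convergence is the form that Fatou and dominated convergence ask
  for.\<close>

lemma equicontinuous_pointwise_subsequence:
  fixes f :: "nat \<Rightarrow> real \<Rightarrow> 'b::euclidean_space"
  assumes M: "\<And>n x. norm (f n x) \<le> M"
    and equi: "\<And>\<epsilon>. \<epsilon> > 0 \<Longrightarrow> \<exists>\<delta>>0. \<forall>n x y. \<bar>x - y\<bar> < \<delta> \<longrightarrow> norm (f n x - f n y) < \<epsilon>"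
  shows "\<exists>k F. strict_mono (k :: nat \<Rightarrow> nat) \<and> (\<forall>x. (\<lambda>n. f (k n) x) \<longlonglongrightarrow> F x)"
proof -
  obtain k :: "nat \<Rightarrow> nat" where k: "strict_mono k" "\<And>x. x \<in> \<rat> \<Longrightarrow> \<exists>l. (\<lambda>n. f (k n) x) \<longlonglongrightarrow> l"
    using function_convergent_subsequence[OF countable_rat, of f M] M by blast
  have "\<exists>l. (\<lambda>n. f (k n) x) \<longlonglongrightarrow> l" for x
  proof -
    have "Cauchy (\<lambda>n. f (k n) x)"
    proof (rule metric_CauchyI)
      fix \<epsilon> :: real assume "\<epsilon> > 0"
      then obtain \<delta> where \<delta>: "\<delta> > 0" "\<And>n x y. \<bar>x - y\<bar> < \<delta> \<Longrightarrow> norm (f n x - f n y) < \<epsilon>/3"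
        using equi[of "\<epsilon>/3"] by auto
      obtain y where y: "y \<in> \<rat>" "x < y" "y < x + \<delta>"
        using Rats_dense_in_real[of x "x + \<delta>"] \<delta>(1) by auto
      have "Cauchy (\<lambda>n. f (k n) y)" using k(2)[OF y(1)] LIMSEQ_imp_Cauchy by blast
      then obtain N where N: "\<And>m n. m \<ge> N \<Longrightarrow> n \<ge> N \<Longrightarrow> dist (f (k m) y) (f (k n) y) < \<epsilon>/3"
        using \<open>\<epsilon> > 0\<close> unfolding Cauchy_def by (metis divide_pos_pos zero_less_numeral)
      have xy: "dist (f n x) (f n y) < \<epsilon>/3" for n
        using \<delta>(2)[of x y n] y by (simp add: dist_norm)
      have "dist (f (k m) x) (f (k n) x) < \<epsilon>" if "m \<ge> N" "n \<ge> N" for m n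
        using dist_triangle[of "f (k m) x" "f (k n) x" "f (k m) y"]
          dist_triangle[of "f (k m) y" "f (k n) x" "f (k n) y"]
          xy[of "k m"] xy[of "k n"] N[OF that] dist_commute[of "f (k n) y" "f (k n) x"] by linarith
      then show "\<exists>N. \<forall>m\<ge>N. \<forall>n\<ge>N. dist (f (k m) x) (f (k n) x) < \<epsilon>" by blast
    qed
    then show ?thesis using convergent_eq_Cauchy by blast
  qed
  then show ?thesis using k(1) by metis
qed

text \<open>The time is the supremum of the set of times at which the path is in \<Omega>. This set
  is open, so the supremum does not belong to it, while by continuity the path is in the closure of
  \<Omega> there.\<close>

lemma last_exit:
  fixes u :: "real \<Rightarrow> 'a::topological_space"
  assumes c: "continuous_on UNIV u" and op: "open \<Omega>"
    and m: "u xm \<in> \<Omega>" and p: "\<And>x. x \<ge> xp \<Longrightarrow> u x \<notin> \<Omega>"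
  shows "\<exists>c. u c \<in> frontier \<Omega> \<and> (\<forall>x\<ge>c. u x \<notin> \<Omega>)"
proof -
  define S where "S = {x. u x \<in> \<Omega>}"
  have S: "S \<noteq> {}" "bdd_above S" using m p by (auto simp: S_def bdd_above_def) (metis linear)
  have oS: "open S" using open_vimage[OF op c] by (simp add: S_def vimage_def)
  have above: "u x \<notin> \<Omega>" if "x > Sup S" for x
    using cSup_upper[OF _ S(2), of x] that by (auto simp: S_def)
  have "Sup S \<notin> S"
  proof
    assume "Sup S \<in> S"
    then obtain e where e: "e > 0" "ball (Sup S) e \<subseteq> S" using oS open_contains_ball by blast
    then have "Sup S + e/2 \<in> S" by (auto simp: dist_real_def)
    then show False using cSup_upper[OF _ S(2)] e(1) by fastforce
  qed
  then have n: "u (Sup S) \<notin> \<Omega>" by (simp add: S_def)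
  have "Sup S \<in> closure S" by (rule closure_contains_Sup[OF S])
  moreover have "closure S \<subseteq> u -` closure \<Omega>"
  proof (rule closure_minimal)
    show "S \<subseteq> u -` closure \<Omega>" using closure_subset by (auto simp: S_def)
    show "closed (u -` closure \<Omega>)" by (rule closed_vimage[OF closed_closure c])
  qed
  ultimately have "u (Sup S) \<in> frontier \<Omega>"
    using n op by (auto simp: frontier_def interior_open)
  moreover have "u x \<notin> \<Omega>" if "x \<ge> Sup S" for x
    using above[of x] n that by (cases "x = Sup S") auto
  ultimately show ?thesis by blast
qed

section \<open>Compactness and the direct method\<close>

context double_well
begin

text \<open>The speed is bounded and the velocity is 1/2-Holder, both with constants depending only
  on \<open>E\<close>. Packing \<open>u\<close> and \<open>z\<close> into one map gives a common
  subsequence. The quadratic term passes to the limit by weak lower semicontinuity, the potential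
  term by Fatou.\<close>

lemma energy_bounded_subsequence:
  assumes H: "\<And>n. H2 (u n) (z n) (g n)" and E: "\<And>n. energy W (u n) (z n) (g n) \<le> ennreal E" "E \<ge> 0"
  shows "\<exists>k U Z G. strict_mono (k :: nat \<Rightarrow> nat) \<and> H2 U Z G \<and> (\<forall>x. (\<lambda>n. u (k n) x) \<longlonglongrightarrow> U x)
    \<and> (\<forall>x. (\<lambda>n. z (k n) x) \<longlonglongrightarrow> Z x)
    \<and> energy W U Z G \<le> liminf (\<lambda>n. energy W (u (k n)) (z (k n)) (g (k n)))"
proof -
  obtain M where M: "M > 0" "\<And>n x. norm (z n x) \<le> M" "\<And>n x. norm (u n x) \<le> M"
    using energy_bounds[OF E(2)] H E(1) by metis
  have pu: "primitive (u n) (z n)" and pz: "primitive (z n) (g n)" and Lg: "L2_loc (g n)" for n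
    using H[of n] by (auto simp: H2_def)
  define f where "f n x = (u n x, z n x)" for n x
  have du: "norm (u n x - u n y) \<le> M * \<bar>x - y\<bar>" for n x y
  proof (induction x y rule: linorder_wlog)
    case (le a b)
    have "norm (u n b - u n a) \<le> M * (b - a)"
      by (rule primitive_bound[OF pu le]) (use M less_imp_le in auto)
    then show ?case using le by (simp add: norm_minus_commute)
  qed (simp add: norm_minus_commute abs_minus_commute)
  have dz: "(norm (z n x - z n y))\<^sup>2 \<le> \<bar>x - y\<bar> * (2 * E)" for n x y
  proof (induction x y rule: linorder_wlog)
    case (le a b)
    have "(norm (z n b - z n a))\<^sup>2 \<le> (b - a) * (2 * E)"
      by (rule primitive_Holder[OF pz Lg le energy_L2[OF H E]]) (use E in auto)
    then show ?case using le by (simp add: norm_minus_commute)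
  qed (simp add: norm_minus_commute abs_minus_commute)
  have "\<exists>k F. strict_mono (k :: nat \<Rightarrow> nat) \<and> (\<forall>x. (\<lambda>n. f (k n) x) \<longlonglongrightarrow> F x)"
  proof (rule equicontinuous_pointwise_subsequence)
    show "norm (f n x) \<le> 2 * M" for n x
      unfolding f_def using norm_Pair_le[of "u n x" "z n x"] M(2)[of n x] M(3)[of n x] by linarith
    fix \<epsilon> :: real assume \<epsilon>: "\<epsilon> > 0"
    \<comment> \<open>The denominator \<open>2 * E + 1\<close> instead of \<open>2 * E\<close> keeps
      \<delta> positive also for \<open>E = 0\<close>.\<close>
    define \<delta> where "\<delta> = min (\<epsilon> / (2 * M)) ((\<epsilon>/2)\<^sup>2 / (2 * E + 1))"
    have \<delta>: "\<delta> > 0" using \<epsilon> M(1) E(2) unfolding \<delta>_def by simp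
    have "norm (f n x - f n y) < \<epsilon>" if xy: "\<bar>x - y\<bar> < \<delta>" for n x y
    proof -
      have "M * \<bar>x - y\<bar> < M * (\<epsilon> / (2 * M))"
        using xy M(1) by (intro mult_strict_left_mono) (auto simp: \<delta>_def)
      then have 1: "norm (u n x - u n y) < \<epsilon>/2" using du[of n x y] M(1) by simp
      have "\<bar>x - y\<bar> * (2 * E) \<le> \<bar>x - y\<bar> * (2 * E + 1)" by (intro mult_left_mono) auto
      also have "\<dots> < (\<epsilon>/2)\<^sup>2 / (2 * E + 1) * (2 * E + 1)"
        using xy E(2) by (intro mult_strict_right_mono) (auto simp: \<delta>_def)
      also have "\<dots> = (\<epsilon>/2)\<^sup>2" using E(2) by simp
      finally have "(norm (z n x - z n y))\<^sup>2 < (\<epsilon>/2)\<^sup>2" using dz[of n x y] by linarith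
      then have 2: "norm (z n x - z n y) < \<epsilon>/2"
        by (rule power_less_imp_less_base) (use \<epsilon> in simp)
      have "f n x - f n y = (u n x - u n y, z n x - z n y)" by (simp add: f_def)
      then show ?thesis using norm_Pair_le[of "u n x - u n y" "z n x - z n y"] 1 2 by simp
    qed
    then show "\<exists>\<delta>>0. \<forall>n x y. \<bar>x - y\<bar> < \<delta> \<longrightarrow> norm (f n x - f n y) < \<epsilon>" using \<delta> by blast
  qed
  then obtain k F where k: "strict_mono (k :: nat \<Rightarrow> nat)" and F: "\<And>x. (\<lambda>n. f (k n) x) \<longlonglongrightarrow> F x" by blast
  define U Z where "U x = fst (F x)" and "Z x = snd (F x)" for x
  have U: "(\<lambda>n. u (k n) x) \<longlonglongrightarrow> U x" for x
    using tendsto_fst[OF F[of x]] by (simp add: U_def f_def)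
  have Z: "(\<lambda>n. z (k n) x) \<longlonglongrightarrow> Z x" for x
    using tendsto_snd[OF F[of x]] by (simp add: Z_def f_def)
  have L2g: "L2 (g n)" for n
    by (rule L2_nn_integralI[OF _ energy_L2[OF H E]]) (use Lg[of n] in \<open>simp add: L2_loc_def\<close>)
  have "nsq (g n) \<le> 2 * E" for n
    using nsq_le_iff[OF _ L2g] energy_L2[OF H E] E(2) by simp
  from L2_weak_limit[OF pz L2g this Z]
  obtain G where G: "primitive Z G" "L2 G" "ennreal (nsq G) \<le> liminf (\<lambda>n. ennreal (nsq (g (k n))))" by blast
  have cZ: "continuous_on UNIV Z" by (rule primitive_continuous[OF G(1)])
  have "primitive U Z"
    unfolding primitive_def
  proof (intro conjI allI impI)
    show LZ: "L1_loc Z" by (rule continuous_L1_loc[OF cZ])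
    fix a b :: real assume ab: "a \<le> b"
    \<comment> \<open>Dominated convergence, with the speed bound as majorant, identifies the limit
      of the velocities as the velocity of the limit.\<close>
    have "(\<lambda>n. LBINT x. indicator {a..b} x *\<^sub>R z (k n) x) \<longlonglongrightarrow> (LBINT x. indicator {a..b} x *\<^sub>R Z x)"
    proof (rule integral_dominated_convergence[where w="\<lambda>x. indicator {a..b} x * M"])
      have [measurable]: "z n \<in> borel_measurable borel" "Z \<in> borel_measurable borel" for n
        using primitive_borel[OF pu] LZ by (auto simp: L1_loc_def)
      show "(\<lambda>x. indicator {a..b} x *\<^sub>R Z x) \<in> borel_measurable lborel"
        "(\<lambda>x. indicator {a..b} x *\<^sub>R z (k n) x) \<in> borel_measurable lborel" for n
        by measurable
      show "integrable lborel (\<lambda>x. indicator {a..b} x * M)"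
        by (intro integrable_mult_left integrable_real_indicator) (auto simp: emeasure_lborel_Icc_eq)
      show "AE x in lborel. (\<lambda>n. indicator {a..b} x *\<^sub>R z (k n) x) \<longlonglongrightarrow> indicator {a..b} x *\<^sub>R Z x"
        by (intro AE_I2 tendsto_intros Z)
      show "AE x in lborel. norm (indicator {a..b} x *\<^sub>R z (k n) x) \<le> indicator {a..b} x * M" for n
        using M(2) by (intro AE_I2) (auto simp: indicator_def)
    qed
    then have "(\<lambda>n. u (k n) b - u (k n) a) \<longlonglongrightarrow> (LBINT x:{a..b}. Z x)"
      using primitive_set_integral[OF pu ab] by (simp add: set_lebesgue_integral_def)
    moreover have "(\<lambda>n. u (k n) b - u (k n) a) \<longlonglongrightarrow> U b - U a"
      by (intro tendsto_intros U)
    ultimately have "(LBINT x:{a..b}. Z x) = U b - U a" by (rule LIMSEQ_unique)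
    then show "(Z has_integral U b - U a) {a..b}" using L1_loc_has_integral[OF LZ, of a b] by simp
  qed
  moreover have "L2_loc G" using G(2) unfolding L2_def by (intro L2_loc_integrable) auto
  ultimately have HU: "H2 U Z G" using G(1) by (simp add: H2_def)
  have half: "(\<integral>\<^sup>+x. ennreal (1/2 * (norm (h x))\<^sup>2) \<partial>lborel) = ennreal (1/2) * ennreal (nsq h)" if "L2 h" for h :: "real \<Rightarrow> 'a"
  proof -
    have [measurable]: "h \<in> borel_measurable borel" using that by (simp add: L2_def)
    have "(\<integral>\<^sup>+x. ennreal (1/2 * (norm (h x))\<^sup>2) \<partial>lborel) = (\<integral>\<^sup>+x. ennreal (1/2) * ennreal ((norm (h x))\<^sup>2) \<partial>lborel)"
      by (subst ennreal_mult[symmetric]) auto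
    also have "\<dots> = ennreal (1/2) * sq_nn_integral h"
      by (rule nn_integral_cmult) measurable
    finally show ?thesis by (simp add: L2_nn_integral[OF that])
  qed
  have "(\<integral>\<^sup>+x. ennreal (1/2 * (norm (G x))\<^sup>2) \<partial>lborel)
      \<le> ennreal (1/2) * liminf (\<lambda>n. ennreal (nsq (g (k n))))"
    unfolding half[OF G(2)] by (intro mult_left_mono G(3)) simp
  also have "\<dots> \<le> liminf (\<lambda>n. ennreal (1/2) * ennreal (nsq (g (k n))))"
    unfolding liminf_SUP_INF SUP_mult_left_ennreal
    by (intro SUP_mono' INF_greatest mult_left_mono INF_lower) auto
  finally have A: "(\<integral>\<^sup>+x. ennreal (1/2 * (norm (G x))\<^sup>2) \<partial>lborel)
      \<le> liminf (\<lambda>n. \<integral>\<^sup>+x. ennreal (1/2 * (norm (g (k n) x))\<^sup>2) \<partial>lborel)"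
    by (simp only: half[OF L2g])
  have Wm: "(\<lambda>x. W (u n x, z n x)) \<in> borel_measurable borel" for n by (rule H2_measurable[OF H])
  have "(\<integral>\<^sup>+x. ennreal (W (U x, Z x)) \<partial>lborel) = (\<integral>\<^sup>+x. liminf (\<lambda>n. ennreal (W (u (k n) x, z (k n) x))) \<partial>lborel)"
  proof (rule nn_integral_cong)
    fix x
    have "isCont W (U x, Z x)"
      using W_continuous[of UNIV] by (simp add: continuous_on_eq_continuous_at)
    then have "(\<lambda>n. W (u (k n) x, z (k n) x)) \<longlonglongrightarrow> W (U x, Z x)"
      by (rule isCont_tendsto_compose) (intro tendsto_intros U Z)
    then have "(\<lambda>n. ennreal (W (u (k n) x, z (k n) x))) \<longlonglongrightarrow> ennreal (W (U x, Z x))"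
      by (rule tendsto_ennrealI)
    from lim_imp_Liminf[OF sequentially_bot this]
    show "ennreal (W (U x, Z x)) = liminf (\<lambda>n. ennreal (W (u (k n) x, z (k n) x)))" by (rule sym)
  qed
  also have "\<dots> \<le> liminf (\<lambda>n. \<integral>\<^sup>+x. ennreal (W (u (k n) x, z (k n) x)) \<partial>lborel)"
    by (rule nn_integral_liminf) (use Wm in measurable)
  finally have "energy W U Z G \<le> liminf (\<lambda>n. energy W (u (k n)) (z (k n)) (g (k n)))"
    unfolding energy_split[OF HU] energy_split[OF H]
    by (intro order_trans[OF add_mono[OF A] ennreal_liminf_add])
  then show ?thesis using k HU U Z by blast
qed

lemma admissible_normalize:
  assumes w: "w \<in> admissible Am Ap q"
  shows "\<exists>u z g xm. H2 u z g \<and> energy W u z g = J W w \<and> u 0 \<in> frontier \<Omega> \<and> (\<forall>x\<ge>0. u x \<notin> \<Omega>)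
    \<and> (\<forall>x\<le>xm. infdist (u x) Am \<le> q)"
proof -
  obtain z g where H: "H2 w z g" using w admissible_iff_H2 by blast
  obtain xm xp where x: "\<And>x. x \<le> xm \<Longrightarrow> infdist (w x) Am \<le> q" "\<And>x. x \<ge> xp \<Longrightarrow> infdist (w x) Ap \<le> q"
    using w admissible_iff_H2 by blast
  have "\<exists>c. w c \<in> frontier \<Omega> \<and> (\<forall>x\<ge>c. w x \<notin> \<Omega>)"
  proof (rule last_exit[OF H2_continuous(1)[OF H] \<Omega>_open])
    show "w xm \<in> \<Omega>" using x(1)[OF order_refl] q(3) by blast
    show "w x \<notin> \<Omega>" if "x \<ge> xp" for x using x(2)[OF that] q(4) closure_subset by blast
  qed
  then obtain c where c: "w c \<in> frontier \<Omega>" "\<And>x. x \<ge> c \<Longrightarrow> w x \<notin> \<Omega>" by blast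
  show ?thesis
  proof (intro exI conjI)
    show "H2 (\<lambda>x. w (x + c)) (\<lambda>x. z (x + c)) (\<lambda>x. g (x + c))" by (rule H2_shift[OF H])
    show "energy W (\<lambda>x. w (x + c)) (\<lambda>x. z (x + c)) (\<lambda>x. g (x + c)) = J W w"
      unfolding energy_shift[OF W_measurable H] H2_J_eq_energy[OF H] ..
    show "\<forall>x\<le>xm - c. infdist (w (x + c)) Am \<le> q" using x(1) by auto
  qed (use c in auto)
qed

lemma minimizer_exists:
  "\<exists>u\<in>admissible Am Ap q. (\<forall>w\<in>admissible Am Ap q. J W u \<le> J W w) \<and> J W u < \<infinity>"
proof -
  define m where "m = (INF w\<in>admissible Am Ap q. J W w)"
  have m_le: "m \<le> J W w" if "w \<in> admissible Am Ap q" for w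
    unfolding m_def using that by (rule INF_lower)
  have m_fin: "m < \<infinity>" using admissible_finite_energy_exists m_le by (blast intro: order_le_less_trans)
  define r where "r = enn2real m"
  have r: "r \<ge> 0" "m = ennreal r" using m_fin by (auto simp: r_def)
  have "\<exists>u z g xm. H2 u z g \<and> energy W u z g \<le> ennreal (r + 1 / Suc n) \<and> u 0 \<in> frontier \<Omega> \<and> (\<forall>x\<ge>0. u x \<notin> \<Omega>)
    \<and> (\<forall>x\<le>xm. infdist (u x) Am \<le> q)" for n
  proof -
    have "0 < 1 / real (Suc n)" by simp
    then have "m < ennreal (r + 1 / Suc n)"
      unfolding r(2) using r(1) by (intro ennreal_lessI) linarith+
    then obtain w where "w \<in> admissible Am Ap q" "J W w < ennreal (r + 1 / Suc n)"
      unfolding m_def by (auto simp: INF_less_iff)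
    then show ?thesis using admissible_normalize[of w] by (metis less_imp_le)
  qed
  then obtain u0 z0 g0 x0 where 0: "\<And>n. H2 (u0 n) (z0 n) (g0 n)"
    "\<And>n. energy W (u0 n) (z0 n) (g0 n) \<le> ennreal (r + 1 / Suc n)"
    "\<And>n. u0 n 0 \<in> frontier \<Omega>" "\<And>n x. x \<ge> 0 \<Longrightarrow> u0 n x \<notin> \<Omega>" "\<And>n x. x \<le> x0 n \<Longrightarrow> infdist (u0 n x) Am \<le> q"
    by metis
  have "energy W (u0 n) (z0 n) (g0 n) \<le> ennreal (r + 1)" for n
    by (rule order_trans[OF 0(2)]) (intro ennreal_leI, simp)
  from energy_bounded_subsequence[of u0 z0 g0 "r + 1", OF 0(1) this] r(1)
  obtain k U Z G where k: "strict_mono (k :: nat \<Rightarrow> nat)" and H: "H2 U Z G"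
    and U0: "\<And>x. (\<lambda>n. u0 (k n) x) \<longlonglongrightarrow> U x" and Z0: "\<And>x. (\<lambda>n. z0 (k n) x) \<longlonglongrightarrow> Z x"
    and lsc: "energy W U Z G \<le> liminf (\<lambda>n. energy W (u0 (k n)) (z0 (k n)) (g0 (k n)))"
    by auto
  define u z g xm where "u n = u0 (k n)" and "z n = z0 (k n)" and "g n = g0 (k n)" and "xm n = x0 (k n)" for n
  have Hn: "H2 (u n) (z n) (g n)" for n unfolding u_def z_def g_def by (rule 0(1))
  have en: "energy W (u n) (z n) (g n) \<le> ennreal (r + 1 / Suc n)" for n
  proof -
    have "1 / real (Suc (k n)) \<le> 1 / real (Suc n)"
      using strict_mono_imp_increasing[OF k, of n] by (intro frac_le) auto
    then show ?thesis unfolding u_def z_def g_def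
      by (intro order_trans[OF 0(2)] ennreal_leI) simp
  qed
  have U: "(\<lambda>n. u n x) \<longlonglongrightarrow> U x" and Z: "(\<lambda>n. z n x) \<longlonglongrightarrow> Z x" for x
    using U0 Z0 by (simp_all add: u_def z_def)
  have "liminf (\<lambda>n. energy W (u0 (k n)) (z0 (k n)) (g0 (k n))) \<le> liminf (\<lambda>n. ennreal (r + 1 / Suc n))"
    by (intro Liminf_mono always_eventually allI en[unfolded u_def z_def g_def])
  also have "\<dots> = ennreal (r + 0)"
    by (intro lim_imp_Liminf tendsto_ennrealI tendsto_intros LIMSEQ_Suc[OF lim_const_over_n]) simp
  finally have EU: "energy W U Z G \<le> m" using lsc r(2) by simp
  then have fin: "energy W U Z G < \<infinity>" using m_fin by simp
  have front: "U 0 \<in> frontier \<Omega>"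
    by (rule closed_sequentially[OF frontier_closed _ U]) (simp add: u_def 0(3))
  \<comment> \<open>The complement of \<Omega> is closed, so this half of the normalization survives
    in the limit. It excludes \<open>Am\<close> at the right end, because the
    \<open>q\<close>-neighbourhood of \<open>Am\<close> lies in \<Omega>.\<close>
  have out: "U x \<notin> \<Omega>" if "x \<ge> 0" for x
    using closed_sequentially[of "- \<Omega>" "\<lambda>n. u n x" "U x"] U \<Omega>_open 0(4)[OF that] by (auto simp: u_def)
  have dist0: "((\<lambda>x. infdist (U x) (Am \<union> Ap)) \<longlongrightarrow> 0) at_infinity"
    by (rule finite_energy_infdist_tendsto_0[OF H fin])
  have min: "infdist y (Am \<union> Ap) = min (infdist y Am) (infdist y Ap)" for y
    using infdist_Un_min[of Am Ap y] Am Ap by auto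
  obtain X where X: "\<And>x. \<bar>x\<bar> \<ge> X \<Longrightarrow> infdist (U x) (Am \<union> Ap) < q"
    using order_tendstoD(2)[OF dist0 q(1)] by (auto simp: eventually_at_infinity)
  have right: "infdist (U x) Ap \<le> q" if "x \<ge> \<bar>X\<bar>" for x
  proof -
    have "infdist (U x) (Am \<union> Ap) < q" using X[of x] that by auto
    moreover have "\<not> infdist (U x) Am \<le> q"
    proof -
      have "0 \<le> x" using that by linarith
      then show ?thesis using out[of x] q(3) by blast
    qed
    ultimately show ?thesis unfolding min by linarith
  qed
  \<comment> \<open>Keeping away from \<open>Ap\<close> is enough for convergence to
    \<open>Am\<close>, because the distance to the union of the wells already tends to 0.\<close>
  have "\<exists>\<delta>>0. \<exists>Y. \<forall>x\<le>Y. infdist (U x) Ap > \<delta>"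
  proof (rule ccontr)
    assume "\<not> ?thesis"
    then have near: "\<And>\<delta> Y. \<delta> > 0 \<Longrightarrow> \<exists>x\<le>Y. infdist (U x) Ap \<le> \<delta>" by (meson not_less)
    let ?P = "\<lambda>u z. \<integral>\<^sup>+x\<in>{-1..1}. ennreal (W (u x, z x)) \<partial>lborel"
    have Pm: "(\<lambda>x. ennreal (W (U x, Z x)) * indicator {-1..1} x) \<in> borel_measurable lborel"
      using H2_measurable(2)[OF H] by measurable
    have cW: "continuous_on UNIV (\<lambda>x. W (U x, Z x))"
      by (rule continuous_on_compose2[OF W_continuous[of UNIV]])
        (auto intro!: continuous_intros H2_continuous[OF H])
    \<comment> \<open>Continuity spreads the positivity of \<open>W\<close> at time 0 over a small
      interval. Positivity on the frontier for every velocity is what counts, since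
      \<open>Z 0\<close> may be any vector.\<close>
    have "?P U Z > 0"
    proof -
      have "isCont (\<lambda>x. W (U x, Z x)) 0" using cW by (simp add: continuous_on_eq_continuous_at)
      moreover have W0: "W (U 0, Z 0) > 0" by (rule W_frontier[OF front])
      ultimately have "\<forall>\<^sub>F x in at 0. W (U x, Z x) > W (U 0, Z 0) / 2"
        unfolding isCont_def by (intro order_tendstoD(1)) auto
      then obtain d where d: "d > 0" "\<And>x. x \<noteq> 0 \<Longrightarrow> \<bar>x\<bar> < d \<Longrightarrow> W (U x, Z x) > W (U 0, Z 0) / 2"
        by (auto simp: eventually_at dist_real_def)
      define d' where "d' = min 1 (d/2)"
      have d': "0 < d'" "d' \<le> 1" "d' < d" using d(1) by (auto simp: d'_def)
      have "0 < ennreal (W (U 0, Z 0) / 2) * emeasure lborel {-d'..d'}"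
        using W0 d' by (simp add: ennreal_zero_less_mult_iff)
      also have "\<dots> = (\<integral>\<^sup>+x. ennreal (W (U 0, Z 0) / 2) * indicator {-d'..d'} x \<partial>lborel)"
        by (rule nn_integral_cmult_indicator[symmetric]) simp
      also have "\<dots> \<le> ?P U Z"
      proof (rule nn_integral_mono)
        fix x
        show "ennreal (W (U 0, Z 0) / 2) * indicator {-d'..d'} x \<le> ennreal (W (U x, Z x)) * indicator {-1..1} x"
        proof (cases "x \<in> {-d'..d'}")
          case True
          then have "\<bar>x\<bar> < d" "x \<in> {-1..1}" using d' by auto
          then have "W (U 0, Z 0) / 2 \<le> W (U x, Z x)"
            using d(2)[of x] W0 by (cases "x = 0") (simp_all add: less_imp_le)
          then show ?thesis using True \<open>x \<in> {-1..1}\<close> by (simp add: ennreal_leI)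
        qed simp
      qed
      finally show ?thesis .
    qed
    \<comment> \<open>The budget: a saving above \<open>3 * \<epsilon>\<close> against one
      \<epsilon> for the cut and less than another for the gap between the sequence and the infimum.
      An intermediate extended number comes first, to pass to a real \<epsilon>.\<close>
    then obtain \<epsilon>' where "\<epsilon>' > 0" "\<epsilon>' < ?P U Z" using dense by blast
    moreover from this have "\<epsilon>' < \<infinity>" by (auto intro: less_le_trans)
    ultimately obtain \<epsilon> where \<epsilon>: "\<epsilon> > 0" "ennreal (3 * \<epsilon>) < ?P U Z"
    proof -
      assume a: "\<epsilon>' > 0" "\<epsilon>' < ?P U Z" "\<epsilon>' < \<infinity>" and t: "\<And>\<epsilon>. \<epsilon> > 0 \<Longrightarrow> ennreal (3 * \<epsilon>) < ?P U Z \<Longrightarrow> thesis"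
      have e: "ennreal (enn2real \<epsilon>') = \<epsilon>'" using a(3) by simp
      moreover have "enn2real \<epsilon>' > 0" using a by (simp add: enn2real_positive_iff)
      ultimately show thesis using t[of "enn2real \<epsilon>' / 3"] a by simp
    qed
    \<comment> \<open>Fatou moves the saving from the limit to the paths of the sequence. These are
      the ones to be cut, because they, unlike the limit so far, are known to start near
      \<open>Am\<close>.\<close>
    have "?P U Z \<le> liminf (\<lambda>n. ?P (u n) (z n))"
    proof -
      have "?P U Z = (\<integral>\<^sup>+x. liminf (\<lambda>n. ennreal (W (u n x, z n x)) * indicator {-1..1} x) \<partial>lborel)"
      proof (rule nn_integral_cong)
        fix x :: real
        have "isCont W (U x, Z x)"
          using W_continuous[of UNIV] by (simp add: continuous_on_eq_continuous_at)
        then have "(\<lambda>n. W (u n x, z n x)) \<longlonglongrightarrow> W (U x, Z x)"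
          by (rule isCont_tendsto_compose) (intro tendsto_intros U Z)
        then have "(\<lambda>n. ennreal (W (u n x, z n x))) \<longlonglongrightarrow> ennreal (W (U x, Z x))"
          by (rule tendsto_ennrealI)
        then have "(\<lambda>n. ennreal (W (u n x, z n x)) * indicator {-1..1} x) \<longlonglongrightarrow> ennreal (W (U x, Z x)) * indicator {-1..1} x"
          by (cases "x \<in> {-1..1}") auto
        from lim_imp_Liminf[OF sequentially_bot this]
        show "ennreal (W (U x, Z x)) * indicator {-1..1} x
          = liminf (\<lambda>n. ennreal (W (u n x, z n x)) * indicator {-1..1} x)" by (rule sym)
      qed
      also have "\<dots> \<le> liminf (\<lambda>n. ?P (u n) (z n))"
        by (rule nn_integral_liminf) (use H2_measurable(2)[OF Hn] in measurable)
      finally show ?thesis .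
    qed
    then have "ennreal (3 * \<epsilon>) < liminf (\<lambda>n. ?P (u n) (z n))" using \<epsilon>(2) by simp
    from less_LiminfD[OF this] have evP: "\<forall>\<^sub>F n in sequentially. ennreal (3 * \<epsilon>) < ?P (u n) (z n)" .
    obtain \<delta>1 where \<delta>1: "\<delta>1 > 0" "\<And>a u v. a \<in> Am \<union> Ap \<Longrightarrow> norm (u - a) \<le> \<delta>1 \<Longrightarrow> norm v \<le> \<delta>1 \<Longrightarrow> W (u, v) \<le> \<epsilon>/2"
      using W_small_near_zeros[of "\<epsilon>/2"] \<epsilon>(1) by (metis half_gt_zero)
    \<comment> \<open>The inner \<open>min 1 \<epsilon>\<close> serves to give
      \<open>\<delta>\<^sup>2 \<le> \<epsilon>\<close>.\<close>
    define \<delta> where "\<delta> = min \<delta>1 (min 1 \<epsilon>)"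
    have \<delta>: "\<delta> > 0" "\<delta> \<le> \<delta>1" "\<delta>\<^sup>2 \<le> \<epsilon>"
    proof -
      show "\<delta> > 0" "\<delta> \<le> \<delta>1" using \<delta>1(1) \<epsilon>(1) by (auto simp: \<delta>_def)
      then have "\<delta> * \<delta> \<le> 1 * \<delta>" by (intro mult_right_mono) (auto simp: \<delta>_def)
      also have "\<dots> \<le> \<epsilon>" by (simp add: \<delta>_def)
      finally show "\<delta>\<^sup>2 \<le> \<epsilon>" by (simp add: power2_eq_square)
    qed
    have "(Z \<longlongrightarrow> 0) at_infinity" by (rule finite_energy_derivative_tendsto_0[OF H fin])
    then have "\<forall>\<^sub>F x in at_infinity. norm (Z x) < \<delta>/72"
      using \<delta>(1) tendstoD[of Z 0 at_infinity "\<delta>/72"] by simp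
    then obtain Y where Y: "\<And>x. \<bar>x\<bar> \<ge> Y \<Longrightarrow> norm (Z x) < \<delta>/72" by (auto simp: eventually_at_infinity)
    \<comment> \<open>The bound on \<open>s\<close> ensures both the velocity estimate and
      \<open>L \<ge> 2\<close>. Four errors of size \<delta>/72, two in position and two in
      velocity, times the factor 18 of the connecting path add up to \<delta>.\<close>
    obtain s where s: "s \<le> - \<bar>Y\<bar> - 2" "infdist (U s) Ap \<le> \<delta>/72"
      using near[of "\<delta>/72" "- \<bar>Y\<bar> - 2"] \<delta>(1) by auto
    define L where "L = - s"
    have L: "L \<ge> 2" "infdist (U (-L)) Ap \<le> \<delta>/72" "norm (Z (-L)) < \<delta>/72"
      using s Y[of s] by (auto simp: L_def)
    obtain a where a: "a \<in> Ap" "infdist (U (-L)) Ap = dist (U (-L)) a"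
      using infdist_attains_inf[OF compact_imp_closed[OF Ap(2)] Ap(1)] by blast
    have "\<forall>\<^sub>F n in sequentially. norm (u n (-L) - U (-L)) < \<delta>/72"
      using tendstoD[OF U[of "-L"], of "\<delta>/72"] \<delta>(1) by (simp add: dist_norm)
    moreover have "\<forall>\<^sub>F n in sequentially. norm (z n (-L) - Z (-L)) < \<delta>/72"
      using tendstoD[OF Z[of "-L"], of "\<delta>/72"] \<delta>(1) by (simp add: dist_norm)
    moreover have "\<forall>\<^sub>F n in sequentially. 1 / Suc n < \<epsilon>"
      using order_tendstoD(2)[OF LIMSEQ_Suc[OF lim_const_over_n[of 1]] \<epsilon>(1)] by simp
    ultimately have "\<forall>\<^sub>F n in sequentially. norm (u n (-L) - U (-L)) < \<delta>/72 \<and> norm (z n (-L) - Z (-L)) < \<delta>/72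
      \<and> 1 / Suc n < \<epsilon> \<and> ennreal (3 * \<epsilon>) < ?P (u n) (z n)"
      using evP by eventually_elim blast
    then obtain n where n: "norm (u n (-L) - U (-L)) < \<delta>/72" "norm (z n (-L) - Z (-L)) < \<delta>/72"
      "1 / Suc n < \<epsilon>" "ennreal (3 * \<epsilon>) < ?P (u n) (z n)"
      using eventually_happens'[OF sequentially_bot] by blast
    have "\<exists>w\<in>admissible Am Ap q. J W w + ?P (u n) (z n) \<le> energy W (u n) (z n) (g n) + ennreal \<epsilon>"
    proof (rule energy_cut[OF Hn a(1) L(1) \<epsilon>(1)])
      show "W (x, v) \<le> \<epsilon>/2" if "norm (x - a) \<le> \<delta>" "norm v \<le> \<delta>" for x v
        using \<delta>1(2)[of a x v] a(1) that \<delta>(2) by auto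
      show "\<delta>\<^sup>2 \<le> \<epsilon>" by (rule \<delta>(3))
      have "norm (U (-L) - a) \<le> \<delta>/72" using L(2) a(2) by (simp add: dist_norm)
      then have "norm (u n (-L) - a) \<le> \<delta>/36"
        using norm_triangle_ineq[of "u n (-L) - U (-L)" "U (-L) - a"] n(1) by simp
      moreover have "norm (z n (-L)) \<le> \<delta>/36"
        using norm_triangle_ineq[of "z n (-L) - Z (-L)" "Z (-L)"] n(2) L(3) by simp
      ultimately show "18 * (norm (u n (-L) - a) + norm (z n (-L))) \<le> \<delta>" by simp
      show "\<forall>x\<le>xm n. infdist (u n x) Am \<le> q" by (simp add: xm_def u_def 0(5))
    qed
    then obtain w where w: "w \<in> admissible Am Ap q" "J W w + ?P (u n) (z n) \<le> energy W (u n) (z n) (g n) + ennreal \<epsilon>"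
      by blast
    have "ennreal (r + 3 * \<epsilon>) = m + ennreal (3 * \<epsilon>)" using r \<epsilon>(1) by simp
    also have "\<dots> \<le> J W w + ?P (u n) (z n)" using m_le[OF w(1)] n(4) by (intro add_mono) auto
    also have "\<dots> \<le> ennreal (r + 1 / Suc n) + ennreal \<epsilon>"
      using w(2) en[of n] by (meson add_right_mono order_trans)
    also have "\<dots> = ennreal (r + 1 / Suc n + \<epsilon>)" using r(1) \<epsilon>(1) by (intro ennreal_plus[symmetric]) auto
    finally have "r + 3 * \<epsilon> \<le> r + 1 / Suc n + \<epsilon>"
      using r(1) \<epsilon>(1) by (subst (asm) ennreal_le_iff) auto
    then show False using n(3) \<epsilon>(1) by linarith
  qed
  then obtain \<delta> Y where \<delta>: "\<delta> > 0" and Y: "\<And>x. x \<le> Y \<Longrightarrow> infdist (U x) Ap > \<delta>" by blast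
  \<comment> \<open>Below \<delta> the nearer well can only be \<open>Am\<close>; below
    \<open>q\<close> its distance meets the admissibility threshold.\<close>
  have "min \<delta> q > 0" using \<delta> q(1) by simp
  then obtain X' where X': "\<And>x. \<bar>x\<bar> \<ge> X' \<Longrightarrow> infdist (U x) (Am \<union> Ap) < min \<delta> q"
    using order_tendstoD(2)[OF dist0] unfolding eventually_at_infinity real_norm_def by blast
  have left: "infdist (U x) Am \<le> q" if "x \<le> - \<bar>Y\<bar> - \<bar>X'\<bar> - 1" for x
  proof -
    have "infdist (U x) (Am \<union> Ap) < min \<delta> q" using X'[of x] that by auto
    moreover have "infdist (U x) Ap > \<delta>" using that by (intro Y) auto
    ultimately show ?thesis unfolding min by linarith
  qed
  have adm: "U \<in> admissible Am Ap q"
    unfolding admissible_iff_H2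
  proof (intro conjI exI)
    show "H2 U Z G" by (rule H)
    show "- \<bar>Y\<bar> - \<bar>X'\<bar> - 1 < \<bar>X\<bar>" by simp
  qed (use left right in auto)
  moreover have "J W U \<le> m" using EU H2_J_eq_energy[OF H] by simp
  ultimately show ?thesis using m_le m_fin by (meson order_trans order_le_less_trans)
qed

end

section \<open>The Euler-Lagrange equation\<close>

lemma GDERIV_grad_eq:
  assumes "GDERIV f x :> g"
  shows "grad f x = g"
  unfolding grad_def
proof (rule the_equality)
  fix g' assume "GDERIV f x :> g'"
  then have "(\<lambda>h. h \<bullet> g') = (\<lambda>h. h \<bullet> g)"
    using assms unfolding gderiv_def by (rule has_derivative_unique)
  then show "g' = g" by (metis vector_eq_ldot)
qed (rule assms)

definition Wu :: "('a::euclidean_space \<times> 'a \<Rightarrow> real) \<Rightarrow> 'a \<times> 'a \<Rightarrow> 'a" where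
  "Wu W p = grad_u W (fst p) (snd p)"

definition Wv :: "('a::euclidean_space \<times> 'a \<Rightarrow> real) \<Rightarrow> 'a \<times> 'a \<Rightarrow> 'a" where
  "Wv W p = grad_v W (fst p) (snd p)"

text \<open>This is the total derivative of \<open>Wv W\<close> at \<open>p\<close> in the direction
  \<open>h\<close>, split into its two partial parts; along a path the direction is
  \<open>(u', u'')\<close>.\<close>

definition DWv :: "('a::euclidean_space \<times> 'a \<Rightarrow> real) \<Rightarrow> 'a \<times> 'a \<Rightarrow> 'a \<times> 'a \<Rightarrow> 'a" where
  "DWv W p h = W_uv W (fst p) (snd p) (fst h) + W_vv W (fst p) (snd p) (snd h)"

text \<open>The gradients are read off from the derivative \<open>f'\<close> by evaluating it at
  basis vectors, so they inherit continuity and differentiability from \<open>f'\<close>. The chain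
  rule along the inclusions \<open>a \<mapsto> (a, y)\<close> and \<open>b \<mapsto> (x, b)\<close>
  identifies the partial derivatives that are defined through
  \<open>frechet_derivative\<close>.\<close>

lemma C2_gradients:
  fixes W :: "'a::euclidean_space \<times> 'a \<Rightarrow> real"
  assumes "C2_on_space W"
  shows "(W has_derivative (\<lambda>h. fst h \<bullet> Wu W p + snd h \<bullet> Wv W p)) (at p)"
    and "continuous_on UNIV (Wu W)" and "continuous_on UNIV (Wv W)"
    and "(Wv W has_derivative DWv W p) (at p)"
    and "continuous_on UNIV (\<lambda>(p, h). DWv W p h)"
proof -
  obtain f' :: "'a \<times> 'a \<Rightarrow> ('a \<times> 'a) \<Rightarrow>\<^sub>L real" and f'' :: "'a \<times> 'a \<Rightarrow> ('a \<times> 'a) \<Rightarrow>\<^sub>L ('a \<times> 'a) \<Rightarrow>\<^sub>L real"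
    where f': "\<And>x. (W has_derivative blinfun_apply (f' x)) (at x)"
      and f'': "\<And>x. (f' has_derivative blinfun_apply (f'' x)) (at x)"
      and cf'': "continuous_on UNIV f''"
    using assms unfolding C2_on_space_def by blast
  have cf': "continuous_on UNIV f'"
    using f'' has_derivative_continuous by (blast intro: continuous_at_imp_continuous_on)
  define gu where "gu p = (\<Sum>b\<in>Basis. f' p (b, 0) *\<^sub>R b)" for p
  define gv where "gv p = (\<Sum>b\<in>Basis. f' p (0, b) *\<^sub>R b)" for p
  have u: "f' p (h, 0) = h \<bullet> gu p" for p h
  proof -
    have lin: "linear (\<lambda>h. f' p (h, 0))"
    proof (rule linearI)
      show "f' p (x + y, 0) = f' p (x, 0) + f' p (y, 0)" for x y
        using blinfun.add_right[of "f' p" "(x, 0)" "(y, 0)"] by simp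
      show "f' p (c *\<^sub>R x, 0) = c *\<^sub>R f' p (x, 0)" for c x
        using blinfun.scaleR_right[of "f' p" c "(x, 0)"] by simp
    qed
    have "f' p (h, 0) = (\<Sum>b\<in>Basis. f' p ((h \<bullet> b) *\<^sub>R b, 0))"
      using linear_sum[OF lin, of "\<lambda>b. (h \<bullet> b) *\<^sub>R b" Basis] by (simp only: euclidean_representation)
    also have "\<dots> = (\<Sum>b\<in>Basis. (h \<bullet> b) * f' p (b, 0))"
      by (simp add: linear_scale[OF lin])
    finally have "f' p (h, 0) = (\<Sum>b\<in>Basis. (h \<bullet> b) * f' p (b, 0))" .
    then show ?thesis by (simp add: gu_def inner_sum_right mult.commute)
  qed
  have v: "f' p (0, h) = h \<bullet> gv p" for p h
  proof -
    have lin: "linear (\<lambda>h. f' p (0, h))"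
    proof (rule linearI)
      show "f' p (0, x + y) = f' p (0, x) + f' p (0, y)" for x y
        using blinfun.add_right[of "f' p" "(0, x)" "(0, y)"] by simp
      show "f' p (0, c *\<^sub>R x) = c *\<^sub>R f' p (0, x)" for c x
        using blinfun.scaleR_right[of "f' p" c "(0, x)"] by simp
    qed
    have "f' p (0, h) = (\<Sum>b\<in>Basis. f' p (0, (h \<bullet> b) *\<^sub>R b))"
      using linear_sum[OF lin, of "\<lambda>b. (h \<bullet> b) *\<^sub>R b" Basis] by (simp only: euclidean_representation)
    also have "\<dots> = (\<Sum>b\<in>Basis. (h \<bullet> b) * f' p (0, b))"
      by (simp add: linear_scale[OF lin])
    finally have "f' p (0, h) = (\<Sum>b\<in>Basis. (h \<bullet> b) * f' p (0, b))" .
    then show ?thesis by (simp add: gv_def inner_sum_right mult.commute)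
  qed
  have "GDERIV (\<lambda>a. W (a, y)) x :> gu (x, y)" for x y
  proof -
    have "((\<lambda>a. W (a, y)) has_derivative (\<lambda>h. f' (x, y) (h, 0))) (at x)"
      by (rule has_derivative_compose[OF _ f', of "\<lambda>a. (a, y)", simplified])
        (auto intro!: derivative_eq_intros)
    then show ?thesis by (simp add: gderiv_def u)
  qed
  then have "grad_u W x y = gu (x, y)" for x y
    unfolding grad_u_def by (rule GDERIV_grad_eq)
  then have Wu: "Wu W = gu" unfolding Wu_def[abs_def] by simp
  have gvd: "GDERIV (\<lambda>b. W (x, b)) y :> gv (x, y)" for x y
  proof -
    have "((\<lambda>b. W (x, b)) has_derivative (\<lambda>h. f' (x, y) (0, h))) (at y)"
      by (rule has_derivative_compose[OF _ f', of "\<lambda>b. (x, b)", simplified])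
        (auto intro!: derivative_eq_intros)
    then show ?thesis by (simp add: gderiv_def v)
  qed
  then have grad_v: "grad_v W x y = gv (x, y)" for x y
    unfolding grad_v_def by (rule GDERIV_grad_eq)
  then have Wv: "Wv W = gv" unfolding Wv_def[abs_def] by simp
  define dgv where "dgv p h = (\<Sum>b\<in>Basis. f'' p h (0, b) *\<^sub>R b)" for p h
  have dgv: "(gv has_derivative dgv p) (at p)" for p
    unfolding gv_def[abs_def] dgv_def[abs_def]
    by (auto intro!: derivative_eq_intros f'')
  have dgv_add: "dgv p (a, 0) + dgv p (0, b) = dgv p (a, b)" for p a b
    using linear_add[OF has_derivative_linear[OF dgv[of p]], of "(a, 0)" "(0, b)"] by simp
  have uv: "W_uv W x y h = dgv (x, y) (h, 0)" for x y h
  proof -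
    have "((\<lambda>a. gv (a, y)) has_derivative (\<lambda>h. dgv (x, y) (h, 0))) (at x)"
      by (rule has_derivative_compose[OF _ dgv, of "\<lambda>a. (a, y)", simplified])
        (auto intro!: derivative_eq_intros)
    from frechet_derivative_at[OF this] show ?thesis
      unfolding W_uv_def grad_v by metis
  qed
  have vv: "W_vv W x y h = dgv (x, y) (0, h)" for x y h
  proof -
    have "((\<lambda>b. gv (x, b)) has_derivative (\<lambda>h. dgv (x, y) (0, h))) (at y)"
      by (rule has_derivative_compose[OF _ dgv, of "\<lambda>b. (x, b)", simplified])
        (auto intro!: derivative_eq_intros)
    from frechet_derivative_at[OF this] show ?thesis
      unfolding W_vv_def grad_v by metis
  qed
  have DWv: "DWv W = dgv"
    by (intro ext) (simp add: DWv_def uv vv dgv_add)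
  have "blinfun_apply (f' p) = (\<lambda>h. fst h \<bullet> Wu W p + snd h \<bullet> Wv W p)"
  proof
    fix h show "f' p h = fst h \<bullet> Wu W p + snd h \<bullet> Wv W p"
    using blinfun.add_right[of "f' p" "(fst h, 0)" "(0, snd h)"] by (simp add: Wu Wv u v)
  qed
  then show "(W has_derivative (\<lambda>h. fst h \<bullet> Wu W p + snd h \<bullet> Wv W p)) (at p)"
    using f'[of p] by simp
  show "continuous_on UNIV (Wu W)" "continuous_on UNIV (Wv W)"
    unfolding Wu Wv gu_def[abs_def] gv_def[abs_def]
    by (intro continuous_intros cf')+
  show "(Wv W has_derivative DWv W p) (at p)" unfolding Wv DWv by (rule dgv)
  show "continuous_on UNIV (\<lambda>(p, h). DWv W p h)"
    unfolding DWv dgv_def split_beta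
    by (intro continuous_intros continuous_on_compose2[OF cf'']) auto
qed

section \<open>The fundamental lemma of second order\<close>

lemma primitive_AE_cong:
  assumes f: "primitive f g" and ae: "AE x in lborel. g x = h x" and h: "L1_loc h"
  shows "primitive f h"
  unfolding primitive_def
proof (intro conjI allI impI h)
  fix a b :: real assume ab: "a \<le> b"
  have "(LBINT x:{a..b}. h x) = (LBINT x:{a..b}. g x)"
    by (rule set_lebesgue_integral_cong_AE)
      (use ae primitive_borel[OF f] h in \<open>auto simp: L1_loc_def eq_commute elim: eventually_mono\<close>)
  then show "(h has_integral f b - f a) {a..b}"
    using L1_loc_has_integral[OF h, of a b] primitive_set_integral[OF f ab] by simp
qed

lemma primitive_constant_on:
  assumes "primitive f g" "a \<le> b" "\<And>x. x \<in> {a<..<b} \<Longrightarrow> g x = 0"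
  shows "f b = f a"
proof -
  have "((\<lambda>x. 0) has_integral f b - f a) {a..b}"
    by (rule has_integral_spike_finite[OF _ _ primitive_has_integral[OF assms(1,2)], of "{a, b}"])
      (use assms(3) in auto)
  then show ?thesis by (simp add: has_integral_0_eq)
qed

text \<open>The two moments of \<open>p\<close> vanish exactly when its second primitive is compactly supported.\<close>

lemma compact_second_primitive:
  fixes p :: "real \<Rightarrow> real"
  assumes p: "L2_loc p" and supp: "\<And>x. x \<notin> {-r..r} \<Longrightarrow> p x = 0" and r: "r > 0"
    and m0: "(LBINT x:{-r..r}. p x) = 0" and m1: "(LBINT x:{-r..r}. x * p x) = 0"
  shows "\<exists>\<psi> \<psi>'. H2 \<psi> \<psi>' p \<and> (\<forall>x. x \<notin> {-r<..<r} \<longrightarrow> \<psi> x = 0 \<and> \<psi>' x = 0)"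
proof -
  obtain f where f: "primitive f p" using primitive_exists[OF L2_loc_imp_L1_loc[OF p]] by blast
  define \<psi>' where "\<psi>' x = f x - f (-r)" for x
  have p1: "primitive \<psi>' p"
    unfolding \<psi>'_def using primitive_diff[OF f primitive_const[of "f (-r)"]] by simp
  obtain g where g: "primitive g \<psi>'"
    using primitive_exists[OF continuous_L1_loc[OF primitive_continuous[OF p1]]] by blast
  define \<psi> where "\<psi> x = g x - g (-r)" for x
  have p2: "primitive \<psi> \<psi>'"
    unfolding \<psi>_def using primitive_diff[OF g primitive_const[of "g (-r)"]] by simp
  have b1: "\<psi>' (-r) = 0" "\<psi>' r = 0"
    using primitive_set_integral[OF p1, of "-r" r] m0 r by (auto simp: \<psi>'_def)
  have idp: "primitive (\<lambda>x. x) (\<lambda>x. 1::real)" by (rule primitive_C1) auto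
  have b2: "\<psi> (-r) = 0" "\<psi> r = 0"
  proof -
    show "\<psi> (-r) = 0" by (simp add: \<psi>_def)
    \<comment> \<open>Integration by parts against \<open>x\<close> turns the vanishing first moment
      of \<open>p\<close> into a vanishing integral of \<open>\<psi>'\<close>.\<close>
    have "(LBINT x:{-r..r}. \<psi>' x) = 0"
      using primitive_by_parts[OF idp p1, of "-r" r] m1 b1 r by simp
    then show "\<psi> r = 0" using primitive_set_integral[OF p2, of "-r" r] r \<open>\<psi> (-r) = 0\<close> by simp
  qed
  have z1: "\<psi>' x = 0" if "x \<notin> {-r<..<r}" for x
  proof (cases "x \<le> -r")
    case True
    have "\<psi>' (-r) = \<psi>' x" by (rule primitive_constant_on[OF p1 True]) (use supp in auto)
    then show ?thesis using b1 by simp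
  next
    case False
    then have "r \<le> x" using that by auto
    then have "\<psi>' x = \<psi>' r" by (rule primitive_constant_on[OF p1]) (use supp in auto)
    then show ?thesis using b1 by simp
  qed
  have z2: "\<psi> x = 0" if "x \<notin> {-r<..<r}" for x
  proof (cases "x \<le> -r")
    case True
    have "\<psi> (-r) = \<psi> x" by (rule primitive_constant_on[OF p2 True]) (use z1 in auto)
    then show ?thesis using b2 by simp
  next
    case False
    then have "r \<le> x" using that by auto
    then have "\<psi> x = \<psi> r" by (rule primitive_constant_on[OF p2]) (use z1 r in auto)
    then show ?thesis using b2 by simp
  qed
  show ?thesis using p1 p2 p z1 z2 unfolding H2_def by blast
qed

text \<open>The functions \<open>1/2\<close> and \<open>3/2 x\<close> on \<open>{-1..1}\<close> are dual to the moments of order \<open>0\<close> and \<open>1\<close>;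
  subtracting multiples of them makes a truncation of \<open>f - \<alpha> - \<beta> x\<close> an admissible test function.\<close>

lemma second_order_du_Bois_Reymond:
  fixes f :: "real \<Rightarrow> real"
  assumes f: "L2_loc f"
    and test: "\<And>r p. r \<ge> 1 \<Longrightarrow> L2_loc p \<Longrightarrow> (\<And>x. x \<notin> {-r..r} \<Longrightarrow> p x = 0) \<Longrightarrow>
      (LBINT x:{-r..r}. p x) = 0 \<Longrightarrow> (LBINT x:{-r..r}. x * p x) = 0 \<Longrightarrow>
      (LBINT x:{-r..r}. p x * f x) = 0"
  shows "\<exists>\<alpha> \<beta>. AE x in lborel. f x = \<alpha> + \<beta> * x"
proof -
  define \<eta>0 \<eta>1 :: "real \<Rightarrow> real"
    where "\<eta>0 x = indicator {-1..1} x * (1/2)" and "\<eta>1 x = indicator {-1..1} x * (3/2 * x)" for x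
  have trunc: "L2_loc (\<lambda>x. indicator {a..b} x * h x)" if "L2_loc h" for h :: "real \<Rightarrow> real" and a b
  proof -
    have [measurable]: "h \<in> borel_measurable borel" using that by (simp add: L2_loc_def)
    have "set_integrable lborel {c..d} (\<lambda>x. (norm (indicator {a..b} x * h x))\<^sup>2)" for c d
    proof -
      have "integrable lborel (\<lambda>x. indicator {a..b} x *\<^sub>R (indicator {c..d} x *\<^sub>R (norm (h x))\<^sup>2))"
        by (rule integrable_mult_indicator) (use that in \<open>simp_all add: L2_loc_def set_integrable_def\<close>)
      moreover have "(\<lambda>x. indicator {a..b} x *\<^sub>R (indicator {c..d} x *\<^sub>R (norm (h x))\<^sup>2))
        = (\<lambda>x. indicator {c..d} x *\<^sub>R (norm (indicator {a..b} x * h x))\<^sup>2)"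
        by (auto simp: indicator_def)
      ultimately show ?thesis by (simp add: set_integrable_def)
    qed
    then show ?thesis by (simp add: L2_loc_def)
  qed
  have L\<eta>: "L2_loc \<eta>0" "L2_loc \<eta>1" "L2_loc (\<lambda>x. x)" "L2_loc (\<lambda>x. c)" for c :: real
    unfolding \<eta>0_def[abs_def] \<eta>1_def[abs_def]
    by (rule trunc | intro continuous_L2_loc continuous_intros)+
  have si: "set_integrable lborel {a..b} (\<lambda>x. g x * h x)" if "L2_loc g" "L2_loc h" for g h :: "real \<Rightarrow> real" and a b
    using L2_loc_inner[OF that, of a b] unfolding inner_real_def .
  have poly: "(LBINT x:{-1..1::real}. 1/2) = (1::real)" "(LBINT x:{-1..1::real}. 1/2 * x) = (0::real)"
    "(LBINT x:{-1..1::real}. 3/2 * x) = (0::real)" "(LBINT x:{-1..1::real}. 3/2 * x * x) = (1::real)"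
  proof -
    have i: "(LBINT x:{-1..1::real}. h x) = H 1 - H (-1)"
      if "\<And>x. (H has_real_derivative h x) (at x)" "continuous_on UNIV h" for H h :: "real \<Rightarrow> real"
      by (rule primitive_set_integral[OF primitive_C1])
        (use that in \<open>auto simp: has_real_derivative_iff_has_vector_derivative\<close>)
    show "(LBINT x:{-1..1::real}. 1/2) = (1::real)"
      by (rule i[where H="\<lambda>x. 1/2 * x", THEN trans]) (auto intro!: derivative_eq_intros continuous_intros)
    show "(LBINT x:{-1..1::real}. 1/2 * x) = (0::real)"
      by (rule i[where H="\<lambda>x. 1/4 * x^2", THEN trans]) (auto intro!: derivative_eq_intros continuous_intros)
    show "(LBINT x:{-1..1::real}. 3/2 * x) = (0::real)"
      by (rule i[where H="\<lambda>x. 3/4 * x^2", THEN trans]) (auto intro!: derivative_eq_intros continuous_intros)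
    show "(LBINT x:{-1..1::real}. 3/2 * x * x) = (1::real)"
      by (rule i[where H="\<lambda>x. 1/2 * x^3", THEN trans]) (auto intro!: derivative_eq_intros continuous_intros simp: power2_eq_square)
  qed
  have int\<eta>: "(LBINT x:{-r..r}. \<eta>0 x * h x) = (LBINT x:{-1..1}. 1/2 * h x)"
    "(LBINT x:{-r..r}. \<eta>1 x * h x) = (LBINT x:{-1..1}. 3/2 * x * h x)" if "r \<ge> 1" for r and h :: "real \<Rightarrow> real"
    unfolding set_lebesgue_integral_def
    by (intro Bochner_Integration.integral_cong; use that in \<open>auto simp: \<eta>0_def \<eta>1_def indicator_def\<close>)+
  \<comment> \<open>By the duality of \<open>\<eta>0\<close> and \<open>\<eta>1\<close> with 1 and
    \<open>x\<close>, this choice makes the remainder \<rho> orthogonal to both.\<close>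
  define \<alpha> where "\<alpha> = (LBINT x:{-1..1}. \<eta>0 x * f x)"
  define \<beta> where "\<beta> = (LBINT x:{-1..1}. \<eta>1 x * f x)"
  define \<rho> where "\<rho> x = f x - (\<alpha> + \<beta> * x)" for x
  have L\<rho>: "L2_loc \<rho>"
    unfolding \<rho>_def by (rule L2_loc_diff[OF f continuous_L2_loc]) (intro continuous_intros)
  have split: "(LBINT x:{-r..r}. h x * f x)
      = (LBINT x:{-r..r}. h x * \<rho> x) + \<alpha> * (LBINT x:{-r..r}. h x * 1) + \<beta> * (LBINT x:{-r..r}. h x * x)"
    if "L2_loc h" for h and r :: real
  proof -
    have "(LBINT x:{-r..r}. h x * f x) = (LBINT x:{-r..r}. (h x * \<rho> x + \<alpha> * (h x * 1)) + \<beta> * (h x * x))"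
      by (rule arg_cong[where f="set_lebesgue_integral lborel {-r..r}"])
        (simp add: \<rho>_def fun_eq_iff right_diff_distrib distrib_left mult.left_commute)
    also have "\<dots> = (LBINT x:{-r..r}. h x * \<rho> x) + \<alpha> * (LBINT x:{-r..r}. h x * 1) + \<beta> * (LBINT x:{-r..r}. h x * x)"
      using si[OF that L\<rho>] si[OF that L\<eta>(4), of _ _ 1] si[OF that L\<eta>(3)]
      by (simp only: set_integral_add set_integrable_mult_right set_integral_mult_right)
    finally show ?thesis .
  qed
  have o: "(1::real) \<ge> 1" by simp
  have \<rho>\<eta>: "(LBINT x:{-r..r}. \<eta>0 x * \<rho> x) = 0" "(LBINT x:{-r..r}. \<eta>1 x * \<rho> x) = 0" if r: "r \<ge> 1" for r
  proof -
    have "(LBINT x:{-1..1}. \<eta>0 x * \<rho> x) = 0"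
      using split[OF L\<eta>(1), of 1] int\<eta>(1)[OF o, of "\<lambda>x. 1"] int\<eta>(1)[OF o, of "\<lambda>x. x"] poly by (simp add: \<alpha>_def)
    then show "(LBINT x:{-r..r}. \<eta>0 x * \<rho> x) = 0"
      using int\<eta>(1)[OF o, of \<rho>] int\<eta>(1)[OF r, of \<rho>] by simp
    have "(LBINT x:{-1..1}. \<eta>1 x * \<rho> x) = 0"
      using split[OF L\<eta>(2), of 1] int\<eta>(2)[OF o, of "\<lambda>x. 1"] int\<eta>(2)[OF o, of "\<lambda>x. x"] poly by (simp add: \<beta>_def)
    then show "(LBINT x:{-r..r}. \<eta>1 x * \<rho> x) = 0"
      using int\<eta>(2)[OF o, of \<rho>] int\<eta>(2)[OF r, of \<rho>] by simp
  qed
  have AEn: "AE x in lborel. x \<in> {-real (Suc n)..real (Suc n)} \<longrightarrow> \<rho> x = 0" for n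
  proof -
    define r where "r = real (Suc n)"
    have r: "r \<ge> 1" by (simp add: r_def)
    define a where "a = (LBINT x:{-r..r}. \<rho> x * 1)"
    define b where "b = (LBINT x:{-r..r}. \<rho> x * x)"
    \<comment> \<open>\<open>a\<close> and \<open>b\<close> are the moments of the truncated \<rho>,
      so \<open>p\<close> has vanishing moments, and \<open>r \<ge> 1\<close> keeps the correction
      inside \<open>{-r..r}\<close>. Since \<rho> is orthogonal to the correction, testing with
      \<open>p\<close> leaves the integral of the square of \<rho>.\<close>
    define p where "p x = indicator {-r..r} x * \<rho> x - (a * \<eta>0 x + b * \<eta>1 x)" for x
    have Lp: "L2_loc p"
      unfolding p_def[abs_def] using L2_loc_scaleR[OF L\<eta>(1), of a] L2_loc_scaleR[OF L\<eta>(2), of b]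
      by (intro L2_loc_diff L2_loc_add trunc L\<rho>) simp_all
    have pint: "(LBINT x:{-r..r}. p x * h x) = (LBINT x:{-r..r}. \<rho> x * h x)
        - (a * (LBINT x:{-r..r}. \<eta>0 x * h x) + b * (LBINT x:{-r..r}. \<eta>1 x * h x))" if "L2_loc h" for h
    proof -
      have "(LBINT x:{-r..r}. p x * h x) = (LBINT x:{-r..r}. \<rho> x * h x - (a * (\<eta>0 x * h x) + b * (\<eta>1 x * h x)))"
        unfolding set_lebesgue_integral_def
        by (intro Bochner_Integration.integral_cong) (auto simp: p_def indicator_def algebra_simps)
      also have "\<dots> = (LBINT x:{-r..r}. \<rho> x * h x)
        - (a * (LBINT x:{-r..r}. \<eta>0 x * h x) + b * (LBINT x:{-r..r}. \<eta>1 x * h x))"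
        using si[OF L\<rho> that] si[OF L\<eta>(1) that] si[OF L\<eta>(2) that]
        by (simp only: set_integral_add set_integral_diff set_integrable_mult_right set_integral_mult_right)
      finally show ?thesis .
    qed
    have m0: "(LBINT x:{-r..r}. p x * 1) = 0"
      using pint[OF L\<eta>(4), of 1] int\<eta>[OF r, of "\<lambda>x. 1"] poly by (simp add: a_def)
    have m1: "(LBINT x:{-r..r}. p x * x) = 0"
      using pint[OF L\<eta>(3)] int\<eta>[OF r, of "\<lambda>x. x"] poly by (simp add: b_def)
    have "(LBINT x:{-r..r}. p x * f x) = 0"
    proof (rule test[OF r Lp])
      show "p x = 0" if "x \<notin> {-r..r}" for x
        using that r by (auto simp: p_def \<eta>0_def \<eta>1_def indicator_def)
    qed (use m0 m1 in \<open>simp_all add: mult.commute\<close>)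
    then have "(LBINT x:{-r..r}. p x * \<rho> x) = 0"
      unfolding split[OF Lp] m0 m1 by simp
    then have "(LBINT x:{-r..r}. \<rho> x * \<rho> x) = 0"
      unfolding pint[OF L\<rho>] \<rho>\<eta>[OF r] by simp
    then have "(LBINT x. indicator {-r..r} x *\<^sub>R (\<rho> x * \<rho> x)) = 0"
      by (simp add: set_lebesgue_integral_def)
    moreover have "integrable lborel (\<lambda>x. indicator {-r..r} x *\<^sub>R (\<rho> x * \<rho> x))"
      using si[OF L\<rho> L\<rho>] by (simp add: set_integrable_def)
    ultimately have "AE x in lborel. indicator {-r..r} x *\<^sub>R (\<rho> x * \<rho> x) = 0"
      by (subst (asm) integral_nonneg_eq_0_iff_AE) (auto intro!: AE_I2)
    then show ?thesis unfolding r_def by eventually_elim (auto simp: indicator_def)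
  qed
  have "AE x in lborel. \<forall>n. x \<in> {-real (Suc n)..real (Suc n)} \<longrightarrow> \<rho> x = 0"
    unfolding AE_all_countable using AEn by blast
  then have "AE x in lborel. f x = \<alpha> + \<beta> * x"
  proof eventually_elim
    case (elim x)
    obtain n where "\<bar>x\<bar> \<le> real n" using real_arch_simple by blast
    then have "x \<in> {-real (Suc n)..real (Suc n)}" by auto
    then show ?case using elim by (auto simp: \<rho>_def)
  qed
  then show ?thesis by blast
qed

section \<open>First variation and the Euler-Lagrange equation\<close>

context double_well
begin

lemma W_path_derivative:
  assumes "(f has_vector_derivative f') (at t)" "(g has_vector_derivative g') (at t)"
  shows "((\<lambda>t. W (f t, g t)) has_real_derivative (f' \<bullet> Wu W (f t, g t) + g' \<bullet> Wv W (f t, g t))) (at t)"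
proof -
  have "((\<lambda>t. (f t, g t)) has_derivative (\<lambda>h. (h *\<^sub>R f', h *\<^sub>R g'))) (at t)"
    using assms unfolding has_vector_derivative_def by (rule has_derivative_Pair)
  from has_derivative_compose[OF this C2_gradients(1)[OF W_C2]]
  have "((\<lambda>t. W (f t, g t)) has_derivative
      (\<lambda>h. h *\<^sub>R f' \<bullet> Wu W (f t, g t) + h *\<^sub>R g' \<bullet> Wv W (f t, g t))) (at t)" by simp
  moreover have "(\<lambda>h. h *\<^sub>R f' \<bullet> Wu W (f t, g t) + h *\<^sub>R g' \<bullet> Wv W (f t, g t))
      = (*) (f' \<bullet> Wu W (f t, g t) + g' \<bullet> Wv W (f t, g t))"
    by (auto simp: fun_eq_iff algebra_simps)
  ultimately show ?thesis by (simp add: has_field_derivative_def)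
qed

text \<open>The competitor \<open>U + t \<psi> e\<close> differs from \<open>U\<close> only on
  \<open>{-r..r}\<close>, hence is admissible for every \<open>t\<close>, and the difference of the
  energies is an integral over \<open>{-r..r}\<close> that is differentiable at \<open>t = 0\<close>
  and minimal there. The fixed direction \<open>e\<close> reduces everything to scalar profiles; it
  will run through the coordinate vectors.\<close>

lemma first_variation:
  assumes adm: "U \<in> admissible Am Ap q" and min: "\<And>w. w \<in> admissible Am Ap q \<Longrightarrow> J W U \<le> J W w"
    and H: "H2 U Z G" and fin: "energy W U Z G < \<infinity>"
    and e: "norm e = 1" and \<psi>: "H2 \<psi> \<psi>' p" and r: "r > 0"
    and supp: "\<And>x. x \<notin> {-r<..<r} \<Longrightarrow> \<psi> x = 0 \<and> \<psi>' x = 0" "\<And>x. x \<notin> {-r..r} \<Longrightarrow> p x = (0::real)"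
  shows "(LBINT x:{-r..r}. p x * (G x \<bullet> e)) +
    (LBINT x:{-r..r}. \<psi> x * (Wu W (U x, Z x) \<bullet> e) + \<psi>' x * (Wv W (U x, Z x) \<bullet> e)) = 0"
proof -
  define V V' V'' where "V t x = U x + (t * \<psi> x) *\<^sub>R e" and "V' t x = Z x + (t * \<psi>' x) *\<^sub>R e"
    and "V'' t x = G x + (t * p x) *\<^sub>R e" for t x
  have c: "continuous_on S U" "continuous_on S Z" "continuous_on S \<psi>" "continuous_on S \<psi>'" for S
    using H2_continuous[OF H] H2_continuous[OF \<psi>] continuous_on_subset by blast+
  have Lp: "L2_loc p" and LG: "L2_loc G" using \<psi> H by (auto simp: H2_def)
  have Lpe: "L2_loc (\<lambda>x. (t * p x) *\<^sub>R e)" for t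
  proof -
    have "L2_loc (\<lambda>x. t *\<^sub>R p x)" using Lp by (rule L2_loc_scaleR)
    then show ?thesis using e by (auto simp: L2_loc_def)
  qed
  have HV: "H2 (V t) (V' t) (V'' t)" for t
  proof -
    have bl: "bounded_linear (\<lambda>s. (t * s) *\<^sub>R e)"
      by (intro bounded_linear_scaleR_const bounded_linear_const_mult bounded_linear_ident)
    show ?thesis
      using H \<psi> unfolding H2_def V_def V'_def V''_def
      by (auto intro!: primitive_add primitive_bounded_linear[OF bl] L2_loc_add Lpe)
  qed
  have Vout: "V t x = U x" "V' t x = Z x" if "x \<notin> {-r<..<r}" for t x
    using supp(1)[OF that] by (auto simp: V_def V'_def)
  have V''out: "V'' t x = G x" if "x \<notin> {-r..r}" for t x
    using supp(2)[OF that] by (auto simp: V''_def)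
  have admV: "V t \<in> admissible Am Ap q" for t
  proof -
    obtain xm xp where x: "xm < xp" "\<And>x. x \<le> xm \<Longrightarrow> infdist (U x) Am \<le> q" "\<And>x. x \<ge> xp \<Longrightarrow> infdist (U x) Ap \<le> q"
      using adm admissible_iff_H2 by blast
    show ?thesis unfolding admissible_iff_H2
    proof (intro conjI exI)
      show "H2 (V t) (V' t) (V'' t)" by (rule HV)
      show "min xm (-r) < max xp r" using r by auto
      show "\<forall>x\<le>min xm (-r). infdist (V t x) Am \<le> q" "\<forall>x\<ge>max xp r. infdist (V t x) Ap \<le> q"
        using x Vout by auto
    qed
  qed
  define d0 where "d0 x = 1/2 * (norm (G x))\<^sup>2 + W (U x, Z x)" for x
  define w where "w t x = W (V t x, V' t x)" for t x
  define D where "D t x = (t * (p x * (G x \<bullet> e)) + t\<^sup>2 * (1/2 * (p x)\<^sup>2)) + (w t x - W (U x, Z x))" for t x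
  \<comment> \<open>The energies on the whole line are compared at the level of densities, so that
    the common integrable part \<open>d0\<close> can be subtracted.\<close>
  have dens: "1/2 * (norm (V'' t x))\<^sup>2 + W (V t x, V' t x) = d0 x + indicator {-r..r} x * D t x" for t x
  proof (cases "x \<in> {-r..r}")
    case True
    have "(norm (V'' t x))\<^sup>2 = (norm (G x))\<^sup>2 + (t * p x)\<^sup>2 + 2 * (t * p x) * (G x \<bullet> e)"
      unfolding V''_def norm_add_sq using e by simp
    then show ?thesis using True by (simp add: d0_def D_def w_def power_mult_distrib algebra_simps)
  next
    case False
    then have "x \<notin> {-r<..<r}" by auto
    then show ?thesis using False Vout V''out by (simp add: d0_def)
  qed
  have cV: "continuous_on S (V t)" "continuous_on S (V' t)" for S t
    unfolding V_def V'_def by (intro continuous_intros c)+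
  have cw: "continuous_on {-r..r} (w t)" for t
    unfolding w_def by (rule continuous_on_compose2[OF W_continuous[of UNIV]]) (auto intro!: continuous_intros cV)
  have iw: "set_integrable lborel {-r..r} (w t)" for t
    by (rule borel_integrable_atLeastAtMost'[OF cw])
  have w0: "w 0 x = W (U x, Z x)" for x by (simp add: w_def V_def V'_def)
  have iG: "set_integrable lborel {-r..r} (\<lambda>x. p x * (G x \<bullet> e))"
    using L2_loc_inner[OF Lpe[of 1] LG, of "-r" r] by (simp add: inner_commute)
  have ip: "set_integrable lborel {-r..r} (\<lambda>x. 1/2 * (p x)\<^sup>2)"
    using Lp by (intro set_integrable_mult_right) (simp add: L2_loc_def)
  have iD: "set_integrable lborel {-r..r} (D t)" for t
    unfolding D_def[abs_def] w0[symmetric]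
    by (intro set_integral_add(1) set_integral_diff(1) set_integrable_mult_right iG ip iw)
  define A where "A = (LBINT x:{-r..r}. p x * (G x \<bullet> e))"
  define B where "B = (LBINT x:{-r..r}. 1/2 * (p x)\<^sup>2)"
  define F where "F t = (LBINT x:{-r..r}. w t x)" for t
  have intD: "(LBINT x:{-r..r}. D t x) = (t * A + t\<^sup>2 * B) + (F t - F 0)" for t
    unfolding D_def[abs_def] w0[symmetric] A_def B_def F_def
    by (simp only: set_integral_add set_integral_diff set_integrable_mult_right set_integral_mult_right iG ip iw)
  have i0: "integrable lborel d0" unfolding d0_def[abs_def] by (rule energy_integrable[OF H fin])
  have nonneg: "0 \<le> (LBINT x:{-r..r}. D t x)" for t
  proof -
    have iV: "integrable lborel (\<lambda>x. d0 x + indicator {-r..r} x * D t x)"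
      using i0 iD[of t] by (simp add: set_integrable_def)
    have pos: "0 \<le> d0 x + indicator {-r..r} x * D t x" for x
      unfolding dens[symmetric] using W_nonneg[of "V t x" "V' t x"] by simp
    have "ennreal (LBINT x. d0 x) = energy W U Z G"
      unfolding energy_def d0_def[symmetric] by (rule nn_integral_eq_integral[symmetric, OF i0])
        (simp add: d0_def W_nonneg)
    also have "\<dots> \<le> energy W (V t) (V' t) (V'' t)"
      using min[OF admV[of t]] H2_J_eq_energy[OF H] H2_J_eq_energy[OF HV] by simp
    also have "\<dots> = ennreal (LBINT x. d0 x + indicator {-r..r} x * D t x)"
      unfolding energy_def dens by (rule nn_integral_eq_integral[OF iV]) (simp add: pos)
    finally have "(LBINT x. d0 x) \<le> (LBINT x. d0 x + indicator {-r..r} x * D t x)"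
      using pos by (subst (asm) ennreal_le_iff) (auto intro: integral_nonneg_AE)
    also have "\<dots> = (LBINT x. d0 x) + (LBINT x:{-r..r}. D t x)"
      using i0 iD[of t] by (simp add: set_integrable_def set_lebesgue_integral_def)
    finally show ?thesis by simp
  qed
  define w' where "w' t x = \<psi> x * (Wu W (V t x, V' t x) \<bullet> e) + \<psi>' x * (Wv W (V t x, V' t x) \<bullet> e)" for t x
  have Fi: "F t = integral (cbox (-r) r) (w t)" for t
    unfolding F_def using set_borel_integral_eq_integral(2)[OF iw] by simp
  have dw: "((\<lambda>t. w t x) has_real_derivative w' t x) (at t)" for t x
  proof -
    have "((\<lambda>t. V t x) has_vector_derivative \<psi> x *\<^sub>R e) (at t)" "((\<lambda>t. V' t x) has_vector_derivative \<psi>' x *\<^sub>R e) (at t)"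
      unfolding V_def V'_def by (auto intro!: derivative_eq_intros simp: has_real_derivative_iff_has_vector_derivative[symmetric])
    from W_path_derivative[OF this] show ?thesis
      by (simp add: w_def w'_def inner_commute)
  qed
  have cp: "continuous_on S (\<lambda>(t, x). (V t x, V' t x))" for S :: "(real \<times> real) set"
    unfolding V_def V'_def split_beta
    by (intro continuous_intros continuous_on_compose2[OF c(1)[of UNIV]] continuous_on_compose2[OF c(2)[of UNIV]]
        continuous_on_compose2[OF c(3)[of UNIV]] continuous_on_compose2[OF c(4)[of UNIV]]) auto
  have cw': "continuous_on (UNIV \<times> cbox (-r) r) (\<lambda>(t, x). w' t x)"
    unfolding w'_def split_beta
    by (intro continuous_intros continuous_on_compose2[OF c(3)[of UNIV]] continuous_on_compose2[OF c(4)[of UNIV]]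
        continuous_on_compose2[OF C2_gradients(2)[OF W_C2]] continuous_on_compose2[OF C2_gradients(3)[OF W_C2]]
        cp[unfolded split_beta]) auto
  \<comment> \<open>On a compact interval, joint continuity of \<open>w'\<close> in \<open>t\<close>
    and \<open>x\<close> justifies differentiation under the integral.\<close>
  have "((\<lambda>t. integral (cbox (-r) r) (w t)) has_real_derivative integral (cbox (-r) r) (w' 0)) (at 0 within UNIV)"
  proof (rule leibniz_rule_field_derivative[OF _ _ cw'])
    show "w t integrable_on cbox (-r) r" for t
      using set_borel_integral_eq_integral(1)[OF iw] by simp
  qed (use dw in auto)
  then have "(F has_real_derivative integral (cbox (-r) r) (w' 0)) (at 0)"
    by (simp add: Fi[abs_def])
  then have dK: "((\<lambda>t. (t * A + t\<^sup>2 * B) + (F t - F 0)) has_real_derivative (A + integral (cbox (-r) r) (w' 0))) (at 0)"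
    by (auto intro!: derivative_eq_intros)
  have "A + integral (cbox (-r) r) (w' 0) = 0"
    by (rule DERIV_local_min[OF dK, of 1]) (use nonneg in \<open>simp_all add: intD\<close>)
  moreover have "integral (cbox (-r) r) (w' 0) = (LBINT x:{-r..r}. w' 0 x)"
  proof -
    have "continuous_on {-r..r} (\<lambda>x. case (0, x) of (t, x) \<Rightarrow> w' t x)"
      by (rule continuous_on_compose2[OF cw']) (auto intro!: continuous_intros)
    then have "continuous_on {-r..r} (w' 0)" by simp
    from set_borel_integral_eq_integral(2)[OF borel_integrable_atLeastAtMost'[OF this]] show ?thesis by simp
  qed
  moreover have "w' 0 x = \<psi> x * (Wu W (U x, Z x) \<bullet> e) + \<psi>' x * (Wv W (U x, Z x) \<bullet> e)" for x
    by (simp add: w'_def V_def V'_def)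
  ultimately show ?thesis by (simp add: A_def)
qed

text \<open>With \<open>P\<close> a primitive of \<open>W_u\<close> and \<open>Q\<close> one of
  \<open>W_v - P\<close> along the path, two integrations by parts turn the first variation into the
  orthogonality of each coordinate of \<open>G - Q\<close> to all \<open>p\<close> with vanishing
  moments. The combination \<open>u3 - Wv\<close> is kept together since its derivative
  \<open>- Wu\<close> tends to 0, which the limits at infinity exploit.\<close>

lemma Euler_Lagrange:
  assumes adm: "U \<in> admissible Am Ap q" and min: "\<And>w. w \<in> admissible Am Ap q \<Longrightarrow> J W U \<le> J W w"
    and fin: "J W U < \<infinity>"
  shows "\<exists>Z u2 u3. H2 U Z u2 \<and> (\<forall>x. (Z has_vector_derivative u2 x) (at x)) \<and>
    (\<forall>x. (u2 has_vector_derivative u3 x) (at x)) \<and>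
    (\<forall>x. ((\<lambda>x. u3 x - Wv W (U x, Z x)) has_vector_derivative - Wu W (U x, Z x)) (at x))"
proof -
  obtain Z G where H: "H2 U Z G" using adm admissible_iff_H2 by blast
  have finE: "energy W U Z G < \<infinity>" using fin H2_J_eq_energy[OF H] by simp
  have cUZ: "continuous_on S (\<lambda>x. (U x, Z x))" for S
    using H2_continuous[OF H] continuous_on_subset by (intro continuous_intros) blast+
  have cu: "continuous_on UNIV (\<lambda>x. Wu W (U x, Z x))" and cv: "continuous_on UNIV (\<lambda>x. Wv W (U x, Z x))"
    using continuous_on_compose2[OF C2_gradients(2)[OF W_C2] cUZ] continuous_on_compose2[OF C2_gradients(3)[OF W_C2] cUZ]
    by auto
  obtain P where P: "primitive P (\<lambda>x. Wu W (U x, Z x))" using primitive_exists[OF continuous_L1_loc[OF cu]] by blast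
  have cP: "continuous_on UNIV P" by (rule primitive_continuous[OF P])
  have cvP: "continuous_on UNIV (\<lambda>x. Wv W (U x, Z x) - P x)" by (intro continuous_intros cv cP)
  obtain Q where Q: "primitive Q (\<lambda>x. Wv W (U x, Z x) - P x)" using primitive_exists[OF continuous_L1_loc[OF cvP]] by blast
  have cQ: "continuous_on UNIV Q" by (rule primitive_continuous[OF Q])
  have pZ: "primitive Z G" and LG: "L2_loc G" using H by (auto simp: H2_def)
  have LGe: "L2_loc (\<lambda>x. f x \<bullet> e)" if "L2_loc f" "e \<in> Basis" for f :: "real \<Rightarrow> 'a" and e
  proof -
    have [measurable]: "f \<in> borel_measurable borel" using that by (simp add: L2_loc_def)
    have "set_integrable lborel {a..b} (\<lambda>x. (norm (f x \<bullet> e))\<^sup>2)" for a b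
    proof (rule set_integrable_bound)
      show "set_integrable lborel {a..b} (\<lambda>x. (norm (f x))\<^sup>2)" using that by (simp add: L2_loc_def)
      show "set_borel_measurable lborel {a..b} (\<lambda>x. (norm (f x \<bullet> e))\<^sup>2)"
        unfolding set_borel_measurable_def by measurable
      show "AE x in lborel. x \<in> {a..b} \<longrightarrow> norm ((norm (f x \<bullet> e))\<^sup>2) \<le> norm ((norm (f x))\<^sup>2)"
      proof (intro AE_I2 impI)
        fix x show "norm ((norm (f x \<bullet> e))\<^sup>2) \<le> norm ((norm (f x))\<^sup>2)"
          using power_mono[OF Basis_le_norm[OF that(2), of "f x"] abs_ge_zero, of 2] by simp
      qed
    qed
    then show ?thesis by (simp add: L2_loc_def)
  qed
  have "\<exists>\<alpha> \<beta>. AE x in lborel. (G x - Q x) \<bullet> e = \<alpha> + \<beta> * x" if e: "e \<in> Basis" for e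
  proof (rule second_order_du_Bois_Reymond)
    show "L2_loc (\<lambda>x. (G x - Q x) \<bullet> e)"
      by (intro LGe L2_loc_diff LG continuous_L2_loc cQ e)
    fix r :: real and p :: "real \<Rightarrow> real"
    assume r: "r \<ge> 1" and p: "L2_loc p" and supp: "\<And>x. x \<notin> {-r..r} \<Longrightarrow> p x = 0"
      and m: "(LBINT x:{-r..r}. p x) = 0" "(LBINT x:{-r..r}. x * p x) = 0"
    have r0: "r > 0" and rr: "-r \<le> r" using r by auto
    obtain \<psi> \<psi>' where \<psi>: "H2 \<psi> \<psi>' p" and out: "\<And>x. x \<notin> {-r<..<r} \<Longrightarrow> \<psi> x = 0 \<and> \<psi>' x = 0"
      using compact_second_primitive[OF p supp r0 m] by blast
    have p1: "primitive \<psi> \<psi>'" and p2: "primitive \<psi>' p" using \<psi> by (auto simp: H2_def)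
    have ends: "\<psi> r = 0" "\<psi> (-r) = 0" "\<psi>' r = 0" "\<psi>' (-r) = 0" using out by auto
    note in_e = primitive_bounded_linear[OF bounded_linear_inner_left]
    have b1: "(LBINT x:{-r..r}. \<psi>' x * (P x \<bullet> e)) + (LBINT x:{-r..r}. \<psi> x * (Wu W (U x, Z x) \<bullet> e)) = 0"
      using primitive_by_parts[OF p1 in_e[OF P] rr] ends by simp
    have b2: "(LBINT x:{-r..r}. p x * (Q x \<bullet> e)) + (LBINT x:{-r..r}. \<psi>' x * ((Wv W (U x, Z x) - P x) \<bullet> e)) = 0"
      using primitive_by_parts[OF p2 in_e[OF Q] rr] ends by simp
    have "norm e = 1" using e by simp
    from first_variation[OF adm min H finE this \<psi> r0 out supp]
    have b3: "(LBINT x:{-r..r}. p x * (G x \<bullet> e)) +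
      (LBINT x:{-r..r}. \<psi> x * (Wu W (U x, Z x) \<bullet> e) + \<psi>' x * (Wv W (U x, Z x) \<bullet> e)) = 0" by blast
    have c\<psi>: "continuous_on S \<psi>" "continuous_on S \<psi>'" for S
      using H2_continuous[OF \<psi>] continuous_on_subset by blast+
    have ci: "set_integrable lborel {-r..r} f" if "continuous_on UNIV f" for f :: "real \<Rightarrow> real"
      using continuous_on_subset[OF that] by (intro borel_integrable_atLeastAtMost') auto
    have i1: "set_integrable lborel {-r..r} (\<lambda>x. \<psi> x * (Wu W (U x, Z x) \<bullet> e))"
      and i2: "set_integrable lborel {-r..r} (\<lambda>x. \<psi>' x * (Wv W (U x, Z x) \<bullet> e))"
      and i3: "set_integrable lborel {-r..r} (\<lambda>x. \<psi>' x * (P x \<bullet> e))"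
      by (rule ci; intro continuous_intros c\<psi> cu cv cP)+
    have si: "set_integrable lborel {-r..r} (\<lambda>x. p x * (f x \<bullet> e))" if "L2_loc f" for f :: "real \<Rightarrow> 'a"
      using L2_loc_inner[OF p LGe[OF that e], of "-r" r] unfolding inner_real_def .
    have s3: "(LBINT x:{-r..r}. \<psi> x * (Wu W (U x, Z x) \<bullet> e) + \<psi>' x * (Wv W (U x, Z x) \<bullet> e))
      = (LBINT x:{-r..r}. \<psi> x * (Wu W (U x, Z x) \<bullet> e)) + (LBINT x:{-r..r}. \<psi>' x * (Wv W (U x, Z x) \<bullet> e))"
      by (rule set_integral_add(2)[OF i1 i2])
    have s2: "(LBINT x:{-r..r}. \<psi>' x * ((Wv W (U x, Z x) - P x) \<bullet> e))
      = (LBINT x:{-r..r}. \<psi>' x * (Wv W (U x, Z x) \<bullet> e)) - (LBINT x:{-r..r}. \<psi>' x * (P x \<bullet> e))"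
      unfolding inner_diff_left right_diff_distrib by (rule set_integral_diff(2)[OF i2 i3])
    have "(LBINT x:{-r..r}. p x * ((G x - Q x) \<bullet> e))
      = (LBINT x:{-r..r}. p x * (G x \<bullet> e)) - (LBINT x:{-r..r}. p x * (Q x \<bullet> e))"
      unfolding inner_diff_left right_diff_distrib
      by (rule set_integral_diff(2)[OF si[OF LG] si[OF continuous_L2_loc[OF cQ]]])
    then show "(LBINT x:{-r..r}. p x * ((G x - Q x) \<bullet> e)) = 0"
      using b1 b2 b3 unfolding s2 s3 by linarith
  qed
  then obtain \<alpha> \<beta> where \<alpha>\<beta>: "\<And>e. e \<in> Basis \<Longrightarrow> AE x in lborel. (G x - Q x) \<bullet> e = \<alpha> e + \<beta> e * x" by metis
  define a b where "a = (\<Sum>e\<in>Basis. \<alpha> e *\<^sub>R e)" and "b = (\<Sum>e\<in>Basis. \<beta> e *\<^sub>R e)"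
  \<comment> \<open>The continuous representative of \<open>G\<close>; from here on the second
    derivative is classical.\<close>
  define u2 where "u2 x = Q x + (a + x *\<^sub>R b)" for x
  define u3 where "u3 x = (Wv W (U x, Z x) - P x) + b" for x
  have "AE x in lborel. \<forall>e\<in>Basis. (G x - Q x) \<bullet> e = \<alpha> e + \<beta> e * x"
    using \<alpha>\<beta> by (intro AE_finite_allI) auto
  then have ae: "AE x in lborel. G x = u2 x"
  proof eventually_elim
    case (elim x)
    have "G x - Q x = a + x *\<^sub>R b"
    proof (rule euclidean_eqI)
      fix e :: 'a assume "e \<in> Basis"
      then show "(G x - Q x) \<bullet> e = (a + x *\<^sub>R b) \<bullet> e"
        using elim by (simp add: a_def b_def inner_add_left)
    qed
    then show ?case by (simp add: u2_def algebra_simps)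
  qed
  have c2: "continuous_on UNIV u2" unfolding u2_def by (intro continuous_intros cQ)
  have p2: "primitive Z u2" by (rule primitive_AE_cong[OF pZ ae continuous_L1_loc[OF c2]])
  have "H2 U Z u2" using H p2 continuous_L2_loc[OF c2] by (simp add: H2_def)
  moreover have "(Z has_vector_derivative u2 x) (at x)" for x
    by (rule primitive_has_vector_derivative[OF p2 c2])
  moreover have "(u2 has_vector_derivative u3 x) (at x)" for x
    unfolding u2_def u3_def
    by (auto intro!: derivative_eq_intros primitive_has_vector_derivative[OF Q cvP])
  moreover have "((\<lambda>x. u3 x - Wv W (U x, Z x)) has_vector_derivative - Wu W (U x, Z x)) (at x)" for x
    unfolding u3_def
    by (auto intro!: derivative_eq_intros primitive_has_vector_derivative[OF P cu])
  ultimately show ?thesis by blast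
qed

end

section \<open>Limits at infinity and the conserved quantity\<close>

context double_well
begin

text \<open>\<open>W\<close> is nonnegative and vanishes at \<open>(a, 0)\<close>, so this point is
  a minimum in both variables at once.\<close>

lemma gradients_zero:
  assumes "a \<in> Am \<union> Ap"
  shows "Wu W (a, 0) = 0" "Wv W (a, 0) = 0"
proof -
  have "W (a, 0) = 0" using assms zeros by blast
  then have "(\<lambda>h. fst h \<bullet> Wu W (a, 0) + snd h \<bullet> Wv W (a, 0)) = (\<lambda>h. 0)"
    using W_nonneg by (intro has_derivative_local_min[OF C2_gradients(1)[OF W_C2]]) (auto intro: always_eventually)
  then have *: "fst h \<bullet> Wu W (a, 0) + snd h \<bullet> Wv W (a, 0) = 0" for h by metis
  show "Wu W (a, 0) = 0" using *[of "(Wu W (a, 0), 0)"] by simp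
  show "Wv W (a, 0) = 0" using *[of "(0, Wv W (a, 0))"] by simp
qed

text \<open>Only the distance of the path to the zeros is known to tend to 0, not the path to a
  single point; the estimate that is uniform over all zeros takes the place of continuity at a limit
  point.\<close>

lemma tendsto_along_zeros:
  fixes \<Phi> :: "'a \<times> 'a \<Rightarrow> 'b::real_normed_vector"
  assumes c: "continuous_on UNIV \<Phi>" and zero: "\<And>a. a \<in> Am \<union> Ap \<Longrightarrow> \<Phi> (a, 0) = 0"
    and U: "((\<lambda>x. infdist (U x) (Am \<union> Ap)) \<longlongrightarrow> 0) F" and Z: "(Z \<longlongrightarrow> 0) F"
  shows "((\<lambda>x. \<Phi> (U x, Z x)) \<longlongrightarrow> 0) F"
proof (rule tendstoI)
  fix \<epsilon> :: real assume \<epsilon>: "\<epsilon> > 0"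
  obtain \<delta> where \<delta>: "\<delta> > 0"
    "\<And>a u v. a \<in> Am \<union> Ap \<Longrightarrow> norm (u - a) \<le> \<delta> \<Longrightarrow> norm v \<le> \<delta> \<Longrightarrow> norm (\<Phi> (u, v)) \<le> \<epsilon>/2"
    using small_near_zeros[OF c zero, of "\<epsilon>/2"] \<epsilon> by (metis half_gt_zero)
  have "\<forall>\<^sub>F x in F. infdist (U x) (Am \<union> Ap) < \<delta>" by (rule order_tendstoD(2)[OF U \<delta>(1)])
  moreover have "\<forall>\<^sub>F x in F. norm (Z x) < \<delta>" using tendstoD[OF Z \<delta>(1)] by simp
  ultimately show "\<forall>\<^sub>F x in F. dist (\<Phi> (U x, Z x)) 0 < \<epsilon>"
  proof eventually_elim
    case (elim x)
    have "closed (Am \<union> Ap)" "Am \<union> Ap \<noteq> {}" using Am Ap compact_imp_closed by auto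
    then obtain a where "a \<in> Am \<union> Ap" "infdist (U x) (Am \<union> Ap) = dist (U x) a"
      using infdist_attains_inf by blast
    then have "norm (\<Phi> (U x, Z x)) \<le> \<epsilon>/2"
      using elim by (intro \<delta>(2)) (auto simp: dist_norm)
    then show ?case using \<epsilon> by simp
  qed
qed

text \<open>By the triangle inequality through a nearest point of \<open>Am\<close>: two distances
  of at most \<open>q\<close> cannot bridge a gap of more than \<open>2 * q\<close>. This decides
  which well attains the minimum of the two distances.\<close>

lemma wells_separated:
  assumes "infdist y Am \<le> q"
  shows "infdist y Ap > q"
proof -
  obtain a where a: "a \<in> Am" "infdist y Am = dist y a"
    using infdist_attains_inf[OF compact_imp_closed[OF Am(2)] Am(1)] by blast
  have "setdist Am Ap \<le> setdist {a} Ap" using a(1) by (intro setdist_subset_left) auto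
  also have "\<dots> = infdist a Ap" by (simp add: infdist_eq_setdist)
  also have "\<dots> \<le> infdist y Ap + dist a y" by (rule infdist_triangle)
  finally show ?thesis using q(2) assms a(2) by (simp add: dist_commute)
qed

lemma infdist_well_tendsto:
  assumes "((\<lambda>x. infdist (U x) (Am \<union> Ap)) \<longlongrightarrow> 0) F"
  shows "\<forall>\<^sub>F x in F. infdist (U x) Am \<le> q \<Longrightarrow> ((\<lambda>x. infdist (U x) Am) \<longlongrightarrow> 0) F"
    and "\<forall>\<^sub>F x in F. infdist (U x) Ap \<le> q \<Longrightarrow> ((\<lambda>x. infdist (U x) Ap) \<longlongrightarrow> 0) F"
proof -
  have min: "infdist y (Am \<union> Ap) = min (infdist y Am) (infdist y Ap)" for y
    using infdist_Un_min[of Am Ap y] Am Ap by auto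
  show "((\<lambda>x. infdist (U x) Am) \<longlongrightarrow> 0) F" if "\<forall>\<^sub>F x in F. infdist (U x) Am \<le> q"
  proof (rule Lim_transform_eventually[OF assms])
    show "\<forall>\<^sub>F x in F. infdist (U x) (Am \<union> Ap) = infdist (U x) Am"
      using that
    proof eventually_elim
      case (elim x)
      then show ?case unfolding min using wells_separated[OF elim] by linarith
    qed
  qed
  show "((\<lambda>x. infdist (U x) Ap) \<longlongrightarrow> 0) F" if "\<forall>\<^sub>F x in F. infdist (U x) Ap \<le> q"
  proof (rule Lim_transform_eventually[OF assms])
    show "\<forall>\<^sub>F x in F. infdist (U x) (Am \<union> Ap) = infdist (U x) Ap"
      using that
    proof eventually_elim
      case (elim x)
      then have "\<not> infdist (U x) Am \<le> q" using wells_separated[of "U x"] by linarith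
      then show ?case unfolding min using elim by linarith
    qed
  qed
qed

end

text \<open>On a unit scale \<open>z\<close> is nearly the quadratic \<open>z x + s z' x + s\<^sup>2/2 p x\<close>; smallness at three points
  forces both coefficients to be small.\<close>

lemma higher_derivatives_tendsto_0:
  fixes z z' z'' p w :: "real \<Rightarrow> 'a::euclidean_space"
  assumes z: "\<And>x. (z has_vector_derivative z' x) (at x)" and z': "\<And>x. (z' has_vector_derivative z'' x) (at x)"
    and p: "\<And>x. (p has_vector_derivative w x) (at x)" and cw: "continuous_on UNIV w" and cz: "continuous_on UNIV z''"
    and lim: "(z \<longlongrightarrow> 0) at_infinity" "(w \<longlongrightarrow> 0) at_infinity" "((\<lambda>x. z'' x - p x) \<longlongrightarrow> 0) at_infinity"
  shows "(z' \<longlongrightarrow> 0) at_infinity" "(p \<longlongrightarrow> 0) at_infinity"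
proof -
  have pp: "primitive p w" by (rule primitive_C1[OF p cw])
  have pz': "primitive z' z''" by (rule primitive_C1[OF z' cz])
  have pz: "primitive z z'" by (rule primitive_C1[OF z primitive_continuous[OF pz']])
  have key: "\<exists>b. \<forall>x. \<bar>x\<bar> \<ge> b \<longrightarrow> norm (z' x) \<le> 18 * \<epsilon> \<and> norm (p x) \<le> 24 * \<epsilon>" if \<epsilon>: "\<epsilon> > 0" for \<epsilon>
  proof -
    have "\<forall>\<^sub>F x in at_infinity. norm (z x) < \<epsilon> \<and> norm (w x) < \<epsilon>/4 \<and> norm (z'' x - p x) < \<epsilon>/2"
      using tendstoD[OF lim(1), of \<epsilon>] tendstoD[OF lim(2), of "\<epsilon>/4"] tendstoD[OF lim(3), of "\<epsilon>/2"] \<epsilon>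
      by (simp add: eventually_conj_iff)
    then obtain b where b: "\<And>x. \<bar>x\<bar> \<ge> b \<Longrightarrow> norm (z x) < \<epsilon> \<and> norm (w x) < \<epsilon>/4 \<and> norm (z'' x - p x) < \<epsilon>/2"
      by (auto simp: eventually_at_infinity)
    have "norm (z' x) \<le> 18 * \<epsilon> \<and> norm (p x) \<le> 24 * \<epsilon>" if x: "\<bar>x\<bar> \<ge> \<bar>b\<bar> + 2" for x
    proof -
      have far: "\<bar>t\<bar> \<ge> b" if "t \<in> {x..x+2}" for t using x that by auto
      \<comment> \<open>\<open>p\<close> is frozen at \<open>x\<close> because its derivative
        \<open>w\<close> is small, whereas \<open>z''\<close> is only known to be close to
        \<open>p\<close>. Over a length of at most 2 the errors become \<epsilon>/2 for
        \<open>p\<close>, \<epsilon> for \<open>z''\<close>, 2 \<epsilon> for \<open>z'\<close> and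
        4 \<epsilon> for \<open>z\<close>.\<close>
      have p1: "norm (p t - p x) \<le> \<epsilon>/2" if t: "t \<in> {x..x+2}" for t
      proof -
        have "norm (p t - p x) \<le> \<epsilon>/4 * (t - x)"
        proof (rule primitive_bound[OF pp])
          show "norm (w s) \<le> \<epsilon>/4" if "s \<in> {x..t}" for s
            using b[OF far, of s] that t by auto
        qed (use t \<epsilon> in auto)
        also have "\<dots> \<le> \<epsilon>/4 * 2" using t \<epsilon> by (intro mult_left_mono) auto
        finally show ?thesis by simp
      qed
      have z2: "norm (z'' t - p x) \<le> \<epsilon>" if t: "t \<in> {x..x+2}" for t
        using norm_triangle_ineq[of "z'' t - p t" "p t - p x"] p1[OF t] b[OF far[OF t]] by simp
      have z1: "norm (z' t - (t - x) *\<^sub>R p x - z' x) \<le> 2 * \<epsilon>" if t: "t \<in> {x..x+2}" for t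
      proof -
        have "primitive (\<lambda>t. (t - x) *\<^sub>R p x) (\<lambda>t. p x)"
          by (rule primitive_C1) (auto intro!: derivative_eq_intros)
        from primitive_bound[OF primitive_diff[OF pz' this], of x t \<epsilon>]
        have "norm ((z' t - (t - x) *\<^sub>R p x) - z' x) \<le> \<epsilon> * (t - x)"
          using t \<epsilon> z2 by simp
        also have "\<dots> \<le> \<epsilon> * 2" using t \<epsilon> by (intro mult_left_mono) auto
        finally show ?thesis by simp
      qed
      have z0: "norm (z t - ((t - x) *\<^sub>R z' x + ((t - x)\<^sup>2 / 2) *\<^sub>R p x) - z x) \<le> 4 * \<epsilon>" if t: "t \<in> {x..x+2}" for t
      proof -
        have "primitive (\<lambda>t. (t - x) *\<^sub>R z' x + ((t - x)\<^sup>2 / 2) *\<^sub>R p x) (\<lambda>t. z' x + (t - x) *\<^sub>R p x)"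
          by (rule primitive_C1)
            (auto intro!: derivative_eq_intros continuous_intros
              simp: has_real_derivative_iff_has_vector_derivative[symmetric])
        from primitive_bound[OF primitive_diff[OF pz this], of x t "2 * \<epsilon>"]
        have "norm ((z t - ((t - x) *\<^sub>R z' x + ((t - x)\<^sup>2 / 2) *\<^sub>R p x)) - z x) \<le> 2 * \<epsilon> * (t - x)"
          using t \<epsilon> z1 by (simp add: algebra_simps)
        also have "\<dots> \<le> 2 * \<epsilon> * 2" using t \<epsilon> by (intro mult_left_mono) auto
        finally show ?thesis by simp
      qed
      have zs: "norm (z x) \<le> \<epsilon>" "norm (z (x + 1)) \<le> \<epsilon>" "norm (z (x + 2)) \<le> \<epsilon>"
        using b[OF far, of x] b[OF far, of "x+1"] b[OF far, of "x+2"] by auto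
      \<comment> \<open>\<open>A\<close> and \<open>B\<close> are the increments of the quadratic at
        distances 1 and 2. Solving for its coefficients gives \<open>p x = B - 2 A\<close>, hence
        the factor 6 + 12 = 18, and \<open>z' x = A - p x / 2\<close>, hence 6 + 9 = 15.\<close>
      define A where "A = z' x + (1/2) *\<^sub>R p x"
      define B where "B = 2 *\<^sub>R z' x + 2 *\<^sub>R p x"
      have "norm (z (x + 1) - A - z x) \<le> 4 * \<epsilon>" using z0[of "x + 1"] by (simp add: A_def)
      moreover have "A = z (x + 1) - z x - (z (x + 1) - A - z x)" by simp
      ultimately have A: "norm A \<le> 6 * \<epsilon>"
        using zs norm_triangle_ineq4[of "z (x + 1) - z x" "z (x + 1) - A - z x"] norm_triangle_ineq4[of "z (x + 1)" "z x"]
        by simp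
      have "norm (z (x + 2) - B - z x) \<le> 4 * \<epsilon>" using z0[of "x + 2"] by (simp add: B_def)
      moreover have "B = z (x + 2) - z x - (z (x + 2) - B - z x)" by simp
      ultimately have B: "norm B \<le> 6 * \<epsilon>"
        using zs norm_triangle_ineq4[of "z (x + 2) - z x" "z (x + 2) - B - z x"] norm_triangle_ineq4[of "z (x + 2)" "z x"]
        by simp
      have "p x = B - 2 *\<^sub>R A" by (simp add: A_def B_def scaleR_add_right) (simp add: scaleR_2)
      then have P: "norm (p x) \<le> 18 * \<epsilon>"
        using A B norm_triangle_ineq4[of B "2 *\<^sub>R A"] by simp
      have "z' x = A - (1/2) *\<^sub>R p x" by (simp add: A_def)
      then have "norm (z' x) \<le> 15 * \<epsilon>"
        using A P norm_triangle_ineq4[of A "(1/2) *\<^sub>R p x"] by simp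
      then show ?thesis using P \<epsilon> by simp
    qed
    then show ?thesis by blast
  qed
  have small: "\<forall>\<^sub>F x in at_infinity. norm (z' x) < \<epsilon> \<and> norm (p x) < \<epsilon>" if \<epsilon>: "\<epsilon> > 0" for \<epsilon>
  proof -
    obtain b where b: "\<And>x. \<bar>x\<bar> \<ge> b \<Longrightarrow> norm (z' x) \<le> 18 * (\<epsilon>/48) \<and> norm (p x) \<le> 24 * (\<epsilon>/48)"
      using key[of "\<epsilon>/48"] \<epsilon> by auto
    have "norm (z' x) < \<epsilon> \<and> norm (p x) < \<epsilon>" if "\<bar>x\<bar> \<ge> b" for x
      using b[OF that] \<epsilon> by auto
    then show ?thesis unfolding eventually_at_infinity real_norm_def by blast
  qed
  show "(z' \<longlongrightarrow> 0) at_infinity"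
  proof (rule tendstoI)
    fix \<epsilon> :: real assume "\<epsilon> > 0"
    from small[OF this] show "\<forall>\<^sub>F x in at_infinity. dist (z' x) 0 < \<epsilon>" by eventually_elim simp
  qed
  show "(p \<longlongrightarrow> 0) at_infinity"
  proof (rule tendstoI)
    fix \<epsilon> :: real assume "\<epsilon> > 0"
    from small[OF this] show "\<forall>\<^sub>F x in at_infinity. dist (p x) 0 < \<epsilon>" by eventually_elim simp
  qed
qed

lemma at_infinity_imp_both_ends:
  fixes f :: "real \<Rightarrow> 'a::topological_space"
  assumes "(f \<longlongrightarrow> l) at_infinity"
  shows "(f \<longlongrightarrow> l) at_bot" "(f \<longlongrightarrow> l) at_top"
  using tendsto_mono[OF at_bot_le_at_infinity assms] tendsto_mono[OF at_top_le_at_infinity assms] by auto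

lemma constant_of_derivative_0:
  fixes h :: "real \<Rightarrow> real"
  assumes "\<And>x. (h has_real_derivative 0) (at x)" "(h \<longlongrightarrow> 0) at_infinity"
  shows "h x = 0"
proof -
  have "h y = h x" for y using DERIV_isconst_all[of h y x] assms(1) by blast
  then have "h = (\<lambda>y. h x)" by blast
  then have "(h \<longlongrightarrow> h x) at_top" by (metis tendsto_const)
  then show ?thesis using at_infinity_imp_both_ends(2)[OF assms(2)] tendsto_unique trivial_limit_at_top_linorder by blast
qed

theorem theorem1p1:
  fixes W :: "(real ^ 'm) \<times> (real ^ 'm) \<Rightarrow> real"
    and Am Ap \<Omega> :: "(real ^ 'm) set"
    and q :: real
  assumes W_C2: "C2_on_space W"
    and W_nonneg: "\<And>u v. W (u, v) \<ge> 0"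
    and H1: "{u. W (u, 0) = 0} = Am \<union> Ap" "Am \<inter> Ap = {}" "Am \<noteq> {}" "Ap \<noteq> {}"
      "compact Am" "compact Ap"
    and H2: "open \<Omega>" "Am \<subseteq> \<Omega>" "Ap \<inter> closure \<Omega> = {}"
      "\<And>u v. u \<in> frontier \<Omega> \<Longrightarrow> W (u, v) > 0"
    and H3: "Liminf at_infinity (\<lambda>u. INF v. ereal (W (u, v))) > 0"
    and q: "0 < q" "q < setdist Am Ap / 2"
      "{u. infdist u Am \<le> q} \<subseteq> \<Omega>" "{u. infdist u Ap \<le> q} \<inter> closure \<Omega> = {}"
  shows "\<exists>u \<in> admissible Am Ap q.
    (\<forall>w \<in> admissible Am Ap q. J W u \<le> J W w) \<and> J W u < \<infinity> \<and>
    (Ck 4 u \<and>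
      (\<forall>x. (D ^^ 4) u x + grad_u W (u x) (D u x)
        - W_uv W (u x) (D u x) (D u x) - W_vv W (u x) (D u x) ((D ^^ 2) u x) = 0)) \<and>
    (((\<lambda>x. infdist (u x) Am) \<longlongrightarrow> 0) at_bot \<and> ((\<lambda>x. infdist (u x) Ap) \<longlongrightarrow> 0) at_top) \<and>
    (\<forall>k \<in> {1, 2, 3}. ((D ^^ k) u \<longlongrightarrow> 0) at_bot \<and> ((D ^^ k) u \<longlongrightarrow> 0) at_top) \<and>
    (\<forall>x. 1/2 * (norm ((D ^^ 2) u x))\<^sup>2 - W (u x, D u x)
        + grad_v W (u x) (D u x) \<bullet> D u x - (D ^^ 3) u x \<bullet> D u x = 0)"
proof -
  interpret double_well W Am Ap \<Omega> q
    by unfold_locales (fact assms)+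
  obtain u where adm: "u \<in> admissible Am Ap q" and min: "\<And>w. w \<in> admissible Am Ap q \<Longrightarrow> J W u \<le> J W w"
    and fin: "J W u < \<infinity>"
    using minimizer_exists by blast
  obtain z u2 u3 where H: "H2 u z u2" and d2: "\<And>x. (z has_vector_derivative u2 x) (at x)"
    and d3: "\<And>x. (u2 has_vector_derivative u3 x) (at x)"
    and dp: "\<And>x. ((\<lambda>x. u3 x - Wv W (u x, z x)) has_vector_derivative - Wu W (u x, z x)) (at x)"
    using Euler_Lagrange[OF adm min fin] by blast
  note d1 = H2_has_vector_derivative[OF H]
  define v where "v x = Wv W (u x, z x)" for x
  \<comment> \<open>The derivative of \<open>W_v\<close> along the path, by the chain rule; it
    contains only derivatives of \<open>u\<close> up to \<open>u2\<close>, so \<open>u4\<close> is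
    continuous and the fourth derivative is classical.\<close>
  define v' where "v' x = DWv W (u x, z x) (z x, u2 x)" for x
  define u4 where "u4 x = v' x - Wu W (u x, z x)" for x
  have dv: "(v has_vector_derivative v' x) (at x)" for x
  proof -
    have "((\<lambda>t. (u t, z t)) has_derivative (\<lambda>h. (h *\<^sub>R z x, h *\<^sub>R u2 x))) (at x)"
      using d1[of x] d2[of x] unfolding has_vector_derivative_def by (rule has_derivative_Pair)
    from has_derivative_compose[OF this C2_gradients(4)[OF W_C2]]
    have "(v has_derivative (\<lambda>h. DWv W (u x, z x) (h *\<^sub>R (z x, u2 x)))) (at x)"
      by (simp add: v_def[abs_def])
    moreover have "DWv W (u x, z x) (h *\<^sub>R (z x, u2 x)) = h *\<^sub>R v' x" for h
      unfolding v'_def by (rule linear_scale[OF has_derivative_linear[OF C2_gradients(4)[OF W_C2]]])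
    ultimately show ?thesis by (simp add: has_vector_derivative_def)
  qed
  have d4: "(u3 has_vector_derivative u4 x) (at x)" for x
    using has_vector_derivative_add[OF dp[of x] dv[of x]] by (simp add: v_def u4_def)
  have c0: "continuous_on UNIV u" "continuous_on UNIV z" using H2_continuous[OF H] .
  have c2: "continuous_on UNIV u2" and c3: "continuous_on UNIV u3"
    using d3 d4 by (auto intro!: continuous_at_imp_continuous_on intro: has_vector_derivative_continuous)
  have cWu: "continuous_on UNIV (\<lambda>x. Wu W (u x, z x))"
    by (rule continuous_on_compose2[OF C2_gradients(2)[OF W_C2]]) (auto intro!: continuous_intros c0)
  have "continuous_on UNIV (\<lambda>x. case ((u x, z x), (z x, u2 x)) of (p, h) \<Rightarrow> DWv W p h)"
    by (rule continuous_on_compose2[OF C2_gradients(5)[OF W_C2]]) (auto intro!: continuous_intros c0 c2)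
  then have c4: "continuous_on UNIV u4"
    unfolding u4_def v'_def by (intro continuous_intros cWu) simp
  have D: "D u = z" "D z = u2" "D u2 = u3" "D u3 = u4"
    using d1 d2 d3 d4 by (auto simp: D_def vector_derivative_at)
  have Dk: "(D ^^ 1) u = z" "(D ^^ 2) u = u2" "(D ^^ 3) u = u3" "(D ^^ 4) u = u4"
    by (simp_all add: eval_nat_numeral D)
  have "Ck 4 u"
    unfolding Ck_def Dk
  proof (intro conjI allI impI c4)
    fix k :: nat and x :: real assume "k < 4"
    then consider "k = 0" | "k = 1" | "k = 2" | "k = 3" by linarith
    then show "(D ^^ k) u differentiable (at x)"
      using differentiableI_vector[OF d1[of x]] differentiableI_vector[OF d2[of x]]
        differentiableI_vector[OF d3[of x]] differentiableI_vector[OF d4[of x]]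
      by cases (simp_all only: Dk funpow_0)
  qed
  moreover have "(D ^^ 4) u x + grad_u W (u x) (D u x)
        - W_uv W (u x) (D u x) (D u x) - W_vv W (u x) (D u x) ((D ^^ 2) u x) = 0" for x
    unfolding Dk D by (simp add: u4_def v'_def DWv_def Wu_def)
  moreover
  have finE: "energy W u z u2 < \<infinity>" using fin H2_J_eq_energy[OF H] by simp
  have z0: "(z \<longlongrightarrow> 0) at_infinity" by (rule finite_energy_derivative_tendsto_0[OF H finE])
  have dist0: "((\<lambda>x. infdist (u x) (Am \<union> Ap)) \<longlongrightarrow> 0) at_infinity"
    by (rule finite_energy_infdist_tendsto_0[OF H finE])
  have Wu0: "((\<lambda>x. Wu W (u x, z x)) \<longlongrightarrow> 0) at_infinity" and v0: "(v \<longlongrightarrow> 0) at_infinity"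
    and W0: "((\<lambda>x. W (u x, z x)) \<longlongrightarrow> 0) at_infinity"
    unfolding v_def[abs_def]
    using tendsto_along_zeros[OF C2_gradients(2)[OF W_C2] gradients_zero(1) dist0 z0]
      tendsto_along_zeros[OF C2_gradients(3)[OF W_C2] gradients_zero(2) dist0 z0]
      tendsto_along_zeros[OF W_continuous _ dist0 z0] zeros by blast+
  \<comment> \<open>Applied to the velocity \<open>z\<close>, whose limit is known: the role of
    \<open>p\<close> is played by \<open>u3 - v\<close>, whose derivative \<open>- Wu\<close> tends
    to 0, and the difference between \<open>u3\<close> and this \<open>p\<close> is
    \<open>v\<close>, which also tends to 0.\<close>
  have u20: "(u2 \<longlongrightarrow> 0) at_infinity" and p0: "((\<lambda>x. u3 x - v x) \<longlongrightarrow> 0) at_infinity"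
  proof -
    have "((\<lambda>x. - Wu W (u x, z x)) \<longlongrightarrow> 0) at_infinity" using tendsto_minus[OF Wu0] by simp
    moreover have "((\<lambda>x. u3 x - (u3 x - v x)) \<longlongrightarrow> 0) at_infinity" using v0 by simp
    ultimately show "(u2 \<longlongrightarrow> 0) at_infinity" "((\<lambda>x. u3 x - v x) \<longlongrightarrow> 0) at_infinity"
      using higher_derivatives_tendsto_0[OF d2 d3 dp[folded v_def] continuous_on_minus[OF cWu] c3 z0] by blast+
  qed
  have u30: "(u3 \<longlongrightarrow> 0) at_infinity" using tendsto_add[OF p0 v0] by simp
  have "((\<lambda>x. infdist (u x) Am) \<longlongrightarrow> 0) at_bot" "((\<lambda>x. infdist (u x) Ap) \<longlongrightarrow> 0) at_top"
  proof -
    obtain xm xp where x: "\<And>x. x \<le> xm \<Longrightarrow> infdist (u x) Am \<le> q" "\<And>x. x \<ge> xp \<Longrightarrow> infdist (u x) Ap \<le> q"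
      using adm admissible_iff_H2 by blast
    show "((\<lambda>x. infdist (u x) Am) \<longlongrightarrow> 0) at_bot"
      using infdist_well_tendsto(1)[OF at_infinity_imp_both_ends(1)[OF dist0]] x(1)
      unfolding eventually_at_bot_linorder by blast
    show "((\<lambda>x. infdist (u x) Ap) \<longlongrightarrow> 0) at_top"
      using infdist_well_tendsto(2)[OF at_infinity_imp_both_ends(2)[OF dist0]] x(2)
      unfolding eventually_at_top_linorder by blast
  qed
  moreover have "\<forall>k \<in> {1, 2, 3}. ((D ^^ k) u \<longlongrightarrow> 0) at_bot \<and> ((D ^^ k) u \<longlongrightarrow> 0) at_top"
    using at_infinity_imp_both_ends[OF z0] at_infinity_imp_both_ends[OF u20] at_infinity_imp_both_ends[OF u30] Dk
    by simp
  moreover have "1/2 * (norm ((D ^^ 2) u x))\<^sup>2 - W (u x, D u x)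
        + grad_v W (u x) (D u x) \<bullet> D u x - (D ^^ 3) u x \<bullet> D u x = 0" for x
  proof -
    define h where "h x = 1/2 * (u2 x \<bullet> u2 x) - W (u x, z x) + v x \<bullet> z x - u3 x \<bullet> z x" for x
    have "h x = 0"
    proof (rule constant_of_derivative_0[of h])
      fix x
      have inn: "((\<lambda>x. f x \<bullet> g x) has_real_derivative (f x \<bullet> g' + f' \<bullet> g x)) (at x)"
        if "(f has_vector_derivative f') (at x)" "(g has_vector_derivative g') (at x)" for f g :: "real \<Rightarrow> real ^ 'm" and f' g'
        unfolding has_real_derivative_iff_has_vector_derivative
        by (rule bounded_bilinear.has_vector_derivative[OF bounded_bilinear_inner that])
      have "(h has_real_derivative
          (1/2 * (u2 x \<bullet> u3 x + u3 x \<bullet> u2 x) - (z x \<bullet> Wu W (u x, z x) + u2 x \<bullet> Wv W (u x, z x))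
          + (v x \<bullet> u2 x + v' x \<bullet> z x) - (u3 x \<bullet> u2 x + u4 x \<bullet> z x))) (at x)"
        unfolding h_def
        by (intro DERIV_diff DERIV_add DERIV_cmult inn W_path_derivative d1 d2 d3 d4 dv)
      \<comment> \<open>The products of \<open>u3\<close> and of \<open>Wv\<close> with
        \<open>u2\<close> cancel in pairs; what remains is the equation, in the form
        \<open>u4 = v' - Wu\<close>, multiplied by \<open>z\<close>.\<close>
      moreover have "1/2 * (u2 x \<bullet> u3 x + u3 x \<bullet> u2 x) - (z x \<bullet> Wu W (u x, z x) + u2 x \<bullet> Wv W (u x, z x))
          + (v x \<bullet> u2 x + v' x \<bullet> z x) - (u3 x \<bullet> u2 x + u4 x \<bullet> z x) = 0"
        by (simp add: u4_def v_def inner_diff_left inner_diff_right inner_commute)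
      ultimately show "(h has_real_derivative 0) (at x)" by simp
    next
      have "((\<lambda>x. 1/2 * (u2 x \<bullet> u2 x) - W (u x, z x) + v x \<bullet> z x - u3 x \<bullet> z x)
          \<longlongrightarrow> 1/2 * (0 \<bullet> (0::real^'m)) - 0 + (0::real^'m) \<bullet> 0 - (0::real^'m) \<bullet> 0) at_infinity"
        by (intro tendsto_intros u20 W0 v0 z0 u30)
      then show "(h \<longlongrightarrow> 0) at_infinity" by (simp add: h_def[abs_def])
    qed
    then show ?thesis unfolding Dk D by (simp add: h_def v_def Wv_def power2_norm_eq_inner)
  qed
  ultimately show ?thesis using adm min fin by blast
qed

end
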